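(* (Heisenberg's uncertainty inequality for the MFrWT) Let $\psi$ be an admissible wavelet (with respect to $\boldsymbol\alpha,\lambda$) and let $f\in L^2(\mathbb{R}^N)$ with MFrWT $W_\psi^{\boldsymbol\alpha,\lambda}f$. Then $$\left(\int_{\mathbb{R}^N_0}\int_{\mathbb{R}^N}\|\boldsymbol b\|^2\,|(W_\psi^{\boldsymbol\alpha,\lambda}f)(\boldsymbol a,\boldsymbol b)|^2\,d\boldsymbol b\,\frac{d\boldsymbol a}{|\boldsymbol a|_m^2}\right)\left(\int_{\mathbb{R}^N}\|\boldsymbol\xi\|^2\,|(\mathfrak F_{\boldsymbol\alpha,\lambda}f)(\boldsymbol\xi)|^2\,d\boldsymbol\xi\right)\ \ge\ P_{\boldsymbol\alpha,\lambda}\,C_{\boldsymbol\alpha,\lambda}\,\frac{N^2}{4}\,\|f\|^4_{L^2(\mathbb{R}^N)},$$ where $$C_{\boldsymbol\alpha,\lambda}=(2\pi)^N\int_{\mathbb{R}^N_0}|(\mathfrak F_{\boldsymbol\alpha,\lambda}\psi)(\boldsymbol u)|^2\frac{d\boldsymbol u}{|\boldsymbol u|_m},\qquad P_{\boldsymbol\alpha,\lambda}=\frac{|c(\boldsymbol\alpha_\lambda)|^2\,|\sin\boldsymbol\alpha|_m}{M^2(\lambda^2)^{N+2}},\qquad M^2=\max_{1\le i\le N}\frac{1}{\sin^2\alpha_i}.$$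
   Context: $N\ge1$ is an integer, $\lambda\in\mathbb{R}\setminus\{0\}$, $\boldsymbol\alpha=(\alpha_1,\dots,\alpha_N)$ with $\alpha_k\in(-\pi,\pi)\setminus\{0\}$. $\|\cdot\|$ is the Euclidean norm on $\mathbb{R}^N$. For $\boldsymbol x\in\mathbb{R}^N$, $|\boldsymbol x|_m=|x_1x_2\cdots x_N|$ and $\mathbb{R}^N_0=\{\boldsymbol x\in\mathbb{R}^N:|\boldsymbol x|_m\ne0\}$; $\sin\boldsymbol\alpha=(\sin\alpha_1,\dots,\sin\alpha_N)$. Products and quotients of vectors are componentwise. Put $a(\alpha_k)=\tfrac12\cot\alpha_k$, $c(\alpha_k)=\sqrt{1-i\cot\alpha_k}$, $c(\boldsymbol\alpha_\lambda)=c(\alpha_1)\cdots c(\alpha_N)$, $e_{\boldsymbol\alpha,\pm\lambda^2}(\boldsymbol x)=e^{\pm i\lambda^2\sum_{k=1}^N a(\alpha_k)x_k^2}$. The multidimensional fractional Fourier transform (MFrFT) is $(\mathfrak F_{\boldsymbol\alpha,\lambda}f)(\boldsymbol\xi)=\int_{\mathbb{R}^N}f(\boldsymbol x)K_{\boldsymbol\alpha,\lambda}(\boldsymbol x,\boldsymbol\xi)\,d\boldsymbol x$ (extended to $L^2(\mathbb{R}^N)$ as usual), with kernel $K_{\boldsymbol\alpha,\lambda}(\boldsymbol x,\boldsymbol\xi)=\frac{c(\boldsymbol\alpha_\lambda)}{(\sqrt{2\pi})^N}e_{\boldsymbol\alpha,\lambda^2}(\boldsymbol x)e_{\boldsymbol\alpha,\lambda^2}(\boldsymbol\xi)e^{-i\lambda^2\sum_{k=1}^N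 x_k\xi_k\csc\alpha_k}$. An admissible wavelet is a non-zero $\psi\in L^2(\mathbb{R}^N)$ with $\int_{\mathbb{R}^N_0}|(\mathfrak F_{\boldsymbol\alpha,\lambda}\psi)(\boldsymbol u)|^2\frac{d\boldsymbol u}{|\boldsymbol u|_m}<\infty$. The multidimensional fractional wavelet transform (MFrWT) of $f\in L^2(\mathbb{R}^N)$ is, for $\boldsymbol a\in\mathbb{R}^N_0$, $\boldsymbol b\in\mathbb{R}^N$, $(W_\psi^{\boldsymbol\alpha,\lambda}f)(\boldsymbol a,\boldsymbol b)=\int_{\mathbb{R}^N}f(\boldsymbol t)\overline{\boldsymbol\Psi_{\boldsymbol\alpha,\lambda,\boldsymbol a,\boldsymbol b}(\boldsymbol t)}\,d\boldsymbol t$, where $\boldsymbol\Psi_{\boldsymbol\alpha,\lambda,\boldsymbol a,\boldsymbol b}(\boldsymbol t)=\overline{c(\boldsymbol\alpha_\lambda)}\,e_{\boldsymbol\alpha,\lambda^2}(\boldsymbol b)\,e_{\boldsymbol\alpha,-\lambda^2}(\boldsymbol t)\frac{1}{\sqrt{|\boldsymbol a|_m}}\tilde\psi\!\left(\frac{\boldsymbol t-\boldsymbol b}{\boldsymbol a}\right)$ and $\tilde\psi=\psi\,e_{\boldsymbol\alpha,\lambda^2}$. *)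

theory Defs
  imports "HOL-Analysis.Analysis"
begin

text \<open>
  The dimension \<open>N\<close> of the underlying space is \<open>CARD('n)\<close>; vectors of \<open>N\<close> real
  entries are elements of \<open>real ^ 'n\<close>.
\<close>

definition prod_abs :: "real ^ 'n \<Rightarrow> real" where
  "prod_abs x = \<bar>\<Prod>k\<in>UNIV. x $ k\<bar>"

definition nonzero_vecs :: "(real ^ 'n) set" where
  "nonzero_vecs = {x. prod_abs x \<noteq> 0}"

definition sin_vec :: "real ^ 'n \<Rightarrow> real ^ 'n" where
  "sin_vec \<alpha> = (\<chi> k. sin (\<alpha> $ k))"

definition vec_div :: "real ^ 'n \<Rightarrow> real ^ 'n \<Rightarrow> real ^ 'n" where
  "vec_div x y = (\<chi> k. x $ k / y $ k)"

definition a_coeff :: "real \<Rightarrow> real" where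
  "a_coeff \<theta> = cot \<theta> / 2"

definition c_coeff :: "real \<Rightarrow> complex" where
  "c_coeff \<theta> = csqrt (1 - \<i> * of_real (cot \<theta>))"

definition c_vec :: "real ^ 'n \<Rightarrow> complex" where
  "c_vec \<alpha> = (\<Prod>k\<in>UNIV. c_coeff (\<alpha> $ k))"

text \<open>The factor \<open>e\<close> with subscript \<open>\<alpha>, \<plusminus>\<lambda>\<^sup>2\<close> is \<open>chirp \<alpha> s\<close> with \<open>s = \<plusminus>\<lambda>\<^sup>2\<close>.\<close>

definition chirp :: "real ^ 'n \<Rightarrow> real \<Rightarrow> real ^ 'n \<Rightarrow> complex" where
  "chirp \<alpha> s x = exp (\<i> * of_real (s * (\<Sum>k\<in>UNIV. a_coeff (\<alpha> $ k) * (x $ k)\<^sup>2)))"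

text \<open>
  Square integrability is with respect to Lebesgue measure (not only its Borel restriction).
  Elements of \<open>L\<^sup>2\<close> are represented by functions; equality in \<open>L\<^sup>2\<close> is equality
  almost everywhere.
\<close>

definition square_integrable :: "(real ^ 'n \<Rightarrow> complex) \<Rightarrow> bool" where
  "square_integrable f \<longleftrightarrow>
     f \<in> borel_measurable lebesgue \<and> integrable lebesgue (\<lambda>x. (cmod (f x))\<^sup>2)"

definition L2_norm :: "(real ^ 'n \<Rightarrow> complex) \<Rightarrow> real" where
  "L2_norm f = sqrt (LINT x|lebesgue. (cmod (f x))\<^sup>2)"

definition L2_tendsto :: "(nat \<Rightarrow> real ^ 'n \<Rightarrow> complex) \<Rightarrow> (real ^ 'n \<Rightarrow> complex) \<Rightarrow> bool" where
  "L2_tendsto h f \<longleftrightarrow>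
     (\<lambda>n. \<integral>\<^sup>+x. ennreal ((cmod (h n x - f x))\<^sup>2) \<partial>lebesgue) \<longlonglongrightarrow> 0"

definition mfrft_kernel :: "real ^ 'n \<Rightarrow> real \<Rightarrow> real ^ 'n \<Rightarrow> real ^ 'n \<Rightarrow> complex" where
  "mfrft_kernel \<alpha> lam x \<xi> =
     c_vec \<alpha> / of_real (sqrt (2 * pi) ^ CARD('n)) * chirp \<alpha> (lam\<^sup>2) x * chirp \<alpha> (lam\<^sup>2) \<xi> *
     exp (- \<i> * of_real (lam\<^sup>2 * (\<Sum>k\<in>UNIV. x $ k * \<xi> $ k * (1 / sin (\<alpha> $ k)))))"

definition mfrft_L1 ::
  "real ^ 'n \<Rightarrow> real \<Rightarrow> (real ^ 'n \<Rightarrow> complex) \<Rightarrow> real ^ 'n \<Rightarrow> complex" where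
  "mfrft_L1 \<alpha> lam f \<xi> = (LINT x|lebesgue. f x * mfrft_kernel \<alpha> lam x \<xi>)"

text \<open>
  The extension of the transform from \<open>L\<^sup>1 \<inter> L\<^sup>2\<close> to \<open>L\<^sup>2\<close> by density and continuity:
  \<open>g\<close> is the \<open>L\<^sup>2\<close>-limit of the integral transforms of functions of \<open>L\<^sup>1 \<inter> L\<^sup>2\<close>
  that converge to \<open>f\<close> in \<open>L\<^sup>2\<close>. Such a \<open>g\<close> exists and is unique up to null sets by the
  Plancherel theorem; the choice operator only selects a representative of its class.
\<close>

definition is_mfrft ::
  "real ^ 'n \<Rightarrow> real \<Rightarrow> (real ^ 'n \<Rightarrow> complex) \<Rightarrow> (real ^ 'n \<Rightarrow> complex) \<Rightarrow> bool" where
  "is_mfrft \<alpha> lam f g \<longleftrightarrow> square_integrable g \<and>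
     (\<exists>h. (\<forall>n. integrable lebesgue (h n) \<and> square_integrable (h n)) \<and>
          L2_tendsto h f \<and> L2_tendsto (\<lambda>n. mfrft_L1 \<alpha> lam (h n)) g)"

definition mfrft ::
  "real ^ 'n \<Rightarrow> real \<Rightarrow> (real ^ 'n \<Rightarrow> complex) \<Rightarrow> real ^ 'n \<Rightarrow> complex" where
  "mfrft \<alpha> lam f = (SOME g. is_mfrft \<alpha> lam f g)"

definition admissible_wavelet ::
  "real ^ 'n \<Rightarrow> real \<Rightarrow> (real ^ 'n \<Rightarrow> complex) \<Rightarrow> bool" where
  "admissible_wavelet \<alpha> lam \<psi> \<longleftrightarrow>
     square_integrable \<psi> \<and> \<not> (AE x in lebesgue. \<psi> x = 0) \<and>
     (\<integral>\<^sup>+u\<in>nonzero_vecs. ennreal ((cmod (mfrft \<alpha> lam \<psi> u))\<^sup>2 / prod_abs u) \<partial>lebesgue) < \<infinity>"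

definition tilde_wavelet ::
  "real ^ 'n \<Rightarrow> real \<Rightarrow> (real ^ 'n \<Rightarrow> complex) \<Rightarrow> real ^ 'n \<Rightarrow> complex" where
  "tilde_wavelet \<alpha> lam \<psi> t = \<psi> t * chirp \<alpha> (lam\<^sup>2) t"

definition wavelet_family ::
  "real ^ 'n \<Rightarrow> real \<Rightarrow> (real ^ 'n \<Rightarrow> complex) \<Rightarrow> real ^ 'n \<Rightarrow> real ^ 'n \<Rightarrow> real ^ 'n \<Rightarrow> complex" where
  "wavelet_family \<alpha> lam \<psi> a b t =
     cnj (c_vec \<alpha>) * chirp \<alpha> (lam\<^sup>2) b * chirp \<alpha> (- (lam\<^sup>2)) t *
     of_real (1 / sqrt (prod_abs a)) * tilde_wavelet \<alpha> lam \<psi> (vec_div (t - b) a)"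

definition mfrwt ::
  "real ^ 'n \<Rightarrow> real \<Rightarrow> (real ^ 'n \<Rightarrow> complex) \<Rightarrow> (real ^ 'n \<Rightarrow> complex) \<Rightarrow>
     real ^ 'n \<Rightarrow> real ^ 'n \<Rightarrow> complex" where
  "mfrwt \<alpha> lam \<psi> f a b = (LINT t|lebesgue. f t * cnj (wavelet_family \<alpha> lam \<psi> a b t))"

definition C_const :: "real ^ 'n \<Rightarrow> real \<Rightarrow> (real ^ 'n \<Rightarrow> complex) \<Rightarrow> real" where
  "C_const \<alpha> lam \<psi> =
     (2 * pi) ^ CARD('n) *
     (LINT u:nonzero_vecs|lebesgue. (cmod (mfrft \<alpha> lam \<psi> u))\<^sup>2 / prod_abs u)"

definition M_sq :: "real ^ 'n \<Rightarrow> real" where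
  "M_sq \<alpha> = Max (range (\<lambda>i. 1 / (sin (\<alpha> $ i))\<^sup>2))"

definition P_const :: "real ^ 'n \<Rightarrow> real \<Rightarrow> real" where
  "P_const \<alpha> lam =
     (cmod (c_vec \<alpha>))\<^sup>2 * prod_abs (sin_vec \<alpha>) / (M_sq \<alpha> * (lam\<^sup>2) ^ (CARD('n) + 2))"

end

theory Submission
  imports Defs "HOL-Probability.Probability"
begin

text \<open>
  The factor \<open>e\<close> of the kernel has modulus one. Put \<open>g = f e\<close> and \<open>\<phi> = \<psi> e\<close>, and let \<open>\<gamma>\<close>, \<open>\<omega>\<close>
  be their ordinary Fourier transforms. Up to a unimodular factor, the MFrFT of \<open>f\<close> is a constant
  times \<open>\<gamma>\<close> read at a componentwise dilated frequency, and the MFrWT of \<open>f\<close> is \<open>c(\<alpha>)\<close> times the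
  classical wavelet coefficient of \<open>g\<close> with respect to \<open>\<phi>\<close>. Because \<open>\<bar>c(\<alpha>)\<bar>\<^sup>2 \<Prod>\<bar>sin \<alpha>\<^sub>k\<bar> = 1\<close>, the
  constants collapse and it is enough to prove, with \<open>K = \<integral> \<bar>\<omega>(u)\<bar>\<^sup>2 / \<bar>u\<bar> du\<close>, the inequality
  \<open>K N\<^sup>2/4 \<parallel>g\<parallel>\<^sup>4 \<le> (\<integral>\<integral> \<parallel>b\<parallel>\<^sup>2 \<bar>W(a,b)\<bar>\<^sup>2 db da/\<bar>a\<bar>\<^sup>2) ((2\<pi>)\<^sup>-\<^sup>N \<integral> \<parallel>\<eta>\<parallel>\<^sup>2 \<bar>\<gamma>(\<eta>)\<bar>\<^sup>2 d\<eta>)\<close>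
  for classical coefficients \<open>W\<close>; this is \<open>wavelet_uncertainty\<close>.

  Two properties of the wavelet transform give it. First, \<open>g \<mapsto> W/\<bar>a\<bar>\<close> multiplies the squared norm by
  \<open>K\<close> (\<open>weighted_coeff_isometry\<close>): for fixed \<open>a\<close> the function \<open>b \<mapsto> W(a,b)\<close> is, up to constants, an inverse
  Fourier transform of \<open>\<gamma>(\<eta>) cnj (\<omega>(a \<eta>))\<close>, Plancherel's theorem computes its energy, and
  \<open>\<integral> \<bar>\<omega>(a \<eta>)\<bar>\<^sup>2 / \<bar>a\<bar> da\<close> does not depend on \<open>\<eta>\<close>. Secondly, translating \<open>g\<close> translates \<open>W\<close> in \<open>b\<close>.

  The uncertainty principle is then obtained without differentiating anything
  (\<open>Heisenberg_finite_differences\<close>). If \<open>T\<close> is the translation by \<open>s\<close> along a unit vector \<open>e\<close>, the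
  substitution \<open>x \<mapsto> x + s e\<close> gives
  \<open>s \<parallel>H\<parallel>\<^sup>2 = \<integral> (x \<bullet> e) (\<bar>H\<bar>\<^sup>2 - \<bar>T H\<bar>\<^sup>2) \<le> \<parallel>T H - H\<parallel> (2 \<parallel>(x \<bullet> e) H\<parallel> + s \<parallel>H\<parallel>)\<close>.
  For \<open>H = W/\<bar>a\<bar>\<close> and a direction of the \<open>b\<close>-space, the two properties turn \<open>\<parallel>T H - H\<parallel>\<close> into
  \<open>\<surd>K \<parallel>T g - g\<parallel>\<close>, which is at most \<open>s \<surd>(K (2\<pi>)\<^sup>-\<^sup>N) \<parallel>\<eta>\<^sub>k \<gamma>\<parallel>\<close> because a translation acts on \<open>\<gamma>\<close> as
  multiplication by \<open>cis (s \<eta>\<^sub>k)\<close>. Divide by \<open>s\<close>, let \<open>s\<close> tend to \<open>0\<close>, and add the \<open>N\<close> coordinate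
  inequalities with the Cauchy-Schwarz inequality: this is where \<open>N\<^sup>2\<close> comes from.

  Plancherel's theorem on \<open>L\<^sup>1 \<inter> L\<^sup>2\<close> is proved by Gaussian regularisation and the continuity of
  translations in \<open>L\<^sup>2\<close>. On \<open>L\<^sup>2\<close> the Fourier transform is handled as a relation, the closure of its
  graph on \<open>L\<^sup>1 \<inter> L\<^sup>2\<close>, so that no representative of a class ever has to be chosen.
\<close>

section \<open>Square-integrable functions\<close>

definition sq_int :: "'a measure \<Rightarrow> ('a \<Rightarrow> complex) \<Rightarrow> bool" where
  "sq_int M f \<longleftrightarrow> f \<in> borel_measurable M \<and> integrable M (\<lambda>x. (cmod (f x))\<^sup>2)"

definition norm2 :: "'a measure \<Rightarrow> ('a \<Rightarrow> complex) \<Rightarrow> real" where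
  "norm2 M f = sqrt (LINT x|M. (cmod (f x))\<^sup>2)"

lemma sq_int_measurable [measurable_dest]: "sq_int M f \<Longrightarrow> f \<in> borel_measurable M"
  by (simp add: sq_int_def)

lemma norm2_nonneg [simp]: "0 \<le> norm2 M f"
  by (simp add: norm2_def)

lemma norm2_power2: "(norm2 M f)\<^sup>2 = (LINT x|M. (cmod (f x))\<^sup>2)"
  by (simp add: norm2_def)

lemma sq_int_nn_integral:
  "sq_int M f \<Longrightarrow> (\<integral>\<^sup>+x. ennreal ((cmod (f x))\<^sup>2) \<partial>M) = ennreal ((norm2 M f)\<^sup>2)"
  unfolding norm2_power2 sq_int_def by (intro nn_integral_eq_integral) auto

lemma sq_intI_nn_integral:
  assumes "f \<in> borel_measurable M" "(\<integral>\<^sup>+x. ennreal ((cmod (f x))\<^sup>2) \<partial>M) < \<infinity>"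
  shows "sq_int M f"
  using assms unfolding sq_int_def by (auto intro!: integrableI_nonneg)

text \<open>
  A pointwise bound transfers square integrability. Unimodular factors, conjugates and cut-offs are
  all treated through this lemma.
\<close>

lemma sq_int_bound:
  assumes "sq_int M f" "g \<in> borel_measurable M" "\<And>x. cmod (g x) \<le> C * cmod (f x)"
  shows "sq_int M g"
  unfolding sq_int_def
proof
  have "cmod (g x) ^ 2 \<le> C\<^sup>2 * (cmod (f x))\<^sup>2" for x
    using power_mono[OF assms(3)[of x], of 2] by (simp add: power_mult_distrib)
  then have "AE x in M. norm ((cmod (g x))\<^sup>2) \<le> norm (C\<^sup>2 * (cmod (f x))\<^sup>2)"
    by (intro AE_I2) (simp add: abs_mult)
  moreover have "integrable M (\<lambda>x. C\<^sup>2 * (cmod (f x))\<^sup>2)"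
    using assms(1) by (simp add: sq_int_def)
  moreover have "(\<lambda>x. (cmod (g x))\<^sup>2) \<in> borel_measurable M"
    using assms(2) by simp
  ultimately show "integrable M (\<lambda>x. (cmod (g x))\<^sup>2)"
    using Bochner_Integration.integrable_bound by blast
qed fact

lemma sq_int_cmult: "sq_int M f \<Longrightarrow> sq_int M (\<lambda>x. c * f x)"
  by (rule sq_int_bound[where C = "cmod c"]) (auto simp: norm_mult)

lemma borel_measurable_cnj [measurable (raw)]:
  "f \<in> borel_measurable M \<Longrightarrow> (\<lambda>x. cnj (f x)) \<in> borel_measurable M"
  by (rule borel_measurable_continuous_on[of cnj]) (simp_all add: continuous_on_cnj continuous_on_id)

lemma sq_int_cnj: "sq_int M f \<Longrightarrow> sq_int M (\<lambda>x. cnj (f x))"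
  by (rule sq_int_bound[where C = 1]) auto

lemma norm2_cnj [simp]: "norm2 M (\<lambda>x. cnj (f x)) = norm2 M f"
  by (simp add: norm2_def)

lemma norm2_cmult: "norm2 M (\<lambda>x. c * f x) = cmod c * norm2 M f"
  by (simp add: norm2_def norm_mult power_mult_distrib real_sqrt_mult)

lemma norm_add_power2_le: "(cmod (a + b))\<^sup>2 \<le> 2 * (cmod a)\<^sup>2 + 2 * (cmod b)\<^sup>2"
proof -
  have "(cmod (a + b))\<^sup>2 \<le> (cmod a + cmod b)\<^sup>2"
    by (intro power_mono norm_triangle_ineq) auto
  also have "\<dots> \<le> 2 * (cmod a)\<^sup>2 + 2 * (cmod b)\<^sup>2"
    using sum_squares_ge_zero[of "cmod a - cmod b" 0] by (simp add: power2_eq_square algebra_simps)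
  finally show ?thesis .
qed

lemma sq_int_add:
  assumes "sq_int M f" "sq_int M g" shows "sq_int M (\<lambda>x. f x + g x)"
  unfolding sq_int_def
proof
  show "integrable M (\<lambda>x. (cmod (f x + g x))\<^sup>2)"
  proof (rule Bochner_Integration.integrable_bound)
    show "integrable M (\<lambda>x. 2 * (cmod (f x))\<^sup>2 + 2 * (cmod (g x))\<^sup>2)"
      using assms by (simp add: sq_int_def)
    show "AE x in M. norm ((cmod (f x + g x))\<^sup>2)
        \<le> norm (2 * (cmod (f x))\<^sup>2 + 2 * (cmod (g x))\<^sup>2)"
      by (intro AE_I2) (simp add: norm_add_power2_le)
  qed (use assms in \<open>auto simp: sq_int_def\<close>)
qed (use assms in \<open>auto simp: sq_int_def\<close>)

lemma sq_int_diff: "sq_int M f \<Longrightarrow> sq_int M g \<Longrightarrow> sq_int M (\<lambda>x. f x - g x)"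
  using sq_int_add[of M f "\<lambda>x. (-1) * g x"] sq_int_cmult[of M g "-1"] by simp

lemma sq_int_mult_integrable:
  assumes "sq_int M f" "sq_int M g" shows "integrable M (\<lambda>x. f x * g x)"
proof (rule Bochner_Integration.integrable_bound)
  show "integrable M (\<lambda>x. (cmod (f x))\<^sup>2 + (cmod (g x))\<^sup>2)"
    using assms by (auto simp: sq_int_def)
  have "cmod (f x) * cmod (g x) \<le> (cmod (f x))\<^sup>2 + (cmod (g x))\<^sup>2" for x
  proof -
    have "0 \<le> cmod (f x) * cmod (g x)" by simp
    then show ?thesis
      using sum_squares_bound[of "cmod (f x)" "cmod (g x)"] by linarith
  qed
  then show "AE x in M. cmod (f x * g x) \<le> norm ((cmod (f x))\<^sup>2 + (cmod (g x))\<^sup>2)"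
    by (simp add: norm_mult)
qed (use assms in \<open>auto simp: sq_int_def\<close>)

lemma Cauchy_Schwarz_norm2:
  assumes f: "sq_int M f" and g: "sq_int M g"
  shows "(LINT x|M. cmod (f x) * cmod (g x)) \<le> norm2 M f * norm2 M g"
proof -
  have [measurable]: "f \<in> borel_measurable M" "g \<in> borel_measurable M"
    using f g by auto
  have "integrable M (\<lambda>x. cmod (f x) * cmod (g x))"
    using integrable_norm[OF sq_int_mult_integrable[OF f g]] by (simp add: norm_mult)
  then have eq: "(\<integral>\<^sup>+x. ennreal (cmod (f x)) * ennreal (cmod (g x)) \<partial>M) =
      ennreal (LINT x|M. cmod (f x) * cmod (g x))"
    by (subst nn_integral_eq_integral[symmetric]) (auto simp: ennreal_mult)
  have "(\<integral>\<^sup>+x. ennreal (cmod (f x)) * ennreal (cmod (g x)) \<partial>M)\<^sup>2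
     \<le> (\<integral>\<^sup>+x. (ennreal (cmod (f x)))\<^sup>2 \<partial>M) * (\<integral>\<^sup>+x. (ennreal (cmod (g x)))\<^sup>2 \<partial>M)"
    by (rule Cauchy_Schwarz_nn_integral) auto
  also have "\<dots> = ennreal ((norm2 M f)\<^sup>2) * ennreal ((norm2 M g)\<^sup>2)"
    by (simp only: ennreal_power norm_ge_zero sq_int_nn_integral[OF f] sq_int_nn_integral[OF g])
  also have "\<dots> = ennreal ((norm2 M f * norm2 M g)\<^sup>2)"
    by (simp only: ennreal_mult[symmetric] zero_le_power2 power_mult_distrib)
  also have "(\<integral>\<^sup>+x. ennreal (cmod (f x)) * ennreal (cmod (g x)) \<partial>M)\<^sup>2
      = ennreal ((LINT x|M. cmod (f x) * cmod (g x))\<^sup>2)"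
    unfolding eq by (intro ennreal_power integral_nonneg_AE AE_I2) simp
  finally have "ennreal ((LINT x|M. cmod (f x) * cmod (g x))\<^sup>2) \<le> ennreal ((norm2 M f * norm2 M g)\<^sup>2)" .
  then have "(LINT x|M. cmod (f x) * cmod (g x))\<^sup>2 \<le> (norm2 M f * norm2 M g)\<^sup>2"
    by (subst (asm) ennreal_le_iff) auto
  then show ?thesis
    by (rule power2_le_imp_le) auto
qed

lemma Cauchy_Schwarz_norm2_integral:
  assumes f: "sq_int M f" and g: "sq_int M g"
  shows "cmod (LINT x|M. f x * g x) \<le> norm2 M f * norm2 M g"
proof -
  have "cmod (LINT x|M. f x * g x) \<le> (LINT x|M. cmod (f x * g x))"
    by (rule integral_norm_bound)
  also have "\<dots> \<le> norm2 M f * norm2 M g"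
    using Cauchy_Schwarz_norm2[OF f g] by (simp add: norm_mult)
  finally show ?thesis .
qed

lemma norm2_triangle:
  assumes f: "sq_int M f" and g: "sq_int M g"
  shows "norm2 M (\<lambda>x. f x + g x) \<le> norm2 M f + norm2 M g"
proof -
  have i: "integrable M (\<lambda>x. (cmod (f x))\<^sup>2)" "integrable M (\<lambda>x. (cmod (g x))\<^sup>2)"
    "integrable M (\<lambda>x. (cmod (f x + g x))\<^sup>2)" "integrable M (\<lambda>x. cmod (f x) * cmod (g x))"
    using f g sq_int_add[OF f g] integrable_norm[OF sq_int_mult_integrable[OF f g]]
    by (auto simp: sq_int_def norm_mult)
  have "(LINT x|M. (cmod (f x + g x))\<^sup>2)
      \<le> (LINT x|M. (cmod (f x))\<^sup>2 + (2 * (cmod (f x) * cmod (g x)) + (cmod (g x))\<^sup>2))"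
  proof (rule integral_mono)
    fix x
    have "(cmod (f x + g x))\<^sup>2 \<le> (cmod (f x) + cmod (g x))\<^sup>2"
      by (intro power_mono norm_triangle_ineq) auto
    then show "(cmod (f x + g x))\<^sup>2
        \<le> (cmod (f x))\<^sup>2 + (2 * (cmod (f x) * cmod (g x)) + (cmod (g x))\<^sup>2)"
      by (simp add: power2_eq_square algebra_simps)
  qed (use i in auto)
  also have "\<dots> = (norm2 M f)\<^sup>2 + (2 * (LINT x|M. cmod (f x) * cmod (g x)) + (norm2 M g)\<^sup>2)"
    using i by (simp add: norm2_power2)
  also have "\<dots> \<le> (norm2 M f + norm2 M g)\<^sup>2"
    using Cauchy_Schwarz_norm2[OF f g] by (simp add: power2_eq_square algebra_simps)
  finally show ?thesis
    unfolding norm2_power2[symmetric] by (rule power2_le_imp_le) simp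
qed

lemma norm2_minus_commute: "norm2 M (\<lambda>x. f x - g x) = norm2 M (\<lambda>x. g x - f x)"
  by (simp add: norm2_def norm_minus_commute)

lemma norm2_triangle_diff:
  assumes f: "sq_int M f" and g: "sq_int M g" and h: "sq_int M h"
  shows "norm2 M (\<lambda>x. f x - h x) \<le> norm2 M (\<lambda>x. f x - g x) + norm2 M (\<lambda>x. g x - h x)"
  using norm2_triangle[OF sq_int_diff[OF f g] sq_int_diff[OF g h]] by simp

lemma norm2_le_plus_diff:
  assumes f: "sq_int M f" and g: "sq_int M g"
  shows "norm2 M f \<le> norm2 M g + norm2 M (\<lambda>x. f x - g x)"
  using norm2_triangle[OF g sq_int_diff[OF f g]] by simp

lemma norm2_tendsto:
  assumes h: "\<And>n. sq_int M (h n)" and f: "sq_int M f"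
    and lim: "(\<lambda>n. norm2 M (\<lambda>x. h n x - f x)) \<longlonglongrightarrow> 0"
  shows "(\<lambda>n. norm2 M (h n)) \<longlonglongrightarrow> norm2 M f"
proof (rule LIM_zero_cancel, rule Lim_null_comparison[OF _ lim], rule always_eventually, rule allI)
  fix n
  show "norm (norm2 M (h n) - norm2 M f) \<le> norm2 M (\<lambda>x. h n x - f x)"
    using norm2_le_plus_diff[OF h[of n] f] norm2_le_plus_diff[OF f h[of n]]
    by (simp add: norm2_minus_commute[of M f])
qed

lemma norm2_cong_AE:
  assumes "AE x in M. f x = g x" "f \<in> borel_measurable M" "g \<in> borel_measurable M"
  shows "norm2 M f = norm2 M g"
proof -
  have "(LINT x|M. (cmod (f x))\<^sup>2) = (LINT x|M. (cmod (g x))\<^sup>2)"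
    using assms by (intro integral_cong_AE) (auto elim: eventually_mono)
  then show ?thesis by (simp add: norm2_def)
qed

lemma norm2_mono:
  assumes "sq_int M f" "sq_int M g" "\<And>x. cmod (f x) \<le> cmod (g x)"
  shows "norm2 M f \<le> norm2 M g"
  unfolding norm2_def using assms
  by (intro real_sqrt_le_mono integral_mono power_mono) (auto simp: sq_int_def)

lemma polarization_complex:
  "z * cnj w = (of_real ((cmod (z + w))\<^sup>2) - of_real ((cmod (z - w))\<^sup>2)
     + \<i> * (of_real ((cmod (z + \<i> * w))\<^sup>2) - of_real ((cmod (z - \<i> * w))\<^sup>2))) / 4"
  unfolding cmod_power2 by (simp add: complex_eq_iff power2_eq_square algebra_simps)

text \<open>
  Inner products are determined by norms. A linear map that scales all norms by the same factor
  therefore scales inner products too, which is how \<open>fourier_L2_inner\<close> follows from \<open>fourier_L2_isometry\<close>.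
\<close>

lemma polarization_norm2:
  assumes f: "sq_int M f" and g: "sq_int M g"
  shows "(LINT x|M. f x * cnj (g x)) =
    (of_real ((norm2 M (\<lambda>x. f x + g x))\<^sup>2) - of_real ((norm2 M (\<lambda>x. f x - g x))\<^sup>2)
     + \<i> * (of_real ((norm2 M (\<lambda>x. f x + \<i> * g x))\<^sup>2)
            - of_real ((norm2 M (\<lambda>x. f x - \<i> * g x))\<^sup>2))) / 4"
proof -
  note ig = sq_int_cmult[OF g, of \<i>]
  note s = sq_int_add[OF f g] sq_int_diff[OF f g] sq_int_add[OF f ig] sq_int_diff[OF f ig]
  then have i: "integrable M (\<lambda>x. complex_of_real ((cmod (f x + g x))\<^sup>2))"
    "integrable M (\<lambda>x. complex_of_real ((cmod (f x - g x))\<^sup>2))"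
    "integrable M (\<lambda>x. complex_of_real ((cmod (f x + \<i> * g x))\<^sup>2))"
    "integrable M (\<lambda>x. complex_of_real ((cmod (f x - \<i> * g x))\<^sup>2))"
    by (auto simp: sq_int_def intro!: integrable_of_real simp del: of_real_power)
  show ?thesis
    unfolding polarization_complex norm2_power2 using i
    by (simp del: of_real_power add: integral_complex_of_real)
qed

lemma ennreal_le_suminf: "F k \<le> (\<Sum>k. F k :: ennreal)"
  using sum_le_suminf[of F "{k}"] by simp

text \<open>
  Riesz-Fischer. Along a subsequence the successive differences have norm at most \<open>4\<^sup>-\<^sup>k\<close>, so
  \<open>\<Sum> 4\<^sup>k \<bar>difference\<bar>\<^sup>2\<close> has a finite integral and is finite almost everywhere; there the
  differences are dominated by a geometric series and the subsequence converges. Fatou's lemma turns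
  the pointwise limit into a limit in norm.
\<close>

lemma l2_complete:
  assumes h: "\<And>n. sq_int M (h n)"
    and Cauchy: "\<And>e. e > 0 \<Longrightarrow> \<exists>N. \<forall>m\<ge>N. \<forall>n\<ge>N. norm2 M (\<lambda>x. h m x - h n x) < e"
  shows "\<exists>g. sq_int M g \<and> (\<lambda>n. norm2 M (\<lambda>x. h n x - g x)) \<longlonglongrightarrow> 0"
proof -
  have "\<forall>k. \<exists>N. \<forall>m\<ge>N. \<forall>n\<ge>N. norm2 M (\<lambda>x. h m x - h n x) < (1/4)^k"
    using Cauchy by simp
  then obtain N where N: "\<And>k m n. m \<ge> N k \<Longrightarrow> n \<ge> N k \<Longrightarrow> norm2 M (\<lambda>x. h m x - h n x) < (1/4::real)^k"
    by metis
  define r where "r k = (\<Sum>i\<le>k. N i)" for k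
  have r_ge: "N k \<le> r j" if "k \<le> j" for k j
    unfolding r_def using that by (intro member_le_sum) auto
  have [measurable]: "h n \<in> borel_measurable M" for n
    using h by (rule sq_int_measurable)
  \<comment> \<open>Each term has integral at most \<open>4\<^sup>k 16\<^sup>-\<^sup>k = 4\<^sup>-\<^sup>k\<close>.\<close>
  define S where "S x = (\<Sum>k. ennreal (4^k * (cmod (h (r (Suc k)) x - h (r k) x))\<^sup>2))" for x
  have [measurable]: "S \<in> borel_measurable M" unfolding S_def by measurable
  have "(\<integral>\<^sup>+x. S x \<partial>M) = (\<Sum>k. \<integral>\<^sup>+x. ennreal (4^k * (cmod (h (r (Suc k)) x - h (r k) x))\<^sup>2) \<partial>M)"
    unfolding S_def by (intro nn_integral_suminf) measurable
  also have "\<dots> \<le> (\<Sum>k. ennreal ((1/4)^k))"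
  proof (intro suminf_le summableI)
    fix k
    let ?d = "\<lambda>x. h (r (Suc k)) x - h (r k) x"
    have "(\<integral>\<^sup>+x. ennreal (4^k * (cmod (?d x))\<^sup>2) \<partial>M) = ennreal (4^k) * (\<integral>\<^sup>+x. ennreal ((cmod (?d x))\<^sup>2) \<partial>M)"
      by (subst nn_integral_cmult[symmetric]) (auto simp: ennreal_mult)
    also have "\<dots> = ennreal (4^k * (norm2 M ?d)\<^sup>2)"
      by (simp add: sq_int_nn_integral[OF sq_int_diff[OF h h]] ennreal_mult)
    also have "\<dots> \<le> ennreal (4^k * ((1/4)^k)\<^sup>2)"
      using N[of k "r (Suc k)" "r k"] r_ge[of k "Suc k"] r_ge[of k k]
      by (intro ennreal_leI mult_left_mono power_mono) auto
    also have "(4::real)^k * ((1/4)^k)\<^sup>2 = (1/4)^k"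
      by (simp add: power2_eq_square power_divide)
    finally show "(\<integral>\<^sup>+x. ennreal (4^k * (cmod (?d x))\<^sup>2) \<partial>M) \<le> ennreal ((1/4)^k)" .
  qed
  also have "\<dots> = ennreal (\<Sum>k. (1/4)^k)"
    by (intro suminf_ennreal2 summable_geometric) auto
  finally have "(\<integral>\<^sup>+x. S x \<partial>M) \<noteq> \<infinity>"
    by (auto simp: top_unique)
  then have "AE x in M. S x \<noteq> \<infinity>"
    by (intro nn_integral_noteq_infinite) auto
  then have conv: "AE x in M. convergent (\<lambda>k. h (r k) x)"
  proof eventually_elim
    case (elim x)
    define s where "s = enn2real (S x)"
    have s: "S x = ennreal s" "0 \<le> s"
      using elim by (auto simp: s_def less_top)
    have "cmod (h (r (Suc k)) x - h (r k) x) \<le> sqrt s * (1/2)^k" for k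
    proof -
      have four: "((2::real)^k)\<^sup>2 = 4^k"
        by (subst power_mult[symmetric], subst mult.commute, subst power_mult) simp
      have "ennreal (4^k * (cmod (h (r (Suc k)) x - h (r k) x))\<^sup>2) \<le> S x"
        unfolding S_def
        by (rule ennreal_le_suminf[of "\<lambda>k. ennreal (4^k * (cmod (h (r (Suc k)) x - h (r k) x))\<^sup>2)"])
      then have "4^k * (cmod (h (r (Suc k)) x - h (r k) x))\<^sup>2 \<le> s"
        unfolding s(1) using s(2) by (subst (asm) ennreal_le_iff)
      then have "(2^k * cmod (h (r (Suc k)) x - h (r k) x))\<^sup>2 \<le> (sqrt s)\<^sup>2"
        unfolding power_mult_distrib four using s(2) by simp
      then have "2^k * cmod (h (r (Suc k)) x - h (r k) x) \<le> sqrt s"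
        by (rule power2_le_imp_le) (simp add: s(2))
      then show ?thesis
        by (simp add: power_one_over pos_le_divide_eq mult.commute)
    qed
    moreover have "summable (\<lambda>k. sqrt s * (1/2)^k)"
      by (intro summable_mult summable_geometric) simp
    ultimately have "summable (\<lambda>k. h (r (Suc k)) x - h (r k) x)"
      by (rule summable_comparison_test'[rotated])
    then have "convergent (\<lambda>n. \<Sum>k<n. h (r (Suc k)) x - h (r k) x)"
      by (simp add: summable_iff_convergent)
    then have "convergent (\<lambda>n. h (r 0) x + (h (r n) x - h (r 0) x))"
      by (subst (asm) sum_lessThan_telescope) (intro convergent_add convergent_const)
    then show ?case by simp
  qed
  define g where "g x = lim (\<lambda>k. h (r k) x)" for x
  have g[measurable]: "g \<in> borel_measurable M"
    unfolding g_def by measurable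
  have lim: "AE x in M. (\<lambda>k. h (r k) x) \<longlonglongrightarrow> g x"
    using conv unfolding g_def by eventually_elim (simp add: convergent_LIMSEQ_iff)
  have bnd: "(\<integral>\<^sup>+x. ennreal ((cmod (h n x - g x))\<^sup>2) \<partial>M) \<le> ennreal (((1/4)^k)\<^sup>2)" if n: "n \<ge> N k" for n k
  proof -
    have "AE x in M. ennreal ((cmod (h n x - g x))\<^sup>2)
       = liminf (\<lambda>j. ennreal ((cmod (h n x - h (r j) x))\<^sup>2))"
      using lim
    proof eventually_elim
      case (elim x)
      then have "(\<lambda>j. ennreal ((cmod (h n x - h (r j) x))\<^sup>2)) \<longlonglongrightarrow> ennreal ((cmod (h n x - g x))\<^sup>2)"
        by (intro tendsto_ennrealI tendsto_intros)
      then show ?case by (rule lim_imp_Liminf[symmetric, rotated]) simp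
    qed
    then have "(\<integral>\<^sup>+x. ennreal ((cmod (h n x - g x))\<^sup>2) \<partial>M)
        = (\<integral>\<^sup>+x. liminf (\<lambda>j. ennreal ((cmod (h n x - h (r j) x))\<^sup>2)) \<partial>M)"
      by (rule nn_integral_cong_AE)
    also have "\<dots> \<le> liminf (\<lambda>j. \<integral>\<^sup>+x. ennreal ((cmod (h n x - h (r j) x))\<^sup>2) \<partial>M)"
      by (rule nn_integral_liminf) measurable
    also have "\<dots> \<le> ennreal (((1/4)^k)\<^sup>2)"
    proof (rule Liminf_le, simp, rule eventually_sequentiallyI[of k])
      fix j assume "k \<le> j"
      then have "norm2 M (\<lambda>x. h n x - h (r j) x) \<le> (1/4)^k"
        using N[of k n "r j"] n r_ge[of k j] by auto
      then show "(\<integral>\<^sup>+x. ennreal ((cmod (h n x - h (r j) x))\<^sup>2) \<partial>M) \<le> ennreal (((1/4)^k)\<^sup>2)"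
        unfolding sq_int_nn_integral[OF sq_int_diff[OF h h]]
        by (intro ennreal_leI power_mono) auto
    qed
    finally show ?thesis .
  qed
  have sq: "sq_int M (\<lambda>x. h n x - g x)" if "n \<ge> N k" for n k
    using bnd[OF that] by (intro sq_intI_nn_integral) (auto intro: le_less_trans)
  have "sq_int M (\<lambda>x. h (N 0) x - (h (N 0) x - g x))"
    by (rule sq_int_diff[OF h sq[of 0]]) simp
  then have "sq_int M g" by simp
  moreover have "(\<lambda>n. norm2 M (\<lambda>x. h n x - g x)) \<longlonglongrightarrow> 0"
  proof (rule LIMSEQ_I)
    fix e :: real assume "e > 0"
    then obtain k where k: "(1/4)^k < e"
      using real_arch_pow_inv[of e "1/4"] by auto
    have "norm2 M (\<lambda>x. h n x - g x) < e" if "n \<ge> N k" for n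
    proof -
      have "(norm2 M (\<lambda>x. h n x - g x))\<^sup>2 \<le> ((1/4)^k)\<^sup>2"
        using bnd[OF that] unfolding sq_int_nn_integral[OF sq[OF that]] by simp
      then have "norm2 M (\<lambda>x. h n x - g x) \<le> (1/4)^k"
        by (rule power2_le_imp_le) simp
      then show ?thesis using k by simp
    qed
    then show "\<exists>no. \<forall>n\<ge>no. norm (norm2 M (\<lambda>x. h n x - g x) - 0) < e"
      by auto
  qed
  ultimately show ?thesis by blast
qed

section \<open>Translations and affine substitutions\<close>

lemma integrable_lborel_shift:
  fixes f :: "'a::euclidean_space \<Rightarrow> 'b::{banach, second_countable_topology}"
  assumes "integrable lborel f"
  shows "integrable lborel (\<lambda>x. f (x + c))"
proof -
  have "integrable (distr lborel borel ((+) c)) f"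
    using assms by (simp add: lborel_distr_plus)
  then show ?thesis
    by (subst (asm) integrable_distr_eq) (use assms in \<open>auto simp: add.commute\<close>)
qed

lemma integral_lborel_shift:
  fixes f :: "'a::euclidean_space \<Rightarrow> 'b::{banach, second_countable_topology}"
  assumes [measurable]: "f \<in> borel_measurable borel"
  shows "(LINT x|lborel. f (x + c)) = (LINT x|lborel. f x)"
proof -
  have "(LINT x|lborel. f x) = (LINT x|distr lborel borel ((+) c). f x)"
    by (simp add: lborel_distr_plus)
  also have "\<dots> = (LINT x|lborel. f (x + c))"
    by (subst integral_distr) (auto simp: add.commute)
  finally show ?thesis by simp
qed

lemma AE_lborel_shift:
  fixes c :: "'a::euclidean_space"
  assumes P: "AE x in lborel. P x" shows "AE x in lborel. P (c + x)"
proof -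
  have "AE x in distr lborel borel ((+) c). P x"
    using P by (simp only: lborel_distr_plus)
  then show ?thesis by (rule AE_distrD[rotated]) measurable
qed

lemma sq_int_shift:
  fixes u :: "'a::euclidean_space \<Rightarrow> complex"
  assumes "sq_int lborel u"
  shows "sq_int lborel (\<lambda>x. u (x + z))" "norm2 lborel (\<lambda>x. u (x + z)) = norm2 lborel u"
proof -
  have [measurable]: "u \<in> borel_measurable borel" using sq_int_measurable[OF assms] by simp
  show "sq_int lborel (\<lambda>x. u (x + z))"
    using assms integrable_lborel_shift[of "\<lambda>x. (cmod (u x))\<^sup>2" z] by (simp add: sq_int_def)
  show "norm2 lborel (\<lambda>x. u (x + z)) = norm2 lborel u"
    using integral_lborel_shift[of "\<lambda>x. (cmod (u x))\<^sup>2" z] by (simp add: norm2_def)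
qed

text \<open>
  The next three lemmas are the change of variables \<open>x = T y\<close> for a map \<open>T\<close> that scales volumes by
  the constant \<open>K\<close>. The hypothesis has the shape in which affine maps of Euclidean space are known to
  preserve Lebesgue measure up to a factor; it serves for homotheties and for componentwise dilations.
\<close>

lemma affine_density_nn_integral:
  fixes T :: "'a::euclidean_space \<Rightarrow> 'a" and f :: "'a \<Rightarrow> ennreal"
  assumes eq: "lborel = density (distr lborel borel T) (\<lambda>_. ennreal K)"
    and [measurable]: "T \<in> borel_measurable borel" "f \<in> borel_measurable borel"
  shows "(\<integral>\<^sup>+x. f x \<partial>lborel) = ennreal K * (\<integral>\<^sup>+x. f (T x) \<partial>lborel)"
  by (subst eq, subst nn_integral_density)
     (simp_all add: nn_integral_cmult nn_integral_distr)

lemma affine_density_integral: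
  fixes T :: "'a::euclidean_space \<Rightarrow> 'a" and f :: "'a \<Rightarrow> complex"
  assumes eq: "lborel = density (distr lborel borel T) (\<lambda>_. ennreal K)" and K: "K > 0"
    and [measurable]: "T \<in> borel_measurable borel" "f \<in> borel_measurable borel"
  shows "(LINT x|lborel. f x) = of_real K * (LINT x|lborel. f (T x))"
proof -
  have "(LINT x|lborel. f x) = (LINT x|density (distr lborel borel T) (\<lambda>_. ennreal K). f x)"
    using eq by simp
  also have "\<dots> = (LINT x|distr lborel borel T. K *\<^sub>R f x)"
    using K by (intro integral_density) auto
  also have "\<dots> = (LINT x|lborel. K *\<^sub>R f (T x))"
    by (intro integral_distr) auto
  also have "\<dots> = of_real K * (LINT x|lborel. f (T x))"
    by (simp only: integral_scaleR_right) (simp add: scaleR_conv_of_real)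
  finally show ?thesis .
qed

lemma affine_density_integrable:
  fixes T :: "'a::euclidean_space \<Rightarrow> 'a" and f :: "'a \<Rightarrow> 'b::{banach, second_countable_topology}"
  assumes eq: "lborel = density (distr lborel borel T) (\<lambda>_. ennreal K)" and K: "K > 0"
    and [measurable]: "T \<in> borel_measurable borel" and f: "integrable lborel f"
  shows "integrable lborel (\<lambda>x. f (T x))"
proof -
  have [measurable]: "f \<in> borel_measurable borel" using f by auto
  have "integrable (density (distr lborel borel T) (\<lambda>_. ennreal K)) f"
    using f eq by simp
  then have "integrable (distr lborel borel T) (\<lambda>x. K *\<^sub>R f x)"
    using K by (subst (asm) integrable_density) auto
  then have "integrable lborel (\<lambda>x. K *\<^sub>R f (T x))"
    by (subst (asm) integrable_distr_eq) auto
  then have "integrable lborel (\<lambda>x. inverse K *\<^sub>R K *\<^sub>R f (T x))"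
    by (rule integrable_scaleR_right[rotated])
  then show ?thesis using K by simp
qed

lemma integral_lborel_scale:
  fixes f :: "'a::euclidean_space \<Rightarrow> complex"
  assumes "c > 0" "f \<in> borel_measurable borel"
  shows "(LINT x|lborel. f x) = of_real (c ^ DIM('a)) * (LINT x|lborel. f (t + c *\<^sub>R x))"
proof (rule affine_density_integral)
  show "lborel = density (distr lborel borel (\<lambda>x. t + c *\<^sub>R x)) (\<lambda>_. ennreal (c ^ DIM('a)))"
    using lborel_affine[of c t] assms(1) by (simp only: abs_of_pos)
qed (use assms in auto)

lemma nn_integral_lborel_uminus:
  fixes f :: "'a::euclidean_space \<Rightarrow> ennreal"
  assumes [measurable]: "f \<in> borel_measurable borel"
  shows "(\<integral>\<^sup>+x. f (- x) \<partial>lborel) = (\<integral>\<^sup>+x. f x \<partial>lborel)"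
proof -
  have n: "(- 1 :: real) \<noteq> 0" by simp
  have "lborel = density (distr lborel borel (uminus :: 'a \<Rightarrow> 'a)) (\<lambda>_. ennreal 1)"
    using lborel_affine[OF n, of "0::'a"]
    unfolding add_0 scaleR_minus1_left abs_minus_cancel abs_one power_one .
  then have "(\<integral>\<^sup>+x. f x \<partial>lborel) = ennreal 1 * (\<integral>\<^sup>+x. f (- x) \<partial>lborel)"
    by (rule affine_density_nn_integral) auto
  then show ?thesis by (simp only: ennreal_1 mult_1)
qed

lemma AE_inner_Basis_nonzero:
  fixes e :: "'a::euclidean_space"
  assumes e: "e \<in> Basis"
  shows "AE x in lborel. x \<bullet> e \<noteq> 0"
proof -
  have "{x. x \<bullet> e = 0} \<in> null_sets lebesgue"
    using negligible_standard_hyperplane[OF e, of 0] by (simp add: negligible_iff_null_sets)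
  moreover have "{x. x \<bullet> e = 0} \<in> sets borel"
    using measurable_sets[of "\<lambda>x. x \<bullet> e" borel borel "{0}"] by (simp add: vimage_def)
  ultimately have "{x. x \<bullet> e = 0} \<in> null_sets lborel"
    by (simp add: null_sets_def)
  then show ?thesis using AE_not_in by fastforce
qed

section \<open>Continuity of translations in $L^1$ and $L^2$\<close>

lemma tendsto_0_if_le_eps_plus_null:
  fixes a :: "nat \<Rightarrow> real"
  assumes nonneg: "\<And>n. 0 \<le> a n"
    and le: "\<And>e. e > 0 \<Longrightarrow> \<exists>b. b \<longlonglongrightarrow> 0 \<and> (\<forall>n. a n \<le> e + b n)"
  shows "a \<longlonglongrightarrow> 0"
proof (rule LIMSEQ_I)
  fix e :: real assume "e > 0"
  then obtain b where b: "b \<longlonglongrightarrow> 0" "\<And>n. a n \<le> e/2 + b n"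
    using le[of "e/2"] by auto
  from b(1) \<open>e > 0\<close> obtain no where "\<And>n. n \<ge> no \<Longrightarrow> norm (b n - 0) < e/2"
    using LIMSEQ_D[of b 0 "e/2"] by auto
  then have "norm (a n - 0) < e" if "n \<ge> no" for n
    using that b(2)[of n] nonneg[of n] by fastforce
  then show "\<exists>no. \<forall>n\<ge>no. norm (a n - 0) < e" by blast
qed

text \<open>
  Scheffe's argument. Both indicators have the same integral, so the \<open>L\<^sup>1\<close>-distance is twice the
  integral of the positive part of \<open>1\<^sub>U(x) - 1\<^sub>U(x + z)\<close>. As \<open>U\<close> is open, that part vanishes at each
  point once \<open>z\<close> is small, and it is dominated by \<open>1\<^sub>U\<close>.
\<close>

lemma translation_indicator_open:
  fixes U :: "'a::euclidean_space set"
  assumes U: "open U" "emeasure lborel U < \<infinity>" and z: "z \<longlonglongrightarrow> 0"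
  shows "(\<lambda>n. LINT x|lborel. \<bar>indicator U (x + z n) - indicator U x\<bar> :: real) \<longlonglongrightarrow> 0"
proof -
  have [measurable]: "U \<in> sets borel" using U by simp
  let ?I = "indicator U :: 'a \<Rightarrow> real"
  have I: "integrable lborel ?I" using U by simp
  note IT = integrable_lborel_shift[OF I]
  have IM: "integrable lborel (\<lambda>x. max 0 (?I x - ?I (x + z n)))" for n
    using I IT by (intro integrable_max) auto
  have "(LINT x|lborel. \<bar>?I (x + z n) - ?I x\<bar>) = 2 * (LINT x|lborel. max 0 (?I x - ?I (x + z n)))" for n
  proof -
    have "(LINT x|lborel. \<bar>?I (x + z n) - ?I x\<bar>)
      = (LINT x|lborel. ?I (x + z n) - ?I x + 2 * max 0 (?I x - ?I (x + z n)))"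
      by (intro Bochner_Integration.integral_cong) (auto simp: indicator_def max_def)
    also have "\<dots> = 2 * (LINT x|lborel. max 0 (?I x - ?I (x + z n)))"
      using I IT[of "z n"] IM[of n] integral_lborel_shift[of ?I "z n"] by simp
    finally show ?thesis .
  qed
  moreover have "(\<lambda>n. LINT x|lborel. max 0 (?I x - ?I (x + z n))) \<longlonglongrightarrow> (LINT x|(lborel::'a measure). 0)"
  proof (rule integral_dominated_convergence[where w = ?I])
    show "AE x in lborel. (\<lambda>n. max 0 (?I x - ?I (x + z n))) \<longlonglongrightarrow> 0"
    proof (rule AE_I2)
      fix x
      show "(\<lambda>n. max 0 (?I x - ?I (x + z n))) \<longlonglongrightarrow> 0"
      proof (cases "x \<in> U")
        case True
        have "(\<lambda>n. x + z n) \<longlonglongrightarrow> x + 0" using z by (intro tendsto_intros)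
        then have "eventually (\<lambda>n. x + z n \<in> U) sequentially"
          using U True by (intro topological_tendstoD) auto
        then show ?thesis
          by (intro tendsto_eventually) (auto elim!: eventually_mono simp: True)
      next
        case False
        then have "max 0 (?I x - ?I (x + z n)) = 0" for n by (simp add: indicator_def)
        then show ?thesis by simp
      qed
    qed
    show "AE x in lborel. norm (max 0 (?I x - ?I (x + z n))) \<le> ?I x" for n
      by (auto simp: indicator_def)
  qed (use I in \<open>auto\<close>)
  ultimately show ?thesis
    using tendsto_mult_left[of _ 0 sequentially 2] by simp
qed

text \<open>
  Outer regularity passes from open sets to Borel sets of finite measure, and induction over
  integrable functions does the rest.
\<close>

lemma translation_L1:
  fixes p :: "'a::euclidean_space \<Rightarrow> real"
  assumes "integrable lborel p" "z \<longlonglongrightarrow> 0"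
  shows "(\<lambda>n. LINT x|lborel. \<bar>p (x + z n) - p x\<bar>) \<longlonglongrightarrow> 0"
  using assms(1)
proof (induction rule: integrable_induct)
  case (base A c)
  have A[measurable]: "A \<in> sets borel" using base by simp
  let ?I = "\<lambda>S x. indicator S x :: real"
  have "(\<lambda>n. LINT x|lborel. \<bar>?I A (x + z n) - ?I A x\<bar>) \<longlonglongrightarrow> 0"
  proof (rule tendsto_0_if_le_eps_plus_null)
    fix e :: real assume "e > 0"
    then obtain U where U: "open U" "A \<subseteq> U" "emeasure lborel (U - A) < ennreal (e/2)"
      using outer_regular_lborel[OF A, of "e/2"] by auto
    have [measurable]: "U \<in> sets borel" using U by simp
    have "emeasure lborel U = emeasure lborel A + emeasure lborel (U - A)"
      using U(2) by (subst plus_emeasure) (auto intro!: arg_cong[of _ _ "emeasure lborel"])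
    also have "\<dots> < \<infinity>"
      using base U(3) by (auto simp: less_top[symmetric])
    finally have fin: "emeasure lborel U < \<infinity>" .
    have finD: "emeasure lborel (U - A) < \<infinity>" using U(3) by (auto intro: less_trans)
    have i: "integrable lborel (?I U)" "integrable lborel (?I (U - A))" "integrable lborel (?I A)"
      using fin finD base by auto
    note it = i[THEN integrable_lborel_shift]
    have d: "(LINT x|lborel. ?I (U - A) x) \<le> e/2"
    proof -
      have "ennreal (measure lborel (U - A)) < ennreal (e/2)"
        using U(3) finD by (simp add: emeasure_eq_ennreal_measure)
      then show ?thesis by (simp add: ennreal_less_iff)
    qed
    have "(LINT x|lborel. \<bar>?I A (x + z n) - ?I A x\<bar>) \<le> e + (LINT x|lborel. \<bar>?I U (x + z n) - ?I U x\<bar>)" for n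
    proof -
      have "(LINT x|lborel. \<bar>?I A (x + z n) - ?I A x\<bar>)
         \<le> (LINT x|lborel. \<bar>?I U (x + z n) - ?I U x\<bar> + (?I (U - A) (x + z n) + ?I (U - A) x))"
        using U(2) by (intro integral_mono integrable_abs Bochner_Integration.integrable_add
            Bochner_Integration.integrable_diff i it) (auto simp: indicator_def)
      also have "\<dots> = (LINT x|lborel. \<bar>?I U (x + z n) - ?I U x\<bar>) + 2 * (LINT x|lborel. ?I (U - A) x)"
        using i it[of "z n"] integral_lborel_shift[of "?I (U - A)" "z n"] by simp
      finally show ?thesis using d by linarith
    qed
    then show "\<exists>b. b \<longlonglongrightarrow> 0 \<and> (\<forall>n. (LINT x|lborel. \<bar>?I A (x + z n) - ?I A x\<bar>) \<le> e + b n)"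
      using translation_indicator_open[OF U(1) fin assms(2)] by blast
  qed (auto intro!: integral_nonneg_AE)
  then have "(\<lambda>n. \<bar>c\<bar> * (LINT x|lborel. \<bar>?I A (x + z n) - ?I A x\<bar>)) \<longlonglongrightarrow> 0"
    using tendsto_mult_left[of _ 0 sequentially "\<bar>c\<bar>"] by simp
  then show ?case
    by (subst (asm) integral_mult_right_zero[symmetric]) (simp add: abs_mult[symmetric] algebra_simps)
next
  case (add f g)
  show ?case
  proof (rule tendsto_sandwich[OF _ _ tendsto_const])
    show "(\<lambda>n. (LINT x|lborel. \<bar>f (x + z n) - f x\<bar>) + (LINT x|lborel. \<bar>g (x + z n) - g x\<bar>)) \<longlonglongrightarrow> 0"
      using tendsto_add[OF add.IH] by simp
    have "(LINT x|lborel. \<bar>f (x + z n) + g (x + z n) - (f x + g x)\<bar>)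
      \<le> (LINT x|lborel. \<bar>f (x + z n) - f x\<bar> + \<bar>g (x + z n) - g x\<bar>)" for n
      using add.hyps by (intro integral_mono integrable_abs Bochner_Integration.integrable_add
            Bochner_Integration.integrable_diff integrable_lborel_shift) auto
    then show "\<forall>\<^sub>F n in sequentially. (LINT x|lborel. \<bar>f (x + z n) + g (x + z n) - (f x + g x)\<bar>)
      \<le> (LINT x|lborel. \<bar>f (x + z n) - f x\<bar>) + (LINT x|lborel. \<bar>g (x + z n) - g x\<bar>)"
      using add.hyps integrable_lborel_shift[OF add.hyps(1)] integrable_lborel_shift[OF add.hyps(2)]
      by (intro always_eventually allI) (simp add: integrable_abs)
  qed (auto intro!: always_eventually integral_nonneg_AE)
next
  case (lim f s)
  note [measurable] = borel_measurable_integrable[OF lim.hyps(1)] borel_measurable_integrable[OF lim.hyps(4)]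
  show ?case
  proof (rule tendsto_0_if_le_eps_plus_null)
    fix e :: real assume "e > 0"
    have "(\<lambda>i. LINT x|lborel. \<bar>s i x - f x\<bar>) \<longlonglongrightarrow> (LINT x|(lborel::'a measure). 0)"
    proof (rule integral_dominated_convergence[where w = "\<lambda>x. 3 * \<bar>f x\<bar>"])
      show "AE x in lborel. (\<lambda>i. \<bar>s i x - f x\<bar>) \<longlonglongrightarrow> 0"
        using lim.hyps(2) by (auto intro!: tendsto_rabs_zero simp: LIM_zero_iff)
      show "AE x in lborel. norm \<bar>s i x - f x\<bar> \<le> 3 * \<bar>f x\<bar>" for i
      proof (rule AE_I2)
        fix x show "norm \<bar>s i x - f x\<bar> \<le> 3 * \<bar>f x\<bar>"
          using lim.hyps(3)[of x i] by auto
      qed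
    qed (use lim.hyps in auto)
    then obtain i where "(LINT x|lborel. \<bar>s i x - f x\<bar>) < e/2"
      using LIMSEQ_D[of _ 0 "e/2"] \<open>e > 0\<close> by fastforce
    note i = this
    note fi = lim.hyps(4) lim.hyps(1)[of i]
    have "(LINT x|lborel. \<bar>f (x + z n) - f x\<bar>) \<le> e + (LINT x|lborel. \<bar>s i (x + z n) - s i x\<bar>)" for n
    proof -
      have "(LINT x|lborel. \<bar>f (x + z n) - f x\<bar>)
        \<le> (LINT x|lborel. \<bar>s i (x + z n) - s i x\<bar> + (\<bar>s i (x + z n) - f (x + z n)\<bar> + \<bar>s i x - f x\<bar>))"
        using fi by (intro integral_mono integrable_abs Bochner_Integration.integrable_add
            Bochner_Integration.integrable_diff integrable_lborel_shift) auto
      also have "\<dots> = (LINT x|lborel. \<bar>s i (x + z n) - s i x\<bar>) + 2 * (LINT x|lborel. \<bar>s i x - f x\<bar>)"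
        using fi fi[THEN integrable_lborel_shift, of "z n"]
          integral_lborel_shift[of "\<lambda>x. \<bar>s i x - f x\<bar>" "z n"] by simp
      finally show ?thesis using i by linarith
    qed
    then show "\<exists>b. b \<longlonglongrightarrow> 0 \<and> (\<forall>n. (LINT x|lborel. \<bar>f (x + z n) - f x\<bar>) \<le> e + b n)"
      using lim.IH by blast
  qed (auto intro!: integral_nonneg_AE)
qed

text \<open>
  For nonnegative functions this reduces continuity of translations in \<open>L\<^sup>2\<close> to continuity in \<open>L\<^sup>1\<close>
  of their squares.
\<close>

lemma power2_diff_le_abs_diff_power2:
  fixes a b :: real
  assumes "0 \<le> a" "0 \<le> b" shows "(a - b)\<^sup>2 \<le> \<bar>a\<^sup>2 - b\<^sup>2\<bar>"
proof -
  have "(a - b)\<^sup>2 = \<bar>a - b\<bar> * \<bar>a - b\<bar>" by (simp add: power2_eq_square)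
  also have "\<dots> \<le> \<bar>a - b\<bar> * (a + b)" using assms by (intro mult_left_mono) auto
  also have "\<dots> = \<bar>a\<^sup>2 - b\<^sup>2\<bar>"
    using assms by (simp add: power2_eq_square square_diff_square_factored abs_mult)
  finally show ?thesis .
qed

lemma power2_diff_le_parts:
  fixes v w :: real
  shows "(v - w)\<^sup>2 \<le> 2 * \<bar>(max 0 v)\<^sup>2 - (max 0 w)\<^sup>2\<bar> + 2 * \<bar>(max 0 (-v))\<^sup>2 - (max 0 (-w))\<^sup>2\<bar>"
proof -
  define a b c d where "a = max 0 v" and "b = max 0 w" and "c = max 0 (-v)" and "d = max 0 (-w)"
  have vw: "v - w = (a - b) - (c - d)" by (auto simp: a_def b_def c_def d_def)
  have "(v - w)\<^sup>2 \<le> 2 * (a - b)\<^sup>2 + 2 * (c - d)\<^sup>2"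
    unfolding vw using zero_le_power2[of "(a - b) + (c - d)"]
    by (simp add: power2_eq_square algebra_simps)
  moreover
  have "0 \<le> a" "0 \<le> b" "0 \<le> c" "0 \<le> d"
    by (auto simp: a_def b_def c_def d_def)
  then have "2 * (a - b)\<^sup>2 + 2 * (c - d)\<^sup>2 \<le> 2 * \<bar>a\<^sup>2 - b\<^sup>2\<bar> + 2 * \<bar>c\<^sup>2 - d\<^sup>2\<bar>"
    by (intro add_mono mult_left_mono power2_diff_le_abs_diff_power2) auto
  ultimately have "(v - w)\<^sup>2 \<le> 2 * \<bar>a\<^sup>2 - b\<^sup>2\<bar> + 2 * \<bar>c\<^sup>2 - d\<^sup>2\<bar>"
    by (rule order_trans)
  then show ?thesis
    unfolding a_def b_def c_def d_def .
qed

text \<open>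
  Apply \<open>translation_L1\<close> to the squares of the positive and negative parts of \<open>Re u\<close> and \<open>Im u\<close>.
\<close>

lemma translation_L2:
  fixes u :: "'a::euclidean_space \<Rightarrow> complex"
  assumes u: "sq_int lborel u" and z: "z \<longlonglongrightarrow> 0"
  shows "(\<lambda>n. norm2 lborel (\<lambda>x. u (x + z n) - u x)) \<longlonglongrightarrow> 0"
proof -
  have [measurable]: "u \<in> borel_measurable borel" using sq_int_measurable[OF u] by simp
  have i2: "integrable lborel (\<lambda>x. (cmod (u x))\<^sup>2)" using u by (simp add: sq_int_def)
  \<comment> \<open>The four nonnegative parts, indexed by numbers so that they can be treated in one sum.\<close>
  define p where "p j x = (max 0 ([Re (u x), - Re (u x), Im (u x), - Im (u x)] ! j))\<^sup>2" for j :: nat and x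
  have p: "integrable lborel (p j)" if "j < 4" for j
  proof (rule Bochner_Integration.integrable_bound[OF i2])
    have j: "j = 0 \<or> j = 1 \<or> j = 2 \<or> j = 3" using that by auto
    show "p j \<in> borel_measurable lborel" using j unfolding p_def by auto
    show "AE x in lborel. norm (p j x) \<le> norm ((cmod (u x))\<^sup>2)"
    proof (rule AE_I2)
      fix x
      have "\<bar>Re (u x)\<bar>\<^sup>2 \<le> (cmod (u x))\<^sup>2" "\<bar>Im (u x)\<bar>\<^sup>2 \<le> (cmod (u x))\<^sup>2"
        by (intro power_mono abs_Re_le_cmod abs_Im_le_cmod; simp)+
      then show "norm (p j x) \<le> norm ((cmod (u x))\<^sup>2)"
        using j abs_Re_le_cmod[of "u x"] abs_Im_le_cmod[of "u x"] by (auto simp: p_def max_def)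
    qed
  qed
  have sum4: "(\<Sum>j<4. F j) = F 0 + F 1 + F 2 + F 3" for F :: "nat \<Rightarrow> real"
    by (simp add: eval_nat_numeral)
  have le: "(cmod (v - w))\<^sup>2
      \<le> 2 * \<bar>(max 0 (Re v))\<^sup>2 - (max 0 (Re w))\<^sup>2\<bar> + 2 * \<bar>(max 0 (- Re v))\<^sup>2 - (max 0 (- Re w))\<^sup>2\<bar>
      + (2 * \<bar>(max 0 (Im v))\<^sup>2 - (max 0 (Im w))\<^sup>2\<bar> + 2 * \<bar>(max 0 (- Im v))\<^sup>2 - (max 0 (- Im w))\<^sup>2\<bar>)" for v w
    unfolding cmod_power2 minus_complex.sel
    by (intro add_mono power2_diff_le_parts)
  have p_parts: "p 0 x = (max 0 (Re (u x)))\<^sup>2" "p 1 x = (max 0 (- Re (u x)))\<^sup>2"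
    "p 2 x = (max 0 (Im (u x)))\<^sup>2" "p 3 x = (max 0 (- Im (u x)))\<^sup>2" for x
    by (simp_all add: p_def)
  let ?D = "\<lambda>j n. LINT x|lborel. \<bar>p j (x + z n) - p j x\<bar>"
  have "(\<lambda>n. (norm2 lborel (\<lambda>x. u (x + z n) - u x))\<^sup>2) \<longlonglongrightarrow> 0"
  proof (rule tendsto_sandwich[OF _ _ tendsto_const])
    have "(\<lambda>n. 2 * (\<Sum>j<4. ?D j n)) \<longlonglongrightarrow> 2 * (\<Sum>j<(4::nat). 0)"
      using p z by (intro tendsto_intros translation_L1) auto
    then show "(\<lambda>n. 2 * (\<Sum>j<4. ?D j n)) \<longlonglongrightarrow> 0" by simp
    have "(norm2 lborel (\<lambda>x. u (x + z n) - u x))\<^sup>2 \<le> 2 * (\<Sum>j<4. ?D j n)" for n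
    proof -
      have iD: "integrable lborel (\<lambda>x. \<bar>p j (x + z n) - p j x\<bar>)" if "j < 4" for j
        using p[OF that] by (intro integrable_abs Bochner_Integration.integrable_diff integrable_lborel_shift)
      have le': "(cmod (u (x + z n) - u x))\<^sup>2 \<le> 2 * (\<Sum>j<4. \<bar>p j (x + z n) - p j x\<bar>)" for x
        using le[of "u (x + z n)" "u x"] unfolding sum4 p_parts distrib_left add.assoc .
      have "(norm2 lborel (\<lambda>x. u (x + z n) - u x))\<^sup>2 \<le> (LINT x|lborel. 2 * (\<Sum>j<4. \<bar>p j (x + z n) - p j x\<bar>))"
        unfolding norm2_power2 using le' iD by (intro integral_mono') auto
      also have "\<dots> = 2 * (\<Sum>j<4. ?D j n)"
        using iD by simp
      finally show ?thesis .
    qed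
    then show "\<forall>\<^sub>F n in sequentially. (norm2 lborel (\<lambda>x. u (x + z n) - u x))\<^sup>2 \<le> 2 * (\<Sum>j<4. ?D j n)"
      by simp
  qed auto
  then have "(\<lambda>n. sqrt ((norm2 lborel (\<lambda>x. u (x + z n) - u x))\<^sup>2)) \<longlonglongrightarrow> sqrt 0"
    by (rule tendsto_real_sqrt)
  then show ?thesis by simp
qed

section \<open>The Fourier transform of integrable functions\<close>

lemma borel_measurable_cis [measurable (raw)]:
  "f \<in> borel_measurable M \<Longrightarrow> (\<lambda>x. cis (f x)) \<in> borel_measurable M"
  by (rule borel_measurable_continuous_on[of cis]) (simp_all add: continuous_on_cis)

lemma integrable_mult_bounded:
  fixes u k :: "'a \<Rightarrow> complex"
  assumes "integrable M u" "k \<in> borel_measurable M" "\<And>x. cmod (k x) \<le> C"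
  shows "integrable M (\<lambda>x. u x * k x)"
proof (rule Bochner_Integration.integrable_bound)
  show "integrable M (\<lambda>x. of_real C * u x)" using assms(1) by simp
  have "cmod (u x * k x) \<le> cmod (of_real C * u x)" for x
  proof -
    have "cmod (u x) * cmod (k x) \<le> cmod (u x) * \<bar>C\<bar>"
      by (intro mult_left_mono order_trans[OF assms(3)]) auto
    then show ?thesis by (simp add: norm_mult mult.commute)
  qed
  then show "AE x in M. cmod (u x * k x) \<le> cmod (of_real C * u x)" by simp
qed (use assms in measurable)

text \<open>
  Without a normalising factor, so that Plancherel's theorem carries the factor \<open>(2\<pi>)\<^sup>n\<close>.
\<close>

definition fourier :: "('a::euclidean_space \<Rightarrow> complex) \<Rightarrow> 'a \<Rightarrow> complex" where
  "fourier u \<eta> = (LINT x|lborel. u x * cis (- (x \<bullet> \<eta>)))"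

lemma fourier_integrable: "integrable lborel u \<Longrightarrow> integrable lborel (\<lambda>x. u x * cis (- (x \<bullet> \<eta>)))"
  by (rule integrable_mult_bounded[where C = 1]) auto

lemma norm_fourier_le: "integrable lborel u \<Longrightarrow> cmod (fourier u \<eta>) \<le> (LINT x|lborel. cmod (u x))"
  unfolding fourier_def using integral_norm_bound[of lborel "\<lambda>x. u x * cis (- (x \<bullet> \<eta>))"]
  by (simp add: norm_mult)

lemma fourier_measurable [measurable]:
  assumes [measurable]: "u \<in> borel_measurable borel"
  shows "fourier u \<in> borel_measurable borel"
  unfolding fourier_def by measurable

lemma Fubini_bounded_kernel:
  fixes u v :: "'a::euclidean_space \<Rightarrow> complex"
  assumes u: "integrable lborel u" and v: "integrable lborel v"
    and k[measurable]: "case_prod k \<in> borel_measurable (borel \<Otimes>\<^sub>M borel)"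
    and k1: "\<And>x y. cmod (k x y) \<le> 1"
  shows "(LINT y|lborel. LINT x|lborel. u x * v y * k x y)
       = (LINT x|lborel. LINT y|lborel. u x * v y * k x y)"
proof -
  have [measurable]: "u \<in> borel_measurable borel" "v \<in> borel_measurable borel"
    using u v by auto
  have 1: "integrable lborel (\<lambda>y. u x * v y * k x y)" for x
    using v by (intro integrable_mult_bounded[of lborel "\<lambda>y. u x * v y" "\<lambda>y. k x y" 1] k1) auto
  have "integrable (lborel \<Otimes>\<^sub>M lborel) (\<lambda>(x, y). u x * v y * k x y)"
  proof (rule lborel_pair.Fubini_integrable)
    show "integrable lborel (\<lambda>x. LINT y|lborel. norm (case (x, y) of (x, y) \<Rightarrow> u x * v y * k x y))"
    proof (rule Bochner_Integration.integrable_bound)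
      show "integrable lborel (\<lambda>x. cmod (u x) * (LINT y|lborel. cmod (v y)))"
        using u by (intro integrable_mult_left) auto
      have "(LINT y|lborel. cmod (u x * v y * k x y)) \<le> cmod (u x) * (LINT y|lborel. cmod (v y))" for x
      proof -
        have "(LINT y|lborel. cmod (u x * v y * k x y)) \<le> (LINT y|lborel. cmod (u x) * cmod (v y))"
        proof (rule integral_mono)
          show "integrable lborel (\<lambda>y. cmod (u x * v y * k x y))" using 1 by auto
          show "integrable lborel (\<lambda>y. cmod (u x) * cmod (v y))" using v by auto
          show "cmod (u x * v y * k x y) \<le> cmod (u x) * cmod (v y)" for y
            using mult_left_mono[OF k1[of x y], of "cmod (u x) * cmod (v y)"] by (simp add: norm_mult)
        qed
        then show ?thesis by simp
      qed
      then show "AE x in lborel. norm (LINT y|lborel. norm (case (x, y) of (x, y) \<Rightarrow> u x * v y * k x y))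
          \<le> norm (cmod (u x) * (LINT y|lborel. cmod (v y)))"
        by (intro AE_I2) (auto simp: abs_mult integral_nonneg_AE intro: order_trans)
    qed measurable
  qed (use 1 in \<open>auto\<close>)
  then show ?thesis
    by (rule lborel_pair.Fubini_integral)
qed

text \<open>
  Fubini's theorem for the symmetric kernel. It is the only tool by which an integral over
  frequencies is brought back to an integral over space.
\<close>

lemma fourier_multiplication:
  assumes u: "integrable lborel u" and v: "integrable lborel v"
  shows "(LINT y|lborel. fourier u y * v y) = (LINT x|lborel. u x * fourier v x)"
proof -
  have "(LINT y|lborel. fourier u y * v y) = (LINT y|lborel. LINT x|lborel. u x * v y * cis (- (x \<bullet> y)))"
    unfolding fourier_def integral_mult_left_zero[symmetric] by (simp add: mult_ac)
  also have "\<dots> = (LINT x|lborel. LINT y|lborel. u x * v y * cis (- (x \<bullet> y)))"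
    using u v by (intro Fubini_bounded_kernel) auto
  also have "\<dots> = (LINT x|lborel. u x * fourier v x)"
    unfolding fourier_def integral_mult_right_zero[symmetric] by (simp add: mult_ac inner_commute)
  finally show ?thesis .
qed

lemma fourier_add_cmult:
  assumes "integrable lborel u" "integrable lborel v"
  shows "fourier (\<lambda>x. u x + c * v x) \<eta> = fourier u \<eta> + c * fourier v \<eta>"
proof -
  have "fourier (\<lambda>x. u x + c * v x) \<eta> = (LINT x|lborel. u x * cis (- (x \<bullet> \<eta>)) + c * (v x * cis (- (x \<bullet> \<eta>))))"
    unfolding fourier_def by (intro Bochner_Integration.integral_cong) (auto simp: algebra_simps)
  then show ?thesis
    using fourier_integrable[OF assms(1), of \<eta>] fourier_integrable[OF assms(2), of \<eta>] by (simp add: fourier_def)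
qed

lemma fourier_diff:
  assumes "integrable lborel u" "integrable lborel v"
  shows "fourier (\<lambda>x. u x - v x) \<eta> = fourier u \<eta> - fourier v \<eta>"
  using fourier_add_cmult[OF assms, of "-1" \<eta>] by simp

lemma fourier_shift:
  assumes [measurable]: "u \<in> borel_measurable borel"
  shows "fourier (\<lambda>x. u (x + z)) \<eta> = cis (z \<bullet> \<eta>) * fourier u \<eta>"
proof -
  have "fourier (\<lambda>x. u (x + z)) \<eta> = (LINT x|lborel. cis (z \<bullet> \<eta>) * (u (x + z) * cis (- ((x + z) \<bullet> \<eta>))))"
    unfolding fourier_def
  proof (intro Bochner_Integration.integral_cong refl)
    fix x
    have "cis (- (x \<bullet> \<eta>)) = cis (z \<bullet> \<eta>) * cis (- ((x + z) \<bullet> \<eta>))"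
      by (simp add: cis_mult inner_add_left)
    then show "u (x + z) * cis (- (x \<bullet> \<eta>)) = cis (z \<bullet> \<eta>) * (u (x + z) * cis (- ((x + z) \<bullet> \<eta>)))"
      by simp
  qed
  also have "\<dots> = cis (z \<bullet> \<eta>) * fourier u \<eta>"
    unfolding fourier_def integral_mult_right_zero
    by (subst integral_lborel_shift[of "\<lambda>x. u x * cis (- (x \<bullet> \<eta>))" z]) auto
  finally show ?thesis .
qed

section \<open>Gaussians\<close>

definition gauss :: "real \<Rightarrow> 'a::euclidean_space \<Rightarrow> complex" where
  "gauss \<epsilon> \<eta> = of_real (exp (- (\<epsilon>\<^sup>2 * (norm \<eta>)\<^sup>2 / 2)))"

lemma gauss_measurable [measurable]: "gauss \<epsilon> \<in> borel_measurable borel"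
  unfolding gauss_def[abs_def] by measurable

text \<open>
  The characteristic function of the standard normal distribution, without its normalisation.
\<close>

lemma gauss_real_integral:
  fixes s :: real
  shows "integrable lborel (\<lambda>t::real. of_real (exp (- (t\<^sup>2 / 2))) * cis (- (t * s)))"
    and "(LINT t|lborel. of_real (exp (- (t\<^sup>2 / 2))) * cis (- (t * s))) = of_real (sqrt (2 * pi) * exp (- (s\<^sup>2 / 2)))"
proof -
  have e: "complex_of_real (exp (- (t\<^sup>2 / 2))) = of_real (sqrt (2 * pi)) * of_real (std_normal_density t)" for t
    by (simp add: std_normal_density_def)
  have i: "integrable lborel (\<lambda>t. complex_of_real (std_normal_density t))"
    using integrable_normal_density[of 1 0] by (intro integrable_of_real) auto
  show "integrable lborel (\<lambda>t::real. of_real (exp (- (t\<^sup>2 / 2))) * cis (- (t * s)))"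
    unfolding e by (intro integrable_mult_bounded[where C = 1] integrable_mult_right i) auto
  have "of_real (exp (- (s\<^sup>2 / 2))) = char std_normal_distribution (- s)"
    by (simp add: char_std_normal_distribution)
  also have "\<dots> = (LINT t|lborel. std_normal_density t *\<^sub>R cis (- s * t))"
    unfolding char_def by (subst integral_density) (auto simp: cis_conv_exp normal_density_nonneg)
  finally have c: "of_real (exp (- (s\<^sup>2 / 2))) = (LINT t|lborel. of_real (std_normal_density t) * cis (- (t * s)))"
    by (simp add: scaleR_conv_of_real mult.commute)
  have "(LINT t|lborel. of_real (exp (- (t\<^sup>2 / 2))) * cis (- (t * s)))
      = (LINT t|lborel. of_real (sqrt (2 * pi)) * (of_real (std_normal_density t) * cis (- (t * s))))"
    by (simp only: e mult.assoc)
  also have "\<dots> = of_real (sqrt (2 * pi)) * of_real (exp (- (s\<^sup>2 / 2)))"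
    by (simp only: integral_mult_right_zero c)
  finally show "(LINT t|lborel. of_real (exp (- (t\<^sup>2 / 2))) * cis (- (t * s))) = of_real (sqrt (2 * pi) * exp (- (s\<^sup>2 / 2)))"
    by (simp only: of_real_mult)
qed

lemma integral_lborel_prod_Basis:
  fixes f :: "'a::euclidean_space \<Rightarrow> real \<Rightarrow> complex"
  assumes f: "\<And>b. b \<in> Basis \<Longrightarrow> integrable lborel (f b)"
  shows "integrable lborel (\<lambda>x::'a. \<Prod>b\<in>Basis. f b (x \<bullet> b))"
    and "(LINT x::'a|lborel. (\<Prod>b\<in>Basis. f b (x \<bullet> b))) = (\<Prod>b\<in>Basis. LINT t|lborel. f b t)"
proof -
  interpret product_sigma_finite "\<lambda>_::'a. lborel :: real measure"
    by standard
  have m: "(\<lambda>g. \<Sum>b\<in>Basis. g b *\<^sub>R b) \<in> measurable (\<Pi>\<^sub>M b\<in>(Basis::'a set). lborel) borel"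
    by measurable
  have [measurable]: "b \<in> Basis \<Longrightarrow> f b \<in> borel_measurable borel" for b
    using f[of b] by auto
  have p: "(\<Prod>b\<in>Basis. f b ((\<Sum>c\<in>Basis. g c *\<^sub>R c) \<bullet> b)) = (\<Prod>b\<in>Basis. f b (g b))" for g :: "'a \<Rightarrow> real"
    by (intro prod.cong) (auto simp: inner_sum_left_Basis)
  have fm: "(\<lambda>x::'a. \<Prod>b\<in>Basis. f b (x \<bullet> b)) \<in> borel_measurable borel"
    by measurable
  show "integrable lborel (\<lambda>x::'a. \<Prod>b\<in>Basis. f b (x \<bullet> b))"
    by (subst lborel_eq, subst integrable_distr_eq[OF m fm], unfold p)
       (intro product_integrable_prod f finite_Basis)
  show "(LINT x::'a|lborel. (\<Prod>b\<in>Basis. f b (x \<bullet> b))) = (\<Prod>b\<in>Basis. LINT t|lborel. f b t)"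
    by (subst lborel_eq, subst integral_distr[OF m fm], unfold p)
       (intro product_integral_prod f finite_Basis)
qed

lemma cis_sum: "finite A \<Longrightarrow> cis (\<Sum>a\<in>A. f a) = (\<Prod>a\<in>A. cis (f a))"
  by (induction A rule: finite_induct) (auto simp: cis_mult[symmetric])

lemma gauss1_prod:
  fixes x w :: "'a::euclidean_space"
  shows "gauss 1 x * cis (- (x \<bullet> w)) = (\<Prod>b\<in>Basis. of_real (exp (- ((x \<bullet> b)\<^sup>2 / 2))) * cis (- ((x \<bullet> b) * (w \<bullet> b))))"
proof -
  have "(norm x)\<^sup>2 = (\<Sum>b\<in>Basis. (x \<bullet> b)\<^sup>2)"
    unfolding power2_norm_eq_inner euclidean_inner[of x x] by (simp add: power2_eq_square)
  then have "gauss 1 x = (\<Prod>b\<in>Basis. of_real (exp (- ((x \<bullet> b)\<^sup>2 / 2))))"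
    by (simp add: gauss_def sum_divide_distrib exp_sum flip: sum_negf of_real_prod)
  moreover have "cis (- (x \<bullet> w)) = (\<Prod>b\<in>Basis. cis (- ((x \<bullet> b) * (w \<bullet> b))))"
    unfolding euclidean_inner[of x w] by (simp add: cis_sum flip: sum_negf)
  ultimately show ?thesis by (simp add: prod.distrib)
qed

lemma gauss1_fourier: "fourier (gauss 1) (w::'a::euclidean_space) = of_real (sqrt (2 * pi) ^ DIM('a)) * gauss 1 w"
proof -
  have "fourier (gauss 1) w = (\<Prod>b\<in>Basis. of_real (sqrt (2 * pi) * exp (- ((w \<bullet> b)\<^sup>2 / 2))))"
    unfolding fourier_def gauss1_prod by (subst integral_lborel_prod_Basis) (simp_all only: gauss_real_integral)
  also have "\<dots> = of_real (sqrt (2 * pi) ^ DIM('a)) * (gauss 1 w * cis (- (w \<bullet> 0)))"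
    unfolding gauss1_prod by (simp add: prod.distrib prod_constant)
  finally show ?thesis by simp
qed

lemma gauss1_integrable: "integrable lborel (gauss 1 :: 'a::euclidean_space \<Rightarrow> complex)"
proof -
  have "integrable lborel (\<lambda>x::'a. gauss 1 x * cis (- (x \<bullet> 0)))"
    unfolding gauss1_prod by (intro integral_lborel_prod_Basis gauss_real_integral)
  then show ?thesis by simp
qed

lemma gauss_scale: "gauss \<epsilon> x = gauss 1 (\<epsilon> *\<^sub>R x)"
  by (simp add: gauss_def power_mult_distrib)

lemma gauss_integrable:
  assumes "\<epsilon> > 0" shows "integrable lborel (gauss \<epsilon> :: 'a::euclidean_space \<Rightarrow> complex)"
proof -
  have "integrable lborel (\<lambda>x::'a. gauss 1 (0 + \<epsilon> *\<^sub>R x) :: complex)"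
  proof (rule affine_density_integrable)
    show "lborel = density (distr lborel borel (\<lambda>x::'a. 0 + \<epsilon> *\<^sub>R x)) (\<lambda>_. ennreal (\<epsilon> ^ DIM('a)))"
      using lborel_affine[of \<epsilon> "0::'a"] assms by (simp only: abs_of_pos)
  qed (use assms gauss1_integrable in auto)
  then show ?thesis by (simp add: gauss_scale[of \<epsilon>, abs_def])
qed

lemma gauss_fourier:
  assumes "\<epsilon> > 0"
  shows "of_real (\<epsilon> ^ DIM('a)) * fourier (gauss \<epsilon>) (\<epsilon> *\<^sub>R w) = of_real (sqrt (2 * pi) ^ DIM('a)) * gauss 1 (w::'a::euclidean_space)"
proof -
  have "of_real (sqrt (2 * pi) ^ DIM('a)) * gauss 1 w = fourier (gauss 1) w" by (simp add: gauss1_fourier)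
  also have "\<dots> = of_real (\<epsilon> ^ DIM('a)) * (LINT x|lborel. gauss 1 (0 + \<epsilon> *\<^sub>R x) * cis (- ((0 + \<epsilon> *\<^sub>R x) \<bullet> w)))"
    unfolding fourier_def by (intro integral_lborel_scale assms) measurable
  also have "\<dots> = of_real (\<epsilon> ^ DIM('a)) * fourier (gauss \<epsilon>) (\<epsilon> *\<^sub>R w)"
    unfolding fourier_def gauss_scale[of \<epsilon>] by simp
  finally show ?thesis by simp
qed

section \<open>Plancherel's theorem\<close>

text \<open>
  Inverting the transform after multiplication by a Gaussian gives, up to conjugation and a constant,
  the convolution of \<open>u\<close> with a Gaussian of width \<open>\<epsilon>\<close>. It is written with the substitution \<open>y = x + \<epsilon> w\<close>, so that the weight
  \<open>gauss 1\<close> stays fixed as \<open>\<epsilon>\<close> tends to \<open>0\<close>.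
\<close>

lemma fourier_cnj_gauss:
  fixes u :: "'a::euclidean_space \<Rightarrow> complex"
  assumes u: "integrable lborel u" and e: "\<epsilon> > 0"
  shows "fourier (\<lambda>\<eta>. cnj (fourier u \<eta>) * gauss \<epsilon> \<eta>) x
    = of_real (sqrt (2 * pi) ^ DIM('a)) * (LINT w|lborel. cnj (u (x + \<epsilon> *\<^sub>R w)) * gauss 1 w)"
proof -
  have [measurable]: "u \<in> borel_measurable borel" using u by auto
  have g: "integrable lborel (\<lambda>\<eta>. gauss \<epsilon> \<eta> * cis (- (\<eta> \<bullet> x)))"
    using gauss_integrable[OF e] by (rule fourier_integrable)
  have "fourier (\<lambda>\<eta>. cnj (fourier u \<eta>) * gauss \<epsilon> \<eta>) x
      = (LINT \<eta>|lborel. LINT y|lborel. cnj (u y) * (gauss \<epsilon> \<eta> * cis (- (\<eta> \<bullet> x))) * cis (y \<bullet> \<eta>))"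
  proof -
    have "cnj (fourier u \<eta>) * gauss \<epsilon> \<eta> * cis (- (\<eta> \<bullet> x))
      = (LINT y|lborel. cnj (u y) * (gauss \<epsilon> \<eta> * cis (- (\<eta> \<bullet> x))) * cis (y \<bullet> \<eta>))" for \<eta>
    proof -
      have "cnj (fourier u \<eta>) = (LINT y|lborel. cnj (u y) * cis (y \<bullet> \<eta>))"
        unfolding fourier_def Bochner_Integration.integral_cnj[symmetric] complex_cnj_mult cis_cnj minus_minus ..
      then show ?thesis
        unfolding mult.assoc by (simp only: integral_mult_left_zero[symmetric]) (simp add: mult_ac)
    qed
    then show ?thesis unfolding fourier_def[of _ x] by simp
  qed
  also have "\<dots> = (LINT y|lborel. LINT \<eta>|lborel. cnj (u y) * (gauss \<epsilon> \<eta> * cis (- (\<eta> \<bullet> x))) * cis (y \<bullet> \<eta>))"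
    using u g by (intro Fubini_bounded_kernel) auto
  also have "\<dots> = (LINT y|lborel. cnj (u y) * fourier (gauss \<epsilon>) (x - y))"
    unfolding fourier_def integral_mult_right_zero[symmetric]
    by (simp add: mult_ac cis_mult inner_diff_right inner_commute algebra_simps)
  also have "\<dots> = of_real (\<epsilon> ^ DIM('a)) * (LINT w|lborel. cnj (u (x + \<epsilon> *\<^sub>R w)) * fourier (gauss \<epsilon>) (x - (x + \<epsilon> *\<^sub>R w)))"
    by (intro integral_lborel_scale e) measurable
  also have "\<dots> = (LINT w|lborel. cnj (u (x + \<epsilon> *\<^sub>R w)) * (of_real (\<epsilon> ^ DIM('a)) * fourier (gauss \<epsilon>) (\<epsilon> *\<^sub>R (- w))))"
    unfolding integral_mult_right_zero[symmetric] by (simp add: mult_ac)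
  also have "\<dots> = of_real (sqrt (2 * pi) ^ DIM('a)) * (LINT w|lborel. cnj (u (x + \<epsilon> *\<^sub>R w)) * gauss 1 w)"
    unfolding gauss_fourier[OF e] integral_mult_right_zero[symmetric]
    by (simp add: gauss_def mult_ac)
  finally show ?thesis .
qed

text \<open>
  The regularised energy is a Gaussian average of the autocorrelation \<open>z \<mapsto> \<integral> u(x) cnj (u(x + z)) dx\<close>
  at scale \<open>\<epsilon>\<close>. The square integrability of \<open>u\<close> bounds the autocorrelation and justifies the
  exchange of integrals.
\<close>

lemma fourier_gauss_energy:
  fixes u :: "'a::euclidean_space \<Rightarrow> complex"
  assumes u: "integrable lborel u" and u2: "sq_int lborel u" and e: "\<epsilon> > 0"
  shows "(LINT \<eta>|lborel. fourier u \<eta> * (cnj (fourier u \<eta>) * gauss \<epsilon> \<eta>))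
    = of_real (sqrt (2 * pi) ^ DIM('a)) *
      (LINT w|lborel. gauss 1 w * (LINT x|lborel. u x * cnj (u (x + \<epsilon> *\<^sub>R w))))"
proof -
  let ?F = "\<lambda>w x. gauss 1 w * (u x * cnj (u (x + \<epsilon> *\<^sub>R w)))"
  have [measurable]: "u \<in> borel_measurable borel" using u by auto
  have v: "integrable lborel (\<lambda>\<eta>. cnj (fourier u \<eta>) * gauss \<epsilon> \<eta>)"
    using integrable_mult_bounded[OF gauss_integrable[OF e], of "\<lambda>\<eta>. cnj (fourier u \<eta>)"
      "LINT x|lborel. cmod (u x)"] norm_fourier_le[OF u]
    by (simp add: mult.commute)
  have F: "integrable (lborel \<Otimes>\<^sub>M lborel) (\<lambda>(w, x). ?F w x)"
  proof (rule lborel_pair.Fubini_integrable)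
    have prod: "integrable lborel (\<lambda>x. u x * cnj (u (x + z)))"
      "(LINT x|lborel. cmod (u x * cnj (u (x + z)))) \<le> (norm2 lborel u)\<^sup>2" for z
      using sq_int_mult_integrable[OF u2 sq_int_cnj[OF sq_int_shift(1)[OF u2]], of z]
        Cauchy_Schwarz_norm2[OF u2 sq_int_shift(1)[OF u2], of z]
      by (auto simp: sq_int_shift(2)[OF u2] norm_mult power2_eq_square)
    show "AE w in lborel. integrable lborel (\<lambda>x. case (w, x) of (w, x) \<Rightarrow> ?F w x)"
      using prod by auto
    show "integrable lborel (\<lambda>w. LINT x|lborel. norm (case (w, x) of (w, x) \<Rightarrow> ?F w x))"
    proof (rule Bochner_Integration.integrable_bound)
      show "integrable lborel (\<lambda>w::'a. gauss 1 w * of_real ((norm2 lborel u)\<^sup>2))"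
        using gauss1_integrable by (intro integrable_mult_left) auto
      show "AE w in lborel. norm (LINT x|lborel. norm (case (w, x) of (w, x) \<Rightarrow> ?F w x))
        \<le> norm (gauss 1 w * complex_of_real ((norm2 lborel u)\<^sup>2))"
      proof (rule AE_I2)
        fix w :: 'a
        have "(LINT x|lborel. cmod (?F w x))
          = cmod (gauss 1 w) * (LINT x|lborel. cmod (u x * cnj (u (x + \<epsilon> *\<^sub>R w))))"
          unfolding norm_mult[of "gauss 1 w"] by (rule integral_mult_right_zero)
        also have "\<dots> \<le> cmod (gauss 1 w) * (norm2 lborel u)\<^sup>2"
          by (intro mult_left_mono prod) auto
        finally show "norm (LINT x|lborel. norm (case (w, x) of (w, x) \<Rightarrow> ?F w x))
          \<le> norm (gauss 1 w * complex_of_real ((norm2 lborel u)\<^sup>2))"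
          by (simp add: norm_mult integral_nonneg_AE norm_power)
      qed
    qed measurable
  qed measurable
  have "(LINT \<eta>|lborel. fourier u \<eta> * (cnj (fourier u \<eta>) * gauss \<epsilon> \<eta>))
    = (LINT x|lborel. u x * fourier (\<lambda>\<eta>. cnj (fourier u \<eta>) * gauss \<epsilon> \<eta>) x)"
    by (rule fourier_multiplication[OF u v])
  also have "\<dots> = of_real (sqrt (2 * pi) ^ DIM('a)) * (LINT x|lborel. LINT w|lborel. ?F w x)"
    unfolding fourier_cnj_gauss[OF u e] mult.left_commute[of "u _"] integral_mult_right_zero[symmetric]
    by (simp add: mult_ac)
  also have "(LINT x|lborel. LINT w|lborel. ?F w x)
    = (LINT w|lborel. LINT x|lborel. ?F w x)"
    using F by (rule lborel_pair.Fubini_integral)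
  also have "\<dots> = (LINT w|lborel. gauss 1 w * (LINT x|lborel. u x * cnj (u (x + \<epsilon> *\<^sub>R w))))"
    by (simp only: integral_mult_right_zero)
  finally show ?thesis .
qed

text \<open>
  Let the width \<open>\<epsilon>\<close> in \<open>fourier_gauss_energy\<close> tend to \<open>0\<close>. The left-hand side increases to the energy of
  the transform, which is how its finiteness is obtained; on the right the autocorrelation is
  continuous at \<open>0\<close> by \<open>translation_L2\<close>, with value the squared norm of \<open>u\<close>.
\<close>

theorem Plancherel_L1_L2:
  fixes u :: "'a::euclidean_space \<Rightarrow> complex"
  assumes u: "integrable lborel u" and u2: "sq_int lborel u"
  shows "sq_int lborel (fourier u)" and "(norm2 lborel (fourier u))\<^sup>2 = (2 * pi) ^ DIM('a) * (norm2 lborel u)\<^sup>2"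
proof -
  have [measurable]: "u \<in> borel_measurable borel" using u by auto
  \<comment> \<open>Any sequence decreasing to \<open>0\<close> would do; monotonicity is needed for \<open>J\<close>.\<close>
  define e where "e n = 1 / real (Suc n)" for n
  have e: "e n > 0" for n by (simp add: e_def)
  have e0: "e \<longlonglongrightarrow> 0" unfolding e_def by (rule LIMSEQ_Suc) (rule lim_1_over_n)
  let ?E = "\<lambda>n \<eta>. (cmod (fourier u \<eta>))\<^sup>2 * exp (- ((e n)\<^sup>2 * (norm \<eta>)\<^sup>2 / 2))"
  let ?I = "\<lambda>n. LINT w|lborel. gauss 1 w * (LINT x|lborel. u x * cnj (u (x + e n *\<^sub>R w)))"
  define J where "J n = (\<integral>\<^sup>+\<eta>. ennreal (?E n \<eta>) \<partial>lborel)" for n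
  let ?c = "sqrt (2 * pi) ^ DIM('a)"
  let ?A = "\<lambda>z. LINT x|lborel. u x * cnj (u (x + z))"
  let ?L = "norm2 lborel u"
  have A_le: "cmod (?A z) \<le> ?L\<^sup>2" for z
    using Cauchy_Schwarz_norm2_integral[OF u2 sq_int_cnj[OF sq_int_shift(1)[OF u2]], of z]
    by (simp add: sq_int_shift(2)[OF u2] power2_eq_square)
  have A0: "?A 0 = of_real (?L\<^sup>2)"
    unfolding norm2_power2 by (simp add: complex_norm_square[symmetric] integral_complex_of_real del: of_real_power)
  have A_lim: "(\<lambda>n. ?A (z n)) \<longlonglongrightarrow> ?A 0" if z: "z \<longlonglongrightarrow> 0" for z
  proof (rule LIM_zero_cancel, rule Lim_null_comparison)
    show "(\<lambda>n. ?L * norm2 lborel (\<lambda>x. u (x + z n) - u x)) \<longlonglongrightarrow> 0"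
      using tendsto_mult_left[OF translation_L2[OF u2 z], of ?L] by simp
    have "cmod (?A (z n) - ?A 0) \<le> ?L * norm2 lborel (\<lambda>x. u (x + z n) - u x)" for n
    proof -
      have i: "integrable lborel (\<lambda>x. u x * cnj (u (x + y)))" for y
        using sq_int_mult_integrable[OF u2 sq_int_cnj[OF sq_int_shift(1)[OF u2]]] .
      have "?A (z n) - ?A 0 = (LINT x|lborel. u x * cnj (u (x + z n) - u x))"
        using i[of "z n"] i[of 0] by (simp add: right_diff_distrib)
      then show ?thesis
        using Cauchy_Schwarz_norm2_integral[OF u2 sq_int_cnj[OF sq_int_diff[OF sq_int_shift(1)[OF u2] u2]], of "z n"]
        by (simp only: norm2_cnj)
    qed
    then show "\<forall>\<^sub>F n in sequentially. norm (?A (z n) - ?A 0) \<le> ?L * norm2 lborel (\<lambda>x. u (x + z n) - u x)"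
      by simp
  qed
  have int_g: "(LINT w::'a|lborel. gauss 1 w) = complex_of_real ?c"
    using gauss1_fourier[of "0::'a"] by (simp add: fourier_def gauss_def)
  have lim1: "?I \<longlonglongrightarrow> (LINT w::'a|lborel. gauss 1 w * ?A 0)"
  proof (rule integral_dominated_convergence[where w = "\<lambda>w. cmod (gauss 1 w) * ?L\<^sup>2"])
    show "integrable lborel (\<lambda>w::'a. cmod (gauss 1 w) * ?L\<^sup>2)"
      using gauss1_integrable by (intro integrable_mult_left) auto
    show "AE w in lborel. (\<lambda>n. gauss 1 w * ?A (e n *\<^sub>R w)) \<longlonglongrightarrow> gauss 1 w * ?A 0"
    proof (intro AE_I2 tendsto_mult_left A_lim)
      show "(\<lambda>n. e n *\<^sub>R w) \<longlonglongrightarrow> 0" for w :: 'a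
        using tendsto_scaleR[OF e0 tendsto_const[of w]] by simp
    qed
    show "AE w in lborel. norm (gauss 1 w * ?A (e n *\<^sub>R w)) \<le> cmod (gauss 1 w) * ?L\<^sup>2" for n
      unfolding norm_mult by (intro AE_I2 mult_left_mono A_le) auto
  qed measurable
  have J_eq: "J n = ennreal (Re (of_real ?c * ?I n))" for n
  proof -
    have f: "fourier u \<eta> * (cnj (fourier u \<eta>) * gauss (e n) \<eta>) = of_real (?E n \<eta>)" for \<eta>
      unfolding mult.assoc[symmetric] complex_norm_square[symmetric] by (simp add: gauss_def)
    have "integrable lborel (\<lambda>\<eta>. gauss (e n) \<eta> * (fourier u \<eta> * cnj (fourier u \<eta>)))"
    proof (rule integrable_mult_bounded[OF gauss_integrable[OF e]])
      show "cmod (fourier u \<eta> * cnj (fourier u \<eta>)) \<le> (LINT x|lborel. cmod (u x)) * (LINT x|lborel. cmod (u x))" for \<eta>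
        unfolding norm_mult complex_mod_cnj by (intro mult_mono norm_fourier_le u) (auto intro: integral_nonneg_AE)
    qed measurable
    then have "integrable lborel (\<lambda>\<eta>. fourier u \<eta> * (cnj (fourier u \<eta>) * gauss (e n) \<eta>))"
      by (simp add: mult_ac)
    then have i: "integrable lborel (\<lambda>\<eta>. ?E n \<eta>)"
      unfolding f by (simp only: complex_of_real_integrable_eq)
    have "J n = ennreal (LINT \<eta>|lborel. ?E n \<eta>)"
      unfolding J_def by (intro nn_integral_eq_integral i) auto
    also have "(LINT \<eta>|lborel. ?E n \<eta>)
       = Re (LINT \<eta>|lborel. fourier u \<eta> * (cnj (fourier u \<eta>) * gauss (e n) \<eta>))"
      unfolding f integral_complex_of_real by simp
    finally show ?thesis unfolding fourier_gauss_energy[OF u u2 e] .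
  qed
  have "(\<lambda>n. ennreal (Re (of_real ?c * ?I n))) \<longlonglongrightarrow>
      ennreal (Re (of_real ?c * (LINT w::'a|lborel. gauss 1 w * ?A 0)))"
    by (intro tendsto_ennrealI tendsto_Re tendsto_mult_left lim1)
  also have "of_real ?c * (LINT w::'a|lborel. gauss 1 w * ?A 0) = complex_of_real ((2 * pi) ^ DIM('a) * ?L\<^sup>2)"
  proof -
    have cc: "?c * ?c = (2 * pi) ^ DIM('a)" by (subst power_mult_distrib[symmetric]) simp
    show ?thesis
      unfolding integral_mult_left_zero int_g A0 of_real_mult[symmetric] mult.assoc[symmetric] cc ..
  qed
  finally have J1: "J \<longlonglongrightarrow> ennreal ((2 * pi) ^ DIM('a) * ?L\<^sup>2)"
    unfolding J_eq by simp
  have "J \<longlonglongrightarrow> (\<integral>\<^sup>+\<eta>. ennreal ((cmod (fourier u \<eta>))\<^sup>2) \<partial>lborel)"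
    unfolding J_def
  proof (rule nn_integral_LIMSEQ)
    show "incseq (\<lambda>n \<eta>. ennreal (?E n \<eta>))"
    proof (intro incseq_SucI le_funI ennreal_leI mult_left_mono)
      fix n \<eta>
      have "(e (Suc n))\<^sup>2 \<le> (e n)\<^sup>2" by (intro power_mono) (auto simp: e_def frac_le)
      then show "exp (- ((e n)\<^sup>2 * (norm (\<eta>::'a))\<^sup>2 / 2)) \<le> exp (- ((e (Suc n))\<^sup>2 * (norm \<eta>)\<^sup>2 / 2))"
        by (simp add: mult_right_mono)
    qed auto
    show "(\<lambda>n. ennreal (?E n \<eta>)) \<longlonglongrightarrow> ennreal ((cmod (fourier u \<eta>))\<^sup>2)" for \<eta>
    proof -
      have "(\<lambda>n. ?E n \<eta>) \<longlonglongrightarrow> (cmod (fourier u \<eta>))\<^sup>2 * exp (- (0\<^sup>2 * (norm \<eta>)\<^sup>2 / 2))"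
        by (intro tendsto_intros e0) simp
      then show ?thesis by (intro tendsto_ennrealI) simp
    qed
  qed measurable
  then have eq: "(\<integral>\<^sup>+\<eta>. ennreal ((cmod (fourier u \<eta>))\<^sup>2) \<partial>lborel) = ennreal ((2 * pi) ^ DIM('a) * ?L\<^sup>2)"
    using J1 LIMSEQ_unique by blast
  show s: "sq_int lborel (fourier u)"
    by (rule sq_intI_nn_integral) (simp_all add: eq)
  show "(norm2 lborel (fourier u))\<^sup>2 = (2 * pi) ^ DIM('a) * ?L\<^sup>2"
    using eq unfolding sq_int_nn_integral[OF s] by (subst (asm) ennreal_inj) auto
qed

lemma norm2_fourier:
  fixes u :: "'a::euclidean_space \<Rightarrow> complex"
  assumes "integrable lborel u" "sq_int lborel u"
  shows "norm2 lborel (fourier u) = sqrt ((2 * pi) ^ DIM('a)) * norm2 lborel u"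
proof -
  have "sqrt ((norm2 lborel (fourier u))\<^sup>2) = sqrt ((2 * pi) ^ DIM('a) * (norm2 lborel u)\<^sup>2)"
    by (simp only: Plancherel_L1_L2(2)[OF assms])
  then show ?thesis by (simp only: real_sqrt_mult real_sqrt_abs abs_of_nonneg norm2_nonneg)
qed

section \<open>The Fourier transform on $L^2$ as a relation\<close>

definition fourier_L2_approx ::
  "(nat \<Rightarrow> 'a::euclidean_space \<Rightarrow> complex) \<Rightarrow> ('a \<Rightarrow> complex) \<Rightarrow> ('a \<Rightarrow> complex) \<Rightarrow> bool" where
  "fourier_L2_approx h F G \<longleftrightarrow> (\<forall>n. integrable lborel (h n) \<and> sq_int lborel (h n)) \<and>
     (\<lambda>n. norm2 lborel (\<lambda>x. h n x - F x)) \<longlonglongrightarrow> 0 \<and>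
     (\<lambda>n. norm2 lborel (\<lambda>x. fourier (h n) x - G x)) \<longlonglongrightarrow> 0"

lemma fourier_L2_approxD:
  assumes "fourier_L2_approx h F G"
  shows "\<And>n. integrable lborel (h n)" "\<And>n. sq_int lborel (h n)"
    "(\<lambda>n. norm2 lborel (\<lambda>x. h n x - F x)) \<longlonglongrightarrow> 0"
    "(\<lambda>n. norm2 lborel (\<lambda>x. fourier (h n) x - G x)) \<longlonglongrightarrow> 0"
  using assms unfolding fourier_L2_approx_def by blast+

text \<open>
  The closure in \<open>L\<^sup>2 \<times> L\<^sup>2\<close> of the graph of the Fourier transform on \<open>L\<^sup>1 \<inter> L\<^sup>2\<close>. Each identity
  between norms or inner products, and each covariance, passes to this closure.
\<close>

definition fourier_L2 :: "('a::euclidean_space \<Rightarrow> complex) \<Rightarrow> ('a \<Rightarrow> complex) \<Rightarrow> bool" where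
  "fourier_L2 F G \<longleftrightarrow> sq_int lborel F \<and> sq_int lborel G \<and> (\<exists>h. fourier_L2_approx h F G)"

lemma fourier_L2I:
  assumes "sq_int lborel F" "sq_int lborel G"
    "\<And>n. integrable lborel (h n)" "\<And>n. sq_int lborel (h n)"
    "(\<lambda>n. norm2 lborel (\<lambda>x. h n x - F x)) \<longlonglongrightarrow> 0"
    "(\<lambda>n. norm2 lborel (\<lambda>x. fourier (h n) x - G x)) \<longlonglongrightarrow> 0"
  shows "fourier_L2 F G"
  using assms unfolding fourier_L2_def fourier_L2_approx_def by blast

lemma fourier_L2_measurable:
  assumes "fourier_L2 F G" shows "F \<in> borel_measurable borel" "G \<in> borel_measurable borel"
  using assms by (auto simp: fourier_L2_def sq_int_def)

lemma fourier_L2_sq_int: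
  assumes "fourier_L2 F G" shows "sq_int lborel F" "sq_int lborel G"
  using assms by (auto simp: fourier_L2_def)

lemma fourier_L2_isometry:
  fixes F :: "'a::euclidean_space \<Rightarrow> complex"
  assumes "fourier_L2 F G"
  shows "(norm2 lborel G)\<^sup>2 = (2 * pi) ^ DIM('a) * (norm2 lborel F)\<^sup>2"
proof -
  obtain h where h: "fourier_L2_approx h F G" using assms unfolding fourier_L2_def by blast
  note F = fourier_L2_sq_int(1)[OF assms] and G = fourier_L2_sq_int(2)[OF assms]
  note lim = fourier_L2_approxD(3,4)[OF h] and h = fourier_L2_approxD(1,2)[OF h]
  have "(\<lambda>n. (norm2 lborel (fourier (h n)))\<^sup>2) \<longlonglongrightarrow> (norm2 lborel G)\<^sup>2"
    using Plancherel_L1_L2(1)[OF h] by (intro tendsto_power norm2_tendsto G lim)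
  moreover have "(\<lambda>n. (norm2 lborel (fourier (h n)))\<^sup>2) \<longlonglongrightarrow> (2 * pi) ^ DIM('a) * (norm2 lborel F)\<^sup>2"
    unfolding Plancherel_L1_L2(2)[OF h] by (intro tendsto_power tendsto_mult_left norm2_tendsto F h lim)
  ultimately show ?thesis by (rule LIMSEQ_unique)
qed

lemma fourier_L2_add_cmult:
  assumes "fourier_L2 F G" "fourier_L2 F' G'"
  shows "fourier_L2 (\<lambda>x. F x + c * F' x) (\<lambda>x. G x + c * G' x)"
proof -
  obtain h where h: "fourier_L2_approx h F G" using assms(1) unfolding fourier_L2_def by blast
  note F = fourier_L2_sq_int(1)[OF assms(1)] and G = fourier_L2_sq_int(2)[OF assms(1)]
  note lim = fourier_L2_approxD(3,4)[OF h] and h = fourier_L2_approxD(1,2)[OF h]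
  obtain h' where h': "fourier_L2_approx h' F' G'" using assms(2) unfolding fourier_L2_def by blast
  note F' = fourier_L2_sq_int(1)[OF assms(2)] and G' = fourier_L2_sq_int(2)[OF assms(2)]
  note lim' = fourier_L2_approxD(3,4)[OF h'] and h' = fourier_L2_approxD(1,2)[OF h']
  have comb: "(\<lambda>n. norm2 lborel (\<lambda>x. (p n x + c * p' n x) - (P x + c * P' x))) \<longlonglongrightarrow> 0"
    if "(\<lambda>n. norm2 lborel (\<lambda>x. p n x - P x)) \<longlonglongrightarrow> 0" "(\<lambda>n. norm2 lborel (\<lambda>x. p' n x - P' x)) \<longlonglongrightarrow> 0"
      and s: "\<And>n. sq_int lborel (p n)" "\<And>n. sq_int lborel (p' n)" "sq_int lborel P" "sq_int lborel P'"
    for p p' P P'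
  proof (rule tendsto_sandwich[OF _ _ tendsto_const])
    show "(\<lambda>n. norm2 lborel (\<lambda>x. p n x - P x) + cmod c * norm2 lborel (\<lambda>x. p' n x - P' x)) \<longlonglongrightarrow> 0"
      using tendsto_add[OF that(1) tendsto_mult_left[OF that(2), of "cmod c"]] by simp
    have "norm2 lborel (\<lambda>x. (p n x + c * p' n x) - (P x + c * P' x))
      \<le> norm2 lborel (\<lambda>x. p n x - P x) + cmod c * norm2 lborel (\<lambda>x. p' n x - P' x)" for n
      using norm2_triangle[OF sq_int_diff[OF s(1)[of n] s(3)] sq_int_cmult[OF sq_int_diff[OF s(2)[of n] s(4)], of c]]
      unfolding norm2_cmult by (simp add: algebra_simps)
    then show "\<forall>\<^sub>F n in sequentially. norm2 lborel (\<lambda>x. (p n x + c * p' n x) - (P x + c * P' x))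
      \<le> norm2 lborel (\<lambda>x. p n x - P x) + cmod c * norm2 lborel (\<lambda>x. p' n x - P' x)" by simp
  qed auto
  show ?thesis
  proof (rule fourier_L2I[where h = "\<lambda>n x. h n x + c * h' n x"])
    show "(\<lambda>n. norm2 lborel (\<lambda>x. h n x + c * h' n x - (F x + c * F' x))) \<longlonglongrightarrow> 0"
      by (rule comb) fact+
    show "(\<lambda>n. norm2 lborel (\<lambda>x. fourier (\<lambda>x. h n x + c * h' n x) x - (G x + c * G' x))) \<longlonglongrightarrow> 0"
      unfolding fourier_add_cmult[OF h(1) h'(1)]
      by (rule comb) (fact lim lim' G G' Plancherel_L1_L2(1)[OF h] Plancherel_L1_L2(1)[OF h'])+
    show "sq_int lborel (\<lambda>x. h n x + c * h' n x)" for n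
      by (intro sq_int_add sq_int_cmult h h')
  qed (use F G F' G' h h' in \<open>auto intro: sq_int_add sq_int_cmult\<close>)
qed

text \<open>
  Parseval's identity, from \<open>fourier_L2_isometry\<close> by polarisation.
\<close>

lemma fourier_L2_inner:
  fixes F :: "'a::euclidean_space \<Rightarrow> complex"
  assumes "fourier_L2 F G" "fourier_L2 F' G'"
  shows "(LINT x|lborel. G x * cnj (G' x)) = of_real ((2 * pi) ^ DIM('a)) * (LINT x|lborel. F x * cnj (F' x))"
proof -
  have s: "sq_int lborel F" "sq_int lborel G" "sq_int lborel F'" "sq_int lborel G'"
    using assms by (auto simp: fourier_L2_def)
  have c: "(norm2 lborel (\<lambda>x. G x + c * G' x))\<^sup>2 = (2 * pi) ^ DIM('a) * (norm2 lborel (\<lambda>x. F x + c * F' x))\<^sup>2" for c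
    by (rule fourier_L2_isometry[OF fourier_L2_add_cmult[OF assms]])
  have m: "(\<lambda>x. P x - Q x) = (\<lambda>x. P x + (-1) * Q x)" "(\<lambda>x. P x - \<i> * Q x) = (\<lambda>x. P x + (-\<i>) * Q x)"
    "(\<lambda>x. P x + Q x) = (\<lambda>x. P x + 1 * Q x)" for P Q :: "'a \<Rightarrow> complex"
    by auto
  show ?thesis
    unfolding polarization_norm2[OF s(1,3)] polarization_norm2[OF s(2,4)]
    unfolding m(1)[of F F'] m(1)[of G G'] m(2) m(3)[of F F'] m(3)[of G G'] c of_real_mult
    by (simp add: algebra_simps)
qed

text \<open>
  Cut \<open>F\<close> off outside balls; by Plancherel's theorem the transforms form a Cauchy sequence.
\<close>

lemma fourier_L2_exists:
  fixes F :: "'a::euclidean_space \<Rightarrow> complex"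
  assumes F: "sq_int lborel F"
  shows "\<exists>G. fourier_L2 F G"
proof -
  have [measurable]: "F \<in> borel_measurable borel" using sq_int_measurable[OF F] by simp
  define h where "h n x = F x * indicator (ball 0 (real n)) x" for n x
  have [measurable]: "(\<lambda>x::'a. indicator (ball 0 (real n)) x :: complex) \<in> borel_measurable borel" for n
    by (rule borel_measurable_indicator) simp
  have [measurable]: "h n \<in> borel_measurable borel" for n
    unfolding h_def[abs_def] by measurable
  have sI: "sq_int lborel (\<lambda>x::'a. indicator (ball 0 (real n)) x)" for n
    unfolding sq_int_def
  proof
    have "integrable lborel (indicator (ball (0::'a) (real n)) :: _ \<Rightarrow> real)"
      using emeasure_lborel_ball_finite[of "0::'a" "real n"] by simp
    moreover have "(cmod (indicator (ball 0 (real n)) x))\<^sup>2 = indicator (ball (0::'a) (real n)) x" for x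
      by (simp add: indicator_def)
    ultimately show "integrable lborel (\<lambda>x::'a. (cmod (indicator (ball 0 (real n)) x))\<^sup>2)" by simp
  qed simp
  have h1: "integrable lborel (h n)" for n
    unfolding h_def[abs_def] by (rule sq_int_mult_integrable[OF F sI])
  have h2: "sq_int lborel (h n)" for n
    by (rule sq_int_bound[OF F, where C = 1]) (auto simp: h_def indicator_def)
  have lim: "(\<lambda>n. norm2 lborel (\<lambda>x. h n x - F x)) \<longlonglongrightarrow> 0"
  proof -
    have "(\<lambda>n. LINT x|lborel. (cmod (h n x - F x))\<^sup>2) \<longlonglongrightarrow> (LINT x|(lborel::'a measure). 0)"
    proof (rule integral_dominated_convergence[where w = "\<lambda>x. (cmod (F x))\<^sup>2"])
      show "AE x in lborel. (\<lambda>n. (cmod (h n x - F x))\<^sup>2) \<longlonglongrightarrow> 0"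
      proof (rule AE_I2)
        fix x :: 'a
        obtain N where N: "norm x < real N" using reals_Archimedean2 by blast
        show "(\<lambda>n. (cmod (h n x - F x))\<^sup>2) \<longlonglongrightarrow> 0"
          by (rule tendsto_eventually, rule eventually_sequentiallyI[of N])
             (use N in \<open>auto simp: h_def indicator_def\<close>)
      qed
      show "AE x in lborel. norm ((cmod (h n x - F x))\<^sup>2) \<le> (cmod (F x))\<^sup>2" for n
        by (rule AE_I2) (simp add: h_def indicator_def)
    qed (use F in \<open>auto simp: sq_int_def\<close>)
    then have "(\<lambda>n. sqrt (LINT x|lborel. (cmod (h n x - F x))\<^sup>2)) \<longlonglongrightarrow> sqrt 0"
      by (intro tendsto_real_sqrt) simp
    then show ?thesis by (simp add: norm2_def)
  qed
  define C where "C = sqrt ((2 * pi) ^ DIM('a))"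
  have C: "C > 0" by (simp add: C_def)
  have "\<exists>G. sq_int lborel G \<and> (\<lambda>n. norm2 lborel (\<lambda>x. fourier (h n) x - G x)) \<longlonglongrightarrow> 0"
  proof (rule l2_complete)
    show "sq_int lborel (fourier (h n))" for n by (rule Plancherel_L1_L2[OF h1 h2])
    fix e :: real assume "e > 0"
    then obtain N where N: "\<And>n. n \<ge> N \<Longrightarrow> norm2 lborel (\<lambda>x. h n x - F x) < e / (2 * C)"
      using LIMSEQ_D[OF lim, of "e / (2 * C)"] C by auto
    have "norm2 lborel (\<lambda>x. fourier (h m) x - fourier (h n) x) < e" if "m \<ge> N" "n \<ge> N" for m n
    proof -
      have "norm2 lborel (\<lambda>x. fourier (h m) x - fourier (h n) x) = C * norm2 lborel (\<lambda>x. h m x - h n x)"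
        unfolding fourier_diff[OF h1 h1, symmetric] C_def by (intro norm2_fourier sq_int_diff h2) (auto intro: h1)
      also have "norm2 lborel (\<lambda>x. h m x - h n x) \<le> norm2 lborel (\<lambda>x. h m x - F x) + norm2 lborel (\<lambda>x. h n x - F x)"
        using norm2_triangle_diff[OF h2 F h2, of m n] by (simp add: norm2_minus_commute[of lborel F])
      also have "\<dots> < e / (2 * C) + e / (2 * C)"
        by (intro add_strict_mono N that)
      finally show ?thesis using C by (simp add: mult_strict_left_mono field_simps)
    qed
    then show "\<exists>N. \<forall>m\<ge>N. \<forall>n\<ge>N. norm2 lborel (\<lambda>x. fourier (h m) x - fourier (h n) x) < e" by blast
  qed
  then obtain G where "sq_int lborel G" "(\<lambda>n. norm2 lborel (\<lambda>x. fourier (h n) x - G x)) \<longlonglongrightarrow> 0"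
    by blast
  then show ?thesis using F h1 h2 lim by (blast intro: fourier_L2I)
qed

lemma norm2_cis: "norm2 M (\<lambda>x. cis (f x) * g x) = norm2 M g"
  by (simp add: norm2_def norm_mult)

lemma sq_int_cis:
  "sq_int M g \<Longrightarrow> f \<in> borel_measurable M \<Longrightarrow> sq_int M (\<lambda>x. cis (f x) * g x)"
  by (rule sq_int_bound[where C = 1]) (auto simp: norm_mult)

text \<open>
  The transform turns a translation into the multiplication by a character, along any approximating
  sequence and hence in the limit.
\<close>

lemma fourier_L2_shift:
  assumes "fourier_L2 F G"
  shows "fourier_L2 (\<lambda>x. F (x + z)) (\<lambda>\<eta>. cis (z \<bullet> \<eta>) * G \<eta>)"
proof -
  obtain h where h: "fourier_L2_approx h F G" using assms unfolding fourier_L2_def by blast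
  note F = fourier_L2_sq_int(1)[OF assms] and G = fourier_L2_sq_int(2)[OF assms]
  note lim = fourier_L2_approxD(3,4)[OF h] and h = fourier_L2_approxD(1,2)[OF h]
  have hm: "h n \<in> borel_measurable borel" for n using h(1)[of n] by auto
  show ?thesis
  proof (rule fourier_L2I[where h = "\<lambda>n x. h n (x + z)"])
    show "(\<lambda>n. norm2 lborel (\<lambda>x. h n (x + z) - F (x + z))) \<longlonglongrightarrow> 0"
      unfolding sq_int_shift(2)[OF sq_int_diff[OF h(2) F]] by (rule lim)
    show "(\<lambda>n. norm2 lborel (\<lambda>\<eta>. fourier (\<lambda>x. h n (x + z)) \<eta> - cis (z \<bullet> \<eta>) * G \<eta>)) \<longlonglongrightarrow> 0"
      unfolding fourier_shift[OF hm] right_diff_distrib[symmetric] norm2_cis by (rule lim)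
  qed (use F G h in \<open>auto intro: sq_int_shift integrable_lborel_shift sq_int_cis\<close>)
qed

section \<open>Componentwise dilations\<close>

lemma Basis_vec_range: "(Basis :: (real ^ 'n) set) = range (\<lambda>k. axis k 1)"
  by (auto simp: Basis_vec_def)

lemma borel_measurable_vec_nth [measurable (raw)]:
  fixes f :: "'b \<Rightarrow> real ^ 'n"
  assumes "f \<in> borel_measurable M" shows "(\<lambda>x. f x $ k) \<in> borel_measurable M"
  unfolding cart_eq_inner_axis using assms by measurable

lemma borel_measurable_vec_lambda:
  fixes f :: "'b \<Rightarrow> 'n::finite \<Rightarrow> real"
  assumes "\<And>k. (\<lambda>x. f x k) \<in> borel_measurable M"
  shows "(\<lambda>x. \<chi> k. f x k) \<in> borel_measurable M"
  by (subst borel_measurable_euclidean_space) (auto simp: Basis_vec_range inner_axis assms)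

lemma borel_measurable_vec_times [measurable (raw)]:
  fixes f g :: "'b \<Rightarrow> real ^ 'n"
  assumes [measurable]: "f \<in> borel_measurable M" "g \<in> borel_measurable M"
  shows "(\<lambda>x. f x * g x) \<in> borel_measurable M"
  unfolding times_vec_def by (rule borel_measurable_vec_lambda) measurable

lemma borel_measurable_vec_div [measurable (raw)]:
  fixes f g :: "'b \<Rightarrow> real ^ 'n"
  assumes [measurable]: "f \<in> borel_measurable M" "g \<in> borel_measurable M"
  shows "(\<lambda>x. vec_div (f x) (g x)) \<in> borel_measurable M"
  unfolding vec_div_def by (rule borel_measurable_vec_lambda) measurable

lemma borel_measurable_prod_abs [measurable (raw)]:
  fixes f :: "'b \<Rightarrow> real ^ 'n"
  assumes [measurable]: "f \<in> borel_measurable M"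
  shows "(\<lambda>x. prod_abs (f x)) \<in> borel_measurable M"
  unfolding prod_abs_def by measurable

lemma nonzero_vecs_iff: "a \<in> nonzero_vecs \<longleftrightarrow> (\<forall>k. a $ k \<noteq> 0)"
  by (simp add: nonzero_vecs_def prod_abs_def)

lemma prod_abs_pos: "a \<in> nonzero_vecs \<Longrightarrow> prod_abs a > 0"
  by (simp add: nonzero_vecs_def prod_abs_def)

lemma prod_abs_nonneg: "0 \<le> prod_abs a"
  by (simp add: prod_abs_def)

lemma prod_abs_mult: "prod_abs (a * b) = prod_abs a * prod_abs b"
  by (simp add: prod_abs_def abs_mult prod.distrib)

lemma nonzero_vecs_sets [measurable]: "nonzero_vecs \<in> sets borel"
proof -
  have "{x \<in> space borel. prod_abs x \<noteq> 0} \<in> sets (borel :: (real ^ 'n) measure)" by measurable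
  then show ?thesis by (simp add: nonzero_vecs_def)
qed

lemma AE_nonzero_vecs: "AE a in lborel. a \<in> (nonzero_vecs :: (real ^ 'n) set)"
proof -
  have "AE a in (lborel :: (real ^ 'n) measure). a $ k \<noteq> 0" for k :: 'n
    using AE_inner_Basis_nonzero[of "axis k (1::real)"] by (simp add: Basis_vec_range cart_eq_inner_axis)
  then have "AE a in (lborel :: (real ^ 'n) measure). \<forall>k\<in>UNIV. a $ k \<noteq> 0"
    by (subst AE_ball_countable) auto
  then show ?thesis by (simp add: nonzero_vecs_iff)
qed

lemma diag_eq_Basis_sum:
  fixes a x :: "real ^ 'n"
  shows "(\<Sum>j\<in>Basis. ((a \<bullet> j) * (x \<bullet> j)) *\<^sub>R j) = a * x"
proof (rule euclidean_eqI)
  fix b :: "real ^ 'n" assume b: "b \<in> Basis"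
  then obtain k where k: "b = axis k 1" by (auto simp: Basis_vec_range)
  have "(\<Sum>j\<in>Basis. ((a \<bullet> j) * (x \<bullet> j)) *\<^sub>R j) \<bullet> b = (a \<bullet> b) * (x \<bullet> b)"
    using b by (simp add: inner_sum_left_Basis)
  then show "(\<Sum>j\<in>Basis. ((a \<bullet> j) * (x \<bullet> j)) *\<^sub>R j) \<bullet> b = (a * x) \<bullet> b"
    by (simp add: k inner_axis)
qed

text \<open>
  A product \<open>a * x\<close> of vectors is componentwise, so \<open>x \<mapsto> a * x\<close> is a diagonal linear map with
  determinant \<open>\<plusminus> prod_abs a\<close>.
\<close>

lemma lborel_diag:
  fixes a :: "real ^ 'n"
  assumes a: "a \<in> nonzero_vecs"
  shows "lborel = density (distr lborel borel (\<lambda>x. a * x)) (\<lambda>_. ennreal (prod_abs a))"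
proof -
  have P: "(\<Prod>j\<in>Basis. \<bar>a \<bullet> j\<bar>) = prod_abs a"
    unfolding Basis_vec_range by (subst prod.reindex) (auto simp: inj_on_def axis_eq_axis inner_axis prod_abs_def abs_prod)
  have "\<And>j. j \<in> Basis \<Longrightarrow> a \<bullet> j \<noteq> 0"
    using a by (auto simp: Basis_vec_range inner_axis nonzero_vecs_iff)
  from lborel_affine_euclidean[of "\<lambda>j. a \<bullet> j" 0, OF this] show ?thesis
    unfolding add_0 diag_eq_Basis_sum P .
qed

lemma lebesgue_diag_measurable:
  fixes a :: "real ^ 'n"
  assumes a: "a \<in> nonzero_vecs"
  shows "(\<lambda>x. t + a * x) \<in> lebesgue \<rightarrow>\<^sub>M lebesgue"
proof -
  have "\<And>j. j \<in> Basis \<Longrightarrow> a \<bullet> j \<noteq> 0"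
    using a by (auto simp: Basis_vec_range inner_axis nonzero_vecs_iff)
  from lebesgue_affine_measurable[of "\<lambda>j. a \<bullet> j" t, OF this] show ?thesis
    unfolding diag_eq_Basis_sum .
qed

lemma AE_lborel_diag:
  fixes a :: "real ^ 'n"
  assumes a: "a \<in> nonzero_vecs" and P: "AE x in lborel. P x"
  shows "AE x in lborel. P (a * x)"
proof -
  have "AE x in density (distr lborel borel (\<lambda>x. a * x)) (\<lambda>_. ennreal (prod_abs a)). P x"
    using P by (subst (asm) lborel_diag[OF a])
  then have "AE x in distr lborel borel (\<lambda>x. a * x). P x"
    using prod_abs_pos[OF a] by (simp add: AE_density)
  then show ?thesis by (rule AE_distrD[rotated]) measurable
qed

lemma inner_vec_times_commute: "(a * x) \<bullet> y = x \<bullet> (a * y)" for a x y :: "real ^ 'n"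
  by (simp add: inner_vec_def mult_ac)

lemma vec_div_times: "a \<in> nonzero_vecs \<Longrightarrow> vec_div (a * x) a = x"
  by (simp add: vec_div_def vec_eq_iff nonzero_vecs_iff)

lemma vec_div_times': "a \<in> nonzero_vecs \<Longrightarrow> a * vec_div x a = x"
  by (simp add: vec_div_def vec_eq_iff nonzero_vecs_iff)

definition vec_inverse :: "real ^ 'n \<Rightarrow> real ^ 'n" where "vec_inverse a = (\<chi> k. inverse (a $ k))"

lemma vec_inverse_nonzero: "a \<in> nonzero_vecs \<Longrightarrow> vec_inverse a \<in> nonzero_vecs"
  by (simp add: nonzero_vecs_iff vec_inverse_def)

lemma vec_div_vec_inverse: "vec_div x a = vec_inverse a * x"
  by (simp add: vec_div_def vec_inverse_def vec_eq_iff divide_inverse mult.commute)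

lemma vec_div_diff_eq: "vec_div (t - b) a = vec_inverse a * (- b) + vec_inverse a * t" for a :: "real ^ 'n"
  by (simp add: vec_div_def vec_inverse_def vec_eq_iff divide_inverse algebra_simps)

lemmas nn_integral_diag = affine_density_nn_integral[OF lborel_diag]

lemmas integral_diag = affine_density_integral[OF lborel_diag prod_abs_pos]

lemmas integrable_diag = affine_density_integrable[OF lborel_diag prod_abs_pos]

lemma sq_int_diag:
  fixes F :: "real ^ 'n \<Rightarrow> complex"
  assumes a: "a \<in> nonzero_vecs" and F: "sq_int lborel F"
  shows "sq_int lborel (\<lambda>x. F (a * x))" "norm2 lborel (\<lambda>x. F (a * x)) = norm2 lborel F / sqrt (prod_abs a)"
proof -
  have [measurable]: "F \<in> borel_measurable borel" using sq_int_measurable[OF F] by simp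
  show s: "sq_int lborel (\<lambda>x. F (a * x))"
    using integrable_diag[OF a a, of "\<lambda>x. (cmod (F x))\<^sup>2"] F by (simp add: sq_int_def)
  have "complex_of_real (LINT x|lborel. (cmod (F x))\<^sup>2) = of_real (prod_abs a * (LINT x|lborel. (cmod (F (a * x)))\<^sup>2))"
    using integral_diag[OF a a, of "\<lambda>x. of_real ((cmod (F x))\<^sup>2)"] by (simp del: of_real_power)
  then have "(LINT x|lborel. (cmod (F x))\<^sup>2) = prod_abs a * (LINT x|lborel. (cmod (F (a * x)))\<^sup>2)"
    by (simp only: of_real_eq_iff)
  then show "norm2 lborel (\<lambda>x. F (a * x)) = norm2 lborel F / sqrt (prod_abs a)"
    using prod_abs_pos[OF a] by (simp add: norm2_def real_sqrt_mult)
qed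

lemma fourier_diag:
  assumes a: "a \<in> nonzero_vecs" and [measurable]: "u \<in> borel_measurable borel"
  shows "fourier (\<lambda>x. u (vec_div x a)) \<eta> = of_real (prod_abs a) * fourier u (a * \<eta>)"
proof -
  have "fourier (\<lambda>x. u (vec_div x a)) \<eta> = of_real (prod_abs a) * (LINT x|lborel. u (vec_div (a * x) a) * cis (- ((a * x) \<bullet> \<eta>)))"
    unfolding fourier_def by (rule integral_diag[OF a a]) measurable
  then show ?thesis
    unfolding fourier_def vec_div_times[OF a] inner_vec_times_commute .
qed

lemma fourier_L2_diag:
  fixes a :: "real ^ 'n"
  assumes FG: "fourier_L2 F G" and a: "a \<in> nonzero_vecs"
  shows "fourier_L2 (\<lambda>x. F (vec_div x a)) (\<lambda>\<eta>. of_real (prod_abs a) * G (a * \<eta>))"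
proof -
  note a' = vec_inverse_nonzero[OF a]
  obtain h where h: "fourier_L2_approx h F G" using FG unfolding fourier_L2_def by blast
  note F = fourier_L2_sq_int(1)[OF FG] and G = fourier_L2_sq_int(2)[OF FG]
  note lim = fourier_L2_approxD(3,4)[OF h] and h = fourier_L2_approxD(1,2)[OF h]
  have hm: "h n \<in> borel_measurable borel" for n using h(1)[of n] by auto
  show ?thesis
  proof (rule fourier_L2I[where h = "\<lambda>n x. h n (vec_div x a)"])
    show "(\<lambda>n. norm2 lborel (\<lambda>x. h n (vec_div x a) - F (vec_div x a))) \<longlonglongrightarrow> 0"
      unfolding vec_div_vec_inverse sq_int_diag(2)[OF a' sq_int_diff[OF h(2) F]]
      using tendsto_divide_zero[OF lim(1)] .
    show "(\<lambda>n. norm2 lborel (\<lambda>\<eta>. fourier (\<lambda>x. h n (vec_div x a)) \<eta> - of_real (prod_abs a) * G (a * \<eta>))) \<longlonglongrightarrow> 0"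
      unfolding fourier_diag[OF a hm] right_diff_distrib[symmetric] norm2_cmult
        sq_int_diag(2)[OF a sq_int_diff[OF Plancherel_L1_L2(1)[OF h] G]]
      by (intro tendsto_mult_right_zero tendsto_divide_zero lim)
    show "integrable lborel (\<lambda>x. h n (vec_div x a))" for n
      unfolding vec_div_vec_inverse by (rule integrable_diag[OF a' a']) (auto intro: h)
  qed (auto simp: vec_div_vec_inverse intro!: sq_int_diag(1)[OF a'] sq_int_diag(1)[OF a] sq_int_cmult F G h)
qed

section \<open>Energy of the wavelet transform\<close>

definition wavelet_coeff :: "(real ^ 'n \<Rightarrow> complex) \<Rightarrow> (real ^ 'n \<Rightarrow> complex) \<Rightarrow> real ^ 'n \<Rightarrow> real ^ 'n \<Rightarrow> complex" where
  "wavelet_coeff \<phi> g a b = of_real (1 / sqrt (prod_abs a)) * (LINT t|lborel. g t * cnj (\<phi> (vec_div (t - b) a)))"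

text \<open>
  With the weight \<open>1 / prod_abs a\<close> the measure \<open>da db / \<bar>a\<bar>\<^sup>2\<close> becomes Lebesgue measure on pairs
  \<open>(a, b)\<close>, for which translations in \<open>b\<close> are ordinary translations. Division by zero gives \<open>0\<close>, so
  the coefficient vanishes when a component of \<open>a\<close> does, and such \<open>a\<close> need no separate treatment.
\<close>

definition weighted_coeff :: "(real ^ 'n \<Rightarrow> complex) \<Rightarrow> (real ^ 'n \<Rightarrow> complex) \<Rightarrow> (real ^ 'n) \<times> (real ^ 'n) \<Rightarrow> complex" where
  "weighted_coeff \<phi> g x = wavelet_coeff \<phi> g (fst x) (snd x) / of_real (prod_abs (fst x))"

lemma wavelet_coeff_measurable [measurable]:
  assumes [measurable]: "\<phi> \<in> borel_measurable borel" "g \<in> borel_measurable borel"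
  shows "(\<lambda>x. wavelet_coeff \<phi> g (fst x) (snd x)) \<in> borel_measurable (borel \<Otimes>\<^sub>M borel)"
  unfolding wavelet_coeff_def by measurable

lemma weighted_coeff_measurable [measurable]:
  assumes [measurable]: "\<phi> \<in> borel_measurable borel" "g \<in> borel_measurable borel"
  shows "weighted_coeff \<phi> g \<in> borel_measurable borel"
  unfolding weighted_coeff_def[abs_def] borel_prod[symmetric] by measurable

text \<open>
  Parseval's identity for \<open>g\<close> and the dilated and translated \<open>\<phi>\<close>. The translation by \<open>b\<close> becomes a
  character, so the coefficient is a Fourier integral in \<open>b\<close>.
\<close>

lemma wavelet_coeff_eq_fourier:
  fixes a :: "real ^ 'n"
  assumes g: "fourier_L2 g \<gamma>" and \<phi>: "fourier_L2 \<phi> \<omega>" and a: "a \<in> nonzero_vecs"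
  shows "wavelet_coeff \<phi> g a b = of_real (sqrt (prod_abs a) / (2 * pi) ^ CARD('n)) * fourier (\<lambda>\<eta>. \<gamma> \<eta> * cnj (\<omega> (a * \<eta>))) (- b)"
proof -
  let ?I = "LINT t|lborel. g t * cnj (\<phi> (vec_div (t - b) a))"
  have p: "prod_abs a > 0" by (rule prod_abs_pos[OF a])
  have "fourier_L2 (\<lambda>t. \<phi> (vec_div (t + - b) a)) (\<lambda>\<eta>. cis ((- b) \<bullet> \<eta>) * (of_real (prod_abs a) * \<omega> (a * \<eta>)))"
    by (rule fourier_L2_shift[OF fourier_L2_diag[OF \<phi> a]])
  from fourier_L2_inner[OF g this]
  have "of_real ((2 * pi) ^ CARD('n)) * ?I
      = (LINT \<eta>|lborel. \<gamma> \<eta> * cnj (cis ((- b) \<bullet> \<eta>) * (of_real (prod_abs a) * \<omega> (a * \<eta>))))"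
    by simp
  also have "\<dots> = (LINT \<eta>|lborel. of_real (prod_abs a) * (\<gamma> \<eta> * cnj (\<omega> (a * \<eta>)) * cis (- (\<eta> \<bullet> (- b)))))"
    by (intro Bochner_Integration.integral_cong) (auto simp: cis_cnj inner_commute mult_ac)
  also have "\<dots> = of_real (prod_abs a) * fourier (\<lambda>\<eta>. \<gamma> \<eta> * cnj (\<omega> (a * \<eta>))) (- b)"
    unfolding fourier_def by (rule integral_mult_right_zero)
  finally have I: "?I = of_real (prod_abs a / (2 * pi) ^ CARD('n)) * fourier (\<lambda>\<eta>. \<gamma> \<eta> * cnj (\<omega> (a * \<eta>))) (- b)"
    by (simp add: field_simps)
  have "1 / sqrt (prod_abs a) * (prod_abs a / (2 * pi) ^ CARD('n)) = sqrt (prod_abs a) / (2 * pi) ^ CARD('n)"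
    using p by (simp add: real_div_sqrt)
  then show ?thesis
    unfolding wavelet_coeff_def I mult.assoc[symmetric] of_real_mult[symmetric] by simp
qed

text \<open>
  Plancherel's theorem applied to \<open>wavelet_coeff_eq_fourier\<close>. The function \<open>\<eta> \<mapsto> \<gamma>(\<eta>) cnj (\<omega>(a \<eta>))\<close> is always
  integrable; the hypothesis of finiteness makes it square integrable as well.
\<close>

lemma wavelet_coeff_energy_fixed_scale:
  fixes a :: "real ^ 'n"
  assumes g: "fourier_L2 g \<gamma>" and \<phi>: "fourier_L2 \<phi> \<omega>" and a: "a \<in> nonzero_vecs"
    and fin: "(\<integral>\<^sup>+\<eta>. ennreal ((cmod (\<gamma> \<eta>))\<^sup>2 * (cmod (\<omega> (a * \<eta>)))\<^sup>2 / prod_abs a) \<partial>lborel) < \<infinity>" (is "?R < _")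
  shows "(\<integral>\<^sup>+b. ennreal ((cmod (weighted_coeff \<phi> g (a, b)))\<^sup>2) \<partial>lborel)
    = ennreal (1 / (2 * pi) ^ CARD('n)) *
      ?R"
proof -
  note [measurable] = fourier_L2_measurable[OF g] fourier_L2_measurable[OF \<phi>]
  have p: "prod_abs a > 0" by (rule prod_abs_pos[OF a])
  define u where "u \<eta> = \<gamma> \<eta> * cnj (\<omega> (a * \<eta>))" for \<eta>
  have um[measurable]: "u \<in> borel_measurable borel" unfolding u_def[abs_def] by measurable
  have fin_eq: "?R
      = ennreal (1 / prod_abs a) * (\<integral>\<^sup>+\<eta>. ennreal ((cmod (u \<eta>))\<^sup>2) \<partial>lborel)"
  proof -
    have "ennreal ((cmod (\<gamma> \<eta>))\<^sup>2 * (cmod (\<omega> (a * \<eta>)))\<^sup>2 / prod_abs a) = ennreal (1 / prod_abs a) * ennreal ((cmod (u \<eta>))\<^sup>2)" for \<eta>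
      using p by (subst ennreal_mult[symmetric]) (auto simp: u_def norm_mult power_mult_distrib)
    then show ?thesis by (simp add: nn_integral_cmult)
  qed
  have u2: "sq_int lborel u"
  proof (rule sq_intI_nn_integral)
    show "(\<integral>\<^sup>+\<eta>. ennreal ((cmod (u \<eta>))\<^sup>2) \<partial>lborel) < \<infinity>"
      using fin p unfolding fin_eq by (auto simp: ennreal_mult_less_top less_top[symmetric] ennreal_mult_eq_top_iff)
  qed simp
  have u1: "integrable lborel u"
    unfolding u_def[abs_def]
    by (intro sq_int_mult_integrable sq_int_cnj sq_int_diag(1)[OF a] fourier_L2_sq_int[OF g] fourier_L2_sq_int[OF \<phi>])
  have W: "(cmod (weighted_coeff \<phi> g (a, b)))\<^sup>2 = (1 / (prod_abs a * ((2 * pi) ^ CARD('n))\<^sup>2)) * (cmod (fourier u (- b)))\<^sup>2" for b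
  proof -
    have "weighted_coeff \<phi> g (a, b) = of_real (sqrt (prod_abs a) / (2 * pi) ^ CARD('n) / prod_abs a) * fourier u (- b)"
      unfolding weighted_coeff_def fst_conv snd_conv wavelet_coeff_eq_fourier[OF g \<phi> a] u_def[abs_def] by simp
    then have "(cmod (weighted_coeff \<phi> g (a, b)))\<^sup>2 = (sqrt (prod_abs a) / (2 * pi) ^ CARD('n) / prod_abs a)\<^sup>2 * (cmod (fourier u (- b)))\<^sup>2"
      by (simp only: norm_mult norm_of_real power_mult_distrib power2_abs)
    also have "(sqrt (prod_abs a) / (2 * pi) ^ CARD('n) / prod_abs a)\<^sup>2 = 1 / (prod_abs a * ((2 * pi) ^ CARD('n))\<^sup>2)"
      using p by (simp add: power_divide power2_eq_square)
    finally show ?thesis .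
  qed
  have "(\<integral>\<^sup>+b. ennreal ((cmod (weighted_coeff \<phi> g (a, b)))\<^sup>2) \<partial>lborel)
     = ennreal (1 / (prod_abs a * ((2 * pi) ^ CARD('n))\<^sup>2)) * (\<integral>\<^sup>+b. ennreal ((cmod (fourier u (- b)))\<^sup>2) \<partial>lborel)"
  proof -
    have "0 \<le> 1 / (prod_abs a * ((2 * pi) ^ CARD('n))\<^sup>2)" using p by simp
    then show ?thesis
      unfolding W by (simp only: ennreal_mult') (rule nn_integral_cmult, measurable)
  qed
  also have "(\<integral>\<^sup>+b. ennreal ((cmod (fourier u (- b)))\<^sup>2) \<partial>lborel) = ennreal ((norm2 lborel (fourier u))\<^sup>2)"
    using nn_integral_lborel_uminus[of "\<lambda>b. ennreal ((cmod (fourier u b))\<^sup>2)"]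
      sq_int_nn_integral[OF Plancherel_L1_L2(1)[OF u1 u2]] by simp
  also have "\<dots> = ennreal ((2 * pi) ^ CARD('n) * (norm2 lborel u)\<^sup>2)"
    using Plancherel_L1_L2(2)[OF u1 u2] by simp
  also have "ennreal (1 / (prod_abs a * ((2 * pi) ^ CARD('n))\<^sup>2)) * ennreal ((2 * pi) ^ CARD('n) * (norm2 lborel u)\<^sup>2)
     = ennreal (1 / (2 * pi) ^ CARD('n)) * (ennreal (1 / prod_abs a) * ennreal ((norm2 lborel u)\<^sup>2))"
    using p by (simp add: ennreal_mult[symmetric] power2_eq_square)
  also have "\<dots> = ennreal (1 / (2 * pi) ^ CARD('n)) *
      ?R"
    unfolding fin_eq sq_int_nn_integral[OF u2] ..
  finally show ?thesis .
qed

text \<open>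
  The measure \<open>da / \<bar>a\<bar>\<close> is invariant under componentwise multiplication.
\<close>

lemma scale_integral_invariant:
  fixes \<eta> :: "real ^ 'n"
  assumes [measurable]: "\<omega> \<in> borel_measurable borel" and \<eta>: "\<eta> \<in> nonzero_vecs"
  shows "(\<integral>\<^sup>+a. ennreal ((cmod (\<omega> (a * \<eta>)))\<^sup>2 / prod_abs a) \<partial>lborel)
    = (\<integral>\<^sup>+u. ennreal ((cmod (\<omega> u))\<^sup>2 / prod_abs u) \<partial>lborel)"
proof -
  have p: "prod_abs \<eta> > 0" by (rule prod_abs_pos[OF \<eta>])
  have nn: "0 \<le> prod_abs a" for a :: "real ^ 'n" by (simp add: prod_abs_def)
  have "(\<integral>\<^sup>+u. ennreal ((cmod (\<omega> u))\<^sup>2 / prod_abs u) \<partial>lborel)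
     = ennreal (prod_abs \<eta>) * (\<integral>\<^sup>+a. ennreal ((cmod (\<omega> (\<eta> * a)))\<^sup>2 / prod_abs (\<eta> * a)) \<partial>lborel)"
    by (rule nn_integral_diag[OF \<eta>]) measurable
  also have "\<dots> = (\<integral>\<^sup>+a. ennreal (prod_abs \<eta>) * ennreal ((cmod (\<omega> (\<eta> * a)))\<^sup>2 / prod_abs (\<eta> * a)) \<partial>lborel)"
    by (rule nn_integral_cmult[symmetric]) measurable
  also have "\<dots> = (\<integral>\<^sup>+a. ennreal ((cmod (\<omega> (a * \<eta>)))\<^sup>2 / prod_abs a) \<partial>lborel)"
    using p nn by (intro nn_integral_cong) (simp add: ennreal_mult[symmetric] prod_abs_mult mult.commute)
  finally show ?thesis by simp
qed

text \<open>
  Integrate \<open>wavelet_coeff_energy_fixed_scale\<close> over \<open>a\<close>. By Tonelli's theorem and \<open>scale_integral_invariant\<close> the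
  result is a multiple of \<open>K \<parallel>\<gamma>\<parallel>\<^sup>2\<close>. As this is finite, almost every \<open>a\<close> satisfies the hypothesis of
  finiteness there.
\<close>

theorem weighted_coeff_isometry:
  fixes g \<phi> :: "real ^ 'n \<Rightarrow> complex"
  assumes g: "fourier_L2 g \<gamma>" and \<phi>: "fourier_L2 \<phi> \<omega>" and K: "0 \<le> K"
    "(\<integral>\<^sup>+u. ennreal ((cmod (\<omega> u))\<^sup>2 / prod_abs u) \<partial>lborel) = ennreal K"
  shows "sq_int lborel (weighted_coeff \<phi> g)" "(norm2 lborel (weighted_coeff \<phi> g))\<^sup>2 = K * (norm2 lborel g)\<^sup>2"
proof -
  let ?f = "\<lambda>a \<eta>. ennreal ((cmod (\<gamma> \<eta>))\<^sup>2 * (cmod (\<omega> (a * \<eta>)))\<^sup>2 / prod_abs a)"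
  let ?W = "\<lambda>a. \<integral>\<^sup>+b. ennreal ((cmod (weighted_coeff \<phi> g (a, b)))\<^sup>2) \<partial>lborel"
  note [measurable] = fourier_L2_measurable[OF g] fourier_L2_measurable[OF \<phi>]
  \<comment> \<open>Up to a constant, \<open>R a\<close> is the energy of the coefficients at scale \<open>a\<close>.\<close>
  define R where "R a = (\<integral>\<^sup>+\<eta>. ?f a \<eta> \<partial>lborel)" for a
  have Rm[measurable]: "R \<in> borel_measurable borel" unfolding R_def[abs_def] by measurable
  have "(\<integral>\<^sup>+a. R a \<partial>lborel) = (\<integral>\<^sup>+\<eta>. \<integral>\<^sup>+a. ?f a \<eta> \<partial>lborel \<partial>lborel)"
    unfolding R_def by (rule lborel_pair.Fubini') measurable
  also have "\<dots> = (\<integral>\<^sup>+\<eta>. ennreal K * ennreal ((cmod (\<gamma> \<eta>))\<^sup>2) \<partial>lborel)"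
  proof (rule nn_integral_cong_AE)
    show "AE \<eta> in lborel. (\<integral>\<^sup>+a. ?f a \<eta> \<partial>lborel) = ennreal K * ennreal ((cmod (\<gamma> \<eta>))\<^sup>2)"
      using AE_nonzero_vecs
    proof eventually_elim
      case (elim \<eta>)
      have "(\<integral>\<^sup>+a. ?f a \<eta> \<partial>lborel)
        = (\<integral>\<^sup>+a. ennreal ((cmod (\<gamma> \<eta>))\<^sup>2) * ennreal ((cmod (\<omega> (a * \<eta>)))\<^sup>2 / prod_abs a) \<partial>lborel)"
        by (intro nn_integral_cong) (simp add: ennreal_mult[symmetric] prod_abs_def)
      also have "\<dots> = ennreal ((cmod (\<gamma> \<eta>))\<^sup>2) * ennreal K"
        by (subst nn_integral_cmult) (simp_all add: scale_integral_invariant elim K)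
      finally show ?case by (simp add: mult.commute)
    qed
  qed
  also have "\<dots> = ennreal K * ennreal ((2 * pi) ^ CARD('n) * (norm2 lborel g)\<^sup>2)"
    using sq_int_nn_integral[OF fourier_L2_sq_int(2)[OF g]] fourier_L2_isometry[OF g] by (simp add: nn_integral_cmult)
  finally have R: "(\<integral>\<^sup>+a. R a \<partial>lborel) = ennreal K * ennreal ((2 * pi) ^ CARD('n) * (norm2 lborel g)\<^sup>2)" .
  then have "(\<integral>\<^sup>+a. R a \<partial>lborel) \<noteq> \<infinity>" by (simp add: ennreal_mult_eq_top_iff)
  then have "AE a in lborel. R a \<noteq> \<infinity>" by (intro nn_integral_noteq_infinite) auto
  then have AE: "AE a in lborel. ?W a = ennreal (1 / (2 * pi) ^ CARD('n)) * R a"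
    using AE_nonzero_vecs
    by eventually_elim (use wavelet_coeff_energy_fixed_scale[OF g \<phi>] in \<open>simp add: R_def less_top\<close>)
  have "(\<integral>\<^sup>+x. ennreal ((cmod (weighted_coeff \<phi> g x))\<^sup>2) \<partial>lborel) = (\<integral>\<^sup>+a. ?W a \<partial>lborel)"
    unfolding lborel_prod[symmetric] by (rule lborel.nn_integral_fst[symmetric]) (simp add: lborel_prod)
  also have "\<dots> = (\<integral>\<^sup>+a. ennreal (1 / (2 * pi) ^ CARD('n)) * R a \<partial>lborel)"
    by (rule nn_integral_cong_AE[OF AE])
  also have "\<dots> = ennreal (1 / (2 * pi) ^ CARD('n)) * (ennreal K * ennreal ((2 * pi) ^ CARD('n) * (norm2 lborel g)\<^sup>2))"
    by (simp add: nn_integral_cmult R)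
  also have "\<dots> = ennreal (K * (norm2 lborel g)\<^sup>2)"
    using K(1) by (simp add: ennreal_mult[symmetric])
  finally have E: "(\<integral>\<^sup>+x. ennreal ((cmod (weighted_coeff \<phi> g x))\<^sup>2) \<partial>lborel) = ennreal (K * (norm2 lborel g)\<^sup>2)" .
  show s: "sq_int lborel (weighted_coeff \<phi> g)"
    by (rule sq_intI_nn_integral) (simp_all add: E)
  show "(norm2 lborel (weighted_coeff \<phi> g))\<^sup>2 = K * (norm2 lborel g)\<^sup>2"
    using E K(1) unfolding sq_int_nn_integral[OF s] by (subst (asm) ennreal_inj) auto
qed

section \<open>The uncertainty inequality for wavelet coefficients\<close>

text \<open>
  The constant \<open>S\<close> stands for the norm of the derivative of \<open>H\<close> in the direction \<open>e\<close>, but only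
  difference quotients occur: the inequality for a step \<open>s\<close> comes from an exact substitution and
  carries an error of order \<open>s\<close>, which disappears as \<open>s\<close> tends to \<open>0\<close>.
\<close>

theorem Heisenberg_finite_differences:
  fixes H :: "'a::euclidean_space \<Rightarrow> complex" and e :: 'a
  assumes H: "sq_int lborel H" and XH: "sq_int lborel (\<lambda>x. of_real (x \<bullet> e) * H x)"
    and e: "e \<bullet> e = 1"
    and S: "\<And>s. s > 0 \<Longrightarrow> norm2 lborel (\<lambda>x. H (x + s *\<^sub>R e) - H x) \<le> s * S"
  shows "(norm2 lborel H)\<^sup>2 \<le> 2 * (norm2 lborel (\<lambda>x. of_real (x \<bullet> e) * H x) * S)"
proof -
  let ?L = "norm2 lborel H" and ?X = "norm2 lborel (\<lambda>x. of_real (x \<bullet> e) * H x)"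
  have [measurable]: "H \<in> borel_measurable borel" using sq_int_measurable[OF H] by simp
  have step: "?L\<^sup>2 \<le> S * (2 * ?X + s * ?L)" if s: "s > 0" for s
  proof -
    define T where "T x = H (x + s *\<^sub>R e)" for x
    let ?p = "\<lambda>F x. cmod (of_real (x \<bullet> e) * F x) * cmod (T x - H x)"
    have T: "sq_int lborel T" and TL: "norm2 lborel T = ?L"
      unfolding T_def using sq_int_shift[OF H] by auto
    have [measurable]: "T \<in> borel_measurable borel" using sq_int_measurable[OF T] by simp
    have sh: "sq_int lborel (\<lambda>x. of_real ((x + s *\<^sub>R e) \<bullet> e) * T x)"
      "norm2 lborel (\<lambda>x. of_real ((x + s *\<^sub>R e) \<bullet> e) * T x) = ?X"
      using sq_int_shift[OF XH, of "s *\<^sub>R e"] by (simp_all add: T_def)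
    \<comment> \<open>\<open>T\<close> times the weight is a translate of \<open>H\<close> times the weight, up to the term \<open>- s T\<close>.\<close>
    have XT_eq: "(\<lambda>x. of_real (x \<bullet> e) * T x) = (\<lambda>x. of_real ((x + s *\<^sub>R e) \<bullet> e) * T x + (- of_real s) * T x)"
      by (auto simp: inner_add_left e algebra_simps)
    have XT: "sq_int lborel (\<lambda>x. of_real (x \<bullet> e) * T x)"
      unfolding XT_eq by (intro sq_int_add sh sq_int_cmult T)
    have XT_le: "norm2 lborel (\<lambda>x. of_real (x \<bullet> e) * T x) \<le> ?X + s * ?L"
      using norm2_triangle[OF sh(1) sq_int_cmult[OF T, of "- of_real s"]] s
      unfolding XT_eq sh(2) norm2_cmult TL by simp
    have D: "sq_int lborel (\<lambda>x. T x - H x)" by (rule sq_int_diff[OF T H])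
    have D_le: "norm2 lborel (\<lambda>x. T x - H x) \<le> s * S" unfolding T_def by (rule S[OF s])
    have iH: "integrable lborel (\<lambda>x. (x \<bullet> e) * (cmod (H x))\<^sup>2)"
      and iT: "integrable lborel (\<lambda>x. (x \<bullet> e) * (cmod (T x))\<^sup>2)"
    proof -
      have gen: "integrable lborel (\<lambda>x. (x \<bullet> e) * (cmod (F x))\<^sup>2)"
        if "sq_int lborel F" "sq_int lborel (\<lambda>x. of_real (x \<bullet> e) * F x)" for F
      proof -
        have "integrable lborel (\<lambda>x. of_real (x \<bullet> e) * F x * cnj (F x))"
          using that by (intro sq_int_mult_integrable sq_int_cnj)
        then have "integrable lborel (\<lambda>x. complex_of_real ((x \<bullet> e) * (cmod (F x))\<^sup>2))"
          by (simp add: mult.assoc complex_norm_square[symmetric])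
        then show ?thesis by (simp only: complex_of_real_integrable_eq)
      qed
      show "integrable lborel (\<lambda>x. (x \<bullet> e) * (cmod (H x))\<^sup>2)" by (rule gen[OF H XH])
      show "integrable lborel (\<lambda>x. (x \<bullet> e) * (cmod (T x))\<^sup>2)" by (rule gen[OF T XT])
    qed
    have iT2: "integrable lborel (\<lambda>x. (cmod (T x))\<^sup>2)" using T by (simp add: sq_int_def)
    have "(LINT x|lborel. (x \<bullet> e) * (cmod (H x))\<^sup>2) = (LINT x|lborel. ((x + s *\<^sub>R e) \<bullet> e) * (cmod (H (x + s *\<^sub>R e)))\<^sup>2)"
      by (rule integral_lborel_shift[symmetric]) measurable
    also have "\<dots> = (LINT x|lborel. (x \<bullet> e) * (cmod (T x))\<^sup>2 + s * (cmod (T x))\<^sup>2)"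
      by (simp add: T_def inner_add_left e algebra_simps)
    also have "\<dots> = (LINT x|lborel. (x \<bullet> e) * (cmod (T x))\<^sup>2) + s * ?L\<^sup>2"
      using iT iT2 TL by (simp add: norm2_power2[symmetric])
    finally have "s * ?L\<^sup>2 = (LINT x|lborel. (x \<bullet> e) * (cmod (H x))\<^sup>2 - (x \<bullet> e) * (cmod (T x))\<^sup>2)"
      using iH iT by simp
    also have "\<dots> \<le> (LINT x|lborel. ?p H x + ?p T x)"
    proof (rule integral_mono)
      show "integrable lborel (\<lambda>x. ?p H x + ?p T x)"
        using integrable_norm[OF sq_int_mult_integrable[OF XH D]] integrable_norm[OF sq_int_mult_integrable[OF XT D]]
        by (simp add: norm_mult)
      fix x
      have "(cmod (H x))\<^sup>2 - (cmod (T x))\<^sup>2 = (cmod (H x) - cmod (T x)) * (cmod (H x) + cmod (T x))"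
        by (simp add: power2_eq_square square_diff_square_factored mult.commute)
      then have "\<bar>(cmod (H x))\<^sup>2 - (cmod (T x))\<^sup>2\<bar> = \<bar>cmod (H x) - cmod (T x)\<bar> * (cmod (H x) + cmod (T x))"
        by (simp add: abs_mult)
      also have "\<dots> \<le> cmod (T x - H x) * (cmod (H x) + cmod (T x))"
        using norm_triangle_ineq3[of "H x" "T x"] by (intro mult_right_mono) (auto simp: norm_minus_commute)
      finally have "\<bar>x \<bullet> e\<bar> * \<bar>(cmod (H x))\<^sup>2 - (cmod (T x))\<^sup>2\<bar> \<le> \<bar>x \<bullet> e\<bar> * (cmod (T x - H x) * (cmod (H x) + cmod (T x)))"
        by (intro mult_left_mono) auto
      then have "(x \<bullet> e) * ((cmod (H x))\<^sup>2 - (cmod (T x))\<^sup>2) \<le> \<bar>x \<bullet> e\<bar> * (cmod (T x - H x) * (cmod (H x) + cmod (T x)))"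
        unfolding abs_mult[symmetric] by (rule order_trans[OF abs_ge_self])
      then show "(x \<bullet> e) * (cmod (H x))\<^sup>2 - (x \<bullet> e) * (cmod (T x))\<^sup>2
        \<le> ?p H x + ?p T x"
        by (simp add: norm_mult algebra_simps)
    qed (use iH iT in auto)
    also have "\<dots> = (LINT x|lborel. ?p H x) + (LINT x|lborel. ?p T x)"
      using integrable_norm[OF sq_int_mult_integrable[OF XH D]] integrable_norm[OF sq_int_mult_integrable[OF XT D]]
      by (intro Bochner_Integration.integral_add) (simp_all add: norm_mult)
    also have "\<dots> \<le> ?X * norm2 lborel (\<lambda>x. T x - H x) + norm2 lborel (\<lambda>x. of_real (x \<bullet> e) * T x) * norm2 lborel (\<lambda>x. T x - H x)"
      by (intro add_mono Cauchy_Schwarz_norm2 XH XT D)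
    also have "\<dots> \<le> ?X * (s * S) + (?X + s * ?L) * (s * S)"
      using s by (intro add_mono mult_mono mult_left_mono XT_le D_le) auto
    finally have "s * ?L\<^sup>2 \<le> s * (S * (2 * ?X + s * ?L))"
      by (simp add: algebra_simps)
    then show ?thesis using s by (simp only: mult_le_cancel_left_pos)
  qed
  have "((\<lambda>s. S * (2 * ?X + s * ?L)) \<longlongrightarrow> S * (2 * ?X + 0 * ?L)) (at_right 0)"
    by (intro tendsto_intros)
  then have "?L\<^sup>2 \<le> S * (2 * ?X + 0 * ?L)"
  proof (rule tendsto_lowerbound)
    show "\<forall>\<^sub>F s in at_right 0. ?L\<^sup>2 \<le> S * (2 * ?X + s * ?L)"
      using step by (auto simp: eventually_at_right_less intro!: eventually_mono[OF eventually_at_right_less[of 0]])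
  qed simp
  then show ?thesis by (simp add: mult_ac)
qed

lemma norm_cis_minus_1_le: "cmod (cis t - 1) \<le> \<bar>t\<bar>"
  using iexp_approx1[of t 0] by (simp add: cis_conv_exp)

lemma weighted_coeff_shift:
  fixes g \<phi> :: "real ^ 'n \<Rightarrow> complex"
  assumes g: "sq_int lborel g" and \<phi>: "sq_int lborel \<phi>"
  shows "weighted_coeff \<phi> g (a, b + h) - weighted_coeff \<phi> g (a, b) = weighted_coeff \<phi> (\<lambda>t. g (t + h) - g t) (a, b)"
proof (cases "a \<in> nonzero_vecs")
  case False
  then have "prod_abs a = 0" by (simp add: nonzero_vecs_def)
  then show ?thesis by (simp add: weighted_coeff_def)
next
  case a: True
  have [measurable]: "g \<in> borel_measurable borel" "\<phi> \<in> borel_measurable borel"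
    using sq_int_measurable[OF g] sq_int_measurable[OF \<phi>] by auto
  have \<phi>b: "sq_int lborel (\<lambda>t. \<phi> (vec_div (t - b) a))"
    using sq_int_shift(1)[OF sq_int_diag(1)[OF vec_inverse_nonzero[OF a] \<phi>], of "- b"] by (simp add: vec_div_vec_inverse)
  have i: "integrable lborel (\<lambda>t. g (t + h) * cnj (\<phi> (vec_div (t - b) a)))"
    "integrable lborel (\<lambda>t. g t * cnj (\<phi> (vec_div (t - b) a)))"
    by (intro sq_int_mult_integrable sq_int_cnj \<phi>b g sq_int_shift)+
  have "(LINT t|lborel. g t * cnj (\<phi> (vec_div (t - (b + h)) a)))
      = (LINT t|lborel. g (t + h) * cnj (\<phi> (vec_div (t + h - (b + h)) a)))"
    by (rule integral_lborel_shift[symmetric]) measurable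
  then have "wavelet_coeff \<phi> g a (b + h) - wavelet_coeff \<phi> g a b
      = of_real (1 / sqrt (prod_abs a)) * ((LINT t|lborel. g (t + h) * cnj (\<phi> (vec_div (t - b) a)))
          - (LINT t|lborel. g t * cnj (\<phi> (vec_div (t - b) a))))"
    unfolding wavelet_coeff_def by (simp add: right_diff_distrib)
  also have "\<dots> = wavelet_coeff \<phi> (\<lambda>t. g (t + h) - g t) a b"
    unfolding wavelet_coeff_def using i by (simp add: left_diff_distrib)
  finally show ?thesis
    by (simp add: weighted_coeff_def diff_divide_distrib[symmetric])
qed

text \<open>
  By \<open>weighted_coeff_shift\<close> and \<open>weighted_coeff_isometry\<close> the difference has the norm of a difference of \<open>g\<close>, up to the
  factor \<open>\<surd>K\<close>. On the Fourier side that is \<open>(cis (s \<eta>\<^sub>k) - 1) \<gamma>(\<eta>)\<close>, and \<open>\<bar>cis t - 1\<bar> \<le> \<bar>t\<bar>\<close>.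
\<close>

lemma weighted_coeff_difference_le:
  fixes g \<phi> :: "real ^ 'n \<Rightarrow> complex" and k :: 'n
  assumes g: "fourier_L2 g \<gamma>" and \<phi>: "fourier_L2 \<phi> \<omega>" and K: "0 \<le> K"
    "(\<integral>\<^sup>+u. ennreal ((cmod (\<omega> u))\<^sup>2 / prod_abs u) \<partial>lborel) = ennreal K"
    and Y: "sq_int lborel (\<lambda>\<eta>. of_real (\<eta> $ k) * \<gamma> \<eta>)" and s: "s > 0"
  shows "norm2 lborel (\<lambda>x. weighted_coeff \<phi> g (x + s *\<^sub>R (0, axis k 1)) - weighted_coeff \<phi> g x)
    \<le> s * (sqrt (K / (2 * pi) ^ CARD('n)) * norm2 lborel (\<lambda>\<eta>. of_real (\<eta> $ k) * \<gamma> \<eta>))"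
proof -
  let ?Y = "norm2 lborel (\<lambda>\<eta>. of_real (\<eta> $ k) * \<gamma> \<eta>)"
  define h where "h = s *\<^sub>R axis k (1::real)"
  have h: "h \<bullet> \<eta> = s * \<eta> $ k" for \<eta>
    by (simp add: h_def inner_axis' )
  define g' where "g' t = g (t + h) - g t" for t
  define \<gamma>' where "\<gamma>' \<eta> = (cis (h \<bullet> \<eta>) - 1) * \<gamma> \<eta>" for \<eta>
  have g': "fourier_L2 g' \<gamma>'"
    using fourier_L2_add_cmult[OF fourier_L2_shift[OF g, of h] g, of "-1"]
    by (simp add: g'_def[abs_def] \<gamma>'_def[abs_def] left_diff_distrib)
  have "(\<lambda>x. weighted_coeff \<phi> g (x + s *\<^sub>R (0, axis k 1)) - weighted_coeff \<phi> g x) = weighted_coeff \<phi> g'"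
  proof
    fix x :: "(real ^ 'n) \<times> (real ^ 'n)"
    show "weighted_coeff \<phi> g (x + s *\<^sub>R (0, axis k 1)) - weighted_coeff \<phi> g x = weighted_coeff \<phi> g' x"
      using weighted_coeff_shift[OF fourier_L2_sq_int(1)[OF g] fourier_L2_sq_int(1)[OF \<phi>], of "fst x" "snd x" h]
      by (cases x) (simp add: g'_def[abs_def] h_def)
  qed
  moreover have "norm2 lborel (weighted_coeff \<phi> g') \<le> s * (sqrt (K / (2 * pi) ^ CARD('n)) * ?Y)"
  proof (rule power2_le_imp_le)
    have "norm2 lborel \<gamma>' \<le> norm2 lborel (\<lambda>\<eta>. of_real s * (of_real (\<eta> $ k) * \<gamma> \<eta>))"
    proof (rule norm2_mono[OF fourier_L2_sq_int(2)[OF g'] sq_int_cmult[OF Y]])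
      fix \<eta>
      have "cmod (\<gamma>' \<eta>) \<le> \<bar>s * \<eta> $ k\<bar> * cmod (\<gamma> \<eta>)"
        unfolding \<gamma>'_def norm_mult h by (intro mult_right_mono norm_cis_minus_1_le) auto
      then show "cmod (\<gamma>' \<eta>) \<le> cmod (of_real s * (of_real (\<eta> $ k) * \<gamma> \<eta>))"
        by (simp add: norm_mult abs_mult)
    qed
    also have "\<dots> = s * ?Y" using s by (simp add: norm2_cmult)
    finally have "(norm2 lborel \<gamma>')\<^sup>2 \<le> (s * ?Y)\<^sup>2" by (intro power_mono) auto
    then have "(norm2 lborel g')\<^sup>2 \<le> (s * ?Y)\<^sup>2 / (2 * pi) ^ CARD('n)"
      unfolding fourier_L2_isometry[OF g'] by (simp add: pos_le_divide_eq mult.commute)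
    then have "K * (norm2 lborel g')\<^sup>2 \<le> K * ((s * ?Y)\<^sup>2 / (2 * pi) ^ CARD('n))"
      by (rule mult_left_mono[OF _ K(1)])
    also have "\<dots> = (s * (sqrt (K / (2 * pi) ^ CARD('n)) * ?Y))\<^sup>2"
      using K(1) by (simp add: power_mult_distrib)
    finally show "(norm2 lborel (weighted_coeff \<phi> g'))\<^sup>2 \<le> (s * (sqrt (K / (2 * pi) ^ CARD('n)) * ?Y))\<^sup>2"
      unfolding weighted_coeff_isometry(2)[OF g' \<phi> K] .
  qed (use s K in simp)
  ultimately show ?thesis by simp
qed

lemma coordinate_moments:
  fixes F :: "'b \<Rightarrow> complex" and y :: "'b \<Rightarrow> real ^ 'n"
  assumes [measurable]: "F \<in> borel_measurable M" "y \<in> borel_measurable M"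
    and fin: "(\<integral>\<^sup>+x. ennreal ((norm (y x))\<^sup>2 * (cmod (F x))\<^sup>2) \<partial>M) < \<infinity>"
  shows "\<And>k. sq_int M (\<lambda>x. of_real (y x $ k) * F x)"
    and "(\<integral>\<^sup>+x. ennreal ((norm (y x))\<^sup>2 * (cmod (F x))\<^sup>2) \<partial>M)
      = ennreal (\<Sum>k\<in>UNIV. (norm2 M (\<lambda>x. of_real (y x $ k) * F x))\<^sup>2)"
proof -
  let ?m = "\<lambda>k. \<integral>\<^sup>+x. ennreal ((cmod (of_real (y x $ k) * F x))\<^sup>2) \<partial>M"
  have n: "(norm v)\<^sup>2 = (\<Sum>k\<in>UNIV. (v $ k)\<^sup>2)" for v :: "real ^ 'n"
    unfolding power2_norm_eq_inner inner_vec_def by (simp add: power2_eq_square)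
  have "ennreal ((norm (y x))\<^sup>2 * (cmod (F x))\<^sup>2) = (\<Sum>k\<in>UNIV. ennreal ((cmod (of_real (y x $ k) * F x))\<^sup>2))" for x
    by (subst sum_ennreal) (auto simp: n sum_distrib_right norm_mult power_mult_distrib)
  then have eq: "(\<integral>\<^sup>+x. ennreal ((norm (y x))\<^sup>2 * (cmod (F x))\<^sup>2) \<partial>M)
      = (\<Sum>k\<in>UNIV. ?m k)"
    by (simp only:) (rule nn_integral_sum, measurable)
  show s: "sq_int M (\<lambda>x. of_real (y x $ k) * F x)" for k
  proof (rule sq_intI_nn_integral)
    have "?m k
      \<le> (\<Sum>k\<in>UNIV. ?m k)"
      by (rule member_le_sum) auto
    also have "\<dots> < \<infinity>" using fin unfolding eq .
    finally show "?m k < \<infinity>" .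
  qed measurable
  show "(\<integral>\<^sup>+x. ennreal ((norm (y x))\<^sup>2 * (cmod (F x))\<^sup>2) \<partial>M)
      = ennreal (\<Sum>k\<in>UNIV. (norm2 M (\<lambda>x. of_real (y x $ k) * F x))\<^sup>2)"
    unfolding eq sq_int_nn_integral[OF s] by (simp add: sum_ennreal)
qed

text \<open>
  Excludes a product \<open>0 \<cdot> \<infinity>\<close> of second moments: both moments are positive unless the function
  vanishes.
\<close>

lemma second_moment_eq_0:
  fixes F :: "'a::euclidean_space \<Rightarrow> complex"
  assumes F: "sq_int lborel F" and [measurable]: "y \<in> borel_measurable borel"
    and "(\<integral>\<^sup>+x. ennreal ((norm (y x :: real ^ 'n))\<^sup>2 * (cmod (F x))\<^sup>2) \<partial>lborel) = 0"
    and "AE x in lborel. y x \<noteq> 0"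
  shows "norm2 lborel F = 0"
proof -
  have [measurable]: "F \<in> borel_measurable borel" using sq_int_measurable[OF F] by simp
  have "AE x in lborel. ennreal ((norm (y x))\<^sup>2 * (cmod (F x))\<^sup>2) = 0"
    using assms(3) by (subst (asm) nn_integral_0_iff_AE) auto
  then have "AE x in lborel. F x = 0"
    using assms(4)
  proof eventually_elim
    case (elim x)
    then have "(norm (y x))\<^sup>2 * (cmod (F x))\<^sup>2 \<le> 0" by (simp only: ennreal_eq_0_iff)
    then show ?case using elim(2) by (simp add: mult_le_0_iff power_le_zero_eq)
  qed
  then have "norm2 lborel F = norm2 lborel (\<lambda>_::'a. 0)" by (intro norm2_cong_AE) auto
  then show ?thesis by (simp add: norm2_def)
qed

text \<open>
  If a second moment is infinite, so is the product, since neither factor is zero. Otherwise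
  \<open>Heisenberg_finite_differences\<close> applies to each of the \<open>N\<close> coordinate directions of the \<open>b\<close>-space,
  and the Cauchy-Schwarz inequality adds up the coordinates.
\<close>

theorem wavelet_uncertainty:
  fixes g \<phi> :: "real ^ 'n \<Rightarrow> complex"
  assumes g: "fourier_L2 g \<gamma>" and \<phi>: "fourier_L2 \<phi> \<omega>" and K: "0 \<le> K"
    "(\<integral>\<^sup>+u. ennreal ((cmod (\<omega> u))\<^sup>2 / prod_abs u) \<partial>lborel) = ennreal K"
  shows "ennreal (K * (real CARD('n))\<^sup>2 / 4 * (norm2 lborel g) ^ 4)
    \<le> (\<integral>\<^sup>+x. ennreal ((norm (snd x))\<^sup>2 * (cmod (weighted_coeff \<phi> g x))\<^sup>2) \<partial>lborel)
      * (ennreal (1 / (2 * pi) ^ CARD('n)) * (\<integral>\<^sup>+\<eta>. ennreal ((norm \<eta>)\<^sup>2 * (cmod (\<gamma> \<eta>))\<^sup>2) \<partial>lborel))"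
    (is "?lhs \<le> ?A * (ennreal ?c * ?B)")
proof (cases "K = 0 \<or> norm2 lborel g = 0")
  case True
  then have "K * (real CARD('n))\<^sup>2 / 4 * (norm2 lborel g) ^ 4 = 0" by auto
  then show ?thesis by (simp only: ennreal_0 zero_le)
next
  case False
  let ?H = "weighted_coeff \<phi> g" and ?G = "norm2 lborel g"
  note H = weighted_coeff_isometry[OF g \<phi> K]
  note [measurable] = fourier_L2_measurable[OF g] fourier_L2_measurable[OF \<phi>]
  have Hm[measurable]: "?H \<in> borel_measurable borel" by measurable
  have sndm[measurable]: "(snd :: (real ^ 'n) \<times> (real ^ 'n) \<Rightarrow> _) \<in> borel_measurable borel"
    unfolding borel_prod[symmetric] by measurable
  have Kpos: "K > 0" and Gpos: "?G \<noteq> 0" using False K(1) by auto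
  have in_Basis: "(0, axis k 1) \<in> (Basis :: ((real ^ 'n) \<times> (real ^ 'n)) set)" for k
    by (simp add: Basis_prod_def Basis_vec_range)
  have ek: "x \<bullet> (0, axis k 1) = snd x $ k" for x :: "(real ^ 'n) \<times> (real ^ 'n)" and k
    by (cases x) (simp add: inner_axis)
  have A0: "?A \<noteq> 0"
  proof
    assume "?A = 0"
    moreover have "AE x in (lborel :: ((real ^ 'n) \<times> (real ^ 'n)) measure). snd x \<noteq> 0"
      using AE_inner_Basis_nonzero[OF in_Basis[of undefined]] unfolding ek by (rule eventually_mono) auto
    ultimately have "norm2 lborel ?H = 0" by (intro second_moment_eq_0[OF H(1) sndm])
    then show False using H(2) Kpos Gpos by auto
  qed
  have B0: "?B \<noteq> 0"
  proof
    assume B: "?B = 0"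
    have "axis undefined 1 \<in> (Basis :: (real ^ 'n) set)" by (auto simp: Basis_vec_range)
    from AE_inner_Basis_nonzero[OF this] have "AE x in lborel. x \<noteq> (0 :: real ^ 'n)"
      by eventually_elim auto
    with B have "norm2 lborel \<gamma> = 0" by (intro second_moment_eq_0[OF fourier_L2_sq_int(2)[OF g], of "\<lambda>x. x"]) auto
    then show False using fourier_L2_isometry[OF g] Gpos by auto
  qed
  have cpos: "?c > 0" by simp
  show ?thesis
  proof (cases "?A < \<infinity> \<and> ?B < \<infinity>")
    case False
    then have "?A * (ennreal ?c * ?B) = \<infinity>"
      using A0 B0 cpos by (auto simp: ennreal_mult_eq_top_iff less_top[symmetric])
    then show ?thesis by simp
  next
    case True
    have finA: "?A < \<infinity>" and finB: "?B < \<infinity>" using True by auto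
    define X where "X k = norm2 lborel (\<lambda>x. of_real (snd x $ k) * ?H x)" for k
    define Y where "Y k = norm2 lborel (\<lambda>\<eta>. of_real (\<eta> $ k) * \<gamma> \<eta>)" for k
    have mA: "?H \<in> borel_measurable lborel" "snd \<in> borel_measurable (lborel :: ((real ^ 'n) \<times> (real ^ 'n)) measure)"
      using Hm sndm by simp_all
    have mB: "\<gamma> \<in> borel_measurable lborel" "(\<lambda>x. x) \<in> borel_measurable (lborel :: (real ^ 'n) measure)"
      by simp_all
    note XA = coordinate_moments[OF mA finA] and YB = coordinate_moments[OF mB finB]
    have A: "?A = ennreal (\<Sum>k\<in>UNIV. (X k)\<^sup>2)" unfolding X_def by (rule XA(2))
    have B: "?B = ennreal (\<Sum>k\<in>UNIV. (Y k)\<^sup>2)" unfolding Y_def by (rule YB(2))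
    \<comment> \<open>The one-dimensional inequalities; the constant comes from the bound on differences.\<close>
    let ?d = "sqrt (K * ?c)"
    have "K * ?G\<^sup>2 \<le> 2 * ?d * (X k * Y k)" for k
    proof -
      have "(norm2 lborel ?H)\<^sup>2 \<le> 2 * (norm2 lborel (\<lambda>x. of_real (x \<bullet> (0, axis k 1)) * ?H x) * (?d * Y k))"
      proof (rule Heisenberg_finite_differences[OF H(1)])
        show "sq_int lborel (\<lambda>x. of_real (x \<bullet> (0, axis k 1)) * ?H x)"
          unfolding ek by (rule XA(1))
        show "((0, axis k 1) :: (real ^ 'n) \<times> (real ^ 'n)) \<bullet> (0, axis k 1) = 1" by (simp add: inner_axis_axis)
        show "norm2 lborel (\<lambda>x. ?H (x + s *\<^sub>R (0, axis k 1)) - ?H x) \<le> s * (?d * Y k)" if "s > 0" for s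
          using weighted_coeff_difference_le[OF g \<phi> K YB(1) that, of k] by (simp add: Y_def)
      qed
      then show ?thesis unfolding ek X_def[symmetric] H(2) by (simp only: mult_ac)
    qed
    then have "(\<Sum>k\<in>(UNIV::'n set). K * ?G\<^sup>2) \<le> (\<Sum>k\<in>UNIV. 2 * ?d * (X k * Y k))"
      by (rule sum_mono)
    then have "real CARD('n) * (K * ?G\<^sup>2) \<le> 2 * ?d * (\<Sum>k\<in>UNIV. X k * Y k)"
      by (simp add: sum_distrib_left)
    then have "(real CARD('n) * (K * ?G\<^sup>2))\<^sup>2 \<le> (2 * ?d * (\<Sum>k\<in>UNIV. X k * Y k))\<^sup>2"
      using K(1) by (intro power_mono) auto
    also have "\<dots> = 4 * (K * ?c) * (\<Sum>k\<in>UNIV. X k * Y k)\<^sup>2"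
      using K(1) by (simp add: power_mult_distrib)
    also have "\<dots> \<le> 4 * (K * ?c) * ((\<Sum>k\<in>UNIV. (X k)\<^sup>2) * (\<Sum>k\<in>UNIV. (Y k)\<^sup>2))"
      using K(1) by (intro mult_left_mono Cauchy_Schwarz_ineq_sum) auto
    finally have "4 * K * (K * (real CARD('n))\<^sup>2 / 4 * ?G ^ 4) \<le> 4 * K * ((\<Sum>k\<in>UNIV. (X k)\<^sup>2) * (?c * (\<Sum>k\<in>UNIV. (Y k)\<^sup>2)))"
      by (simp add: power2_eq_square power4_eq_xxxx mult_ac)
    then have "K * (real CARD('n))\<^sup>2 / 4 * ?G ^ 4 \<le> (\<Sum>k\<in>UNIV. (X k)\<^sup>2) * (?c * (\<Sum>k\<in>UNIV. (Y k)\<^sup>2))"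
      using Kpos by (subst (asm) mult_le_cancel_left_pos) auto
    then have "?lhs \<le> ennreal ((\<Sum>k\<in>UNIV. (X k)\<^sup>2) * (?c * (\<Sum>k\<in>UNIV. (Y k)\<^sup>2)))"
      by (rule ennreal_leI)
    also have "\<dots> = ?A * (ennreal ?c * ?B)"
    proof -
      have n: "0 \<le> (\<Sum>k\<in>UNIV. (X k)\<^sup>2)" "0 \<le> (\<Sum>k\<in>UNIV. (Y k)\<^sup>2)" "0 \<le> ?c"
        by (simp_all add: sum_nonneg)
      show ?thesis
        unfolding A B ennreal_mult[OF n(1) mult_nonneg_nonneg[OF n(3,2)]] ennreal_mult[OF n(3,2)] ..
    qed
    finally show ?thesis .
  qed
qed

section \<open>Borel representatives of Lebesgue measurable functions\<close>

text \<open>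
  Fubini's theorem and compositions are convenient for Borel functions on \<open>lborel\<close>; the lemmas of this
  section exchange a Lebesgue measurable function for a Borel function of the same class.
\<close>

lemma Borel_representative:
  fixes f :: "'a::euclidean_space \<Rightarrow> complex"
  assumes f: "f \<in> borel_measurable lebesgue"
  obtains f' where "f' \<in> borel_measurable borel" "AE x in lborel. f x = f' x"
proof -
  have "(\<lambda>x. Re (f x)) \<in> borel_measurable lebesgue" "(\<lambda>x. Im (f x)) \<in> borel_measurable lebesgue"
    using f by measurable
  from this[THEN completion_ex_borel_measurable_real] obtain p q
    where pq: "p \<in> borel_measurable lborel" "q \<in> borel_measurable lborel"
      "AE x in lborel. Re (f x) = p x" "AE x in lborel. Im (f x) = q x"
    by blast
  show thesis
  proof
    show "(\<lambda>x. Complex (p x) (q x)) \<in> borel_measurable borel"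
      using pq(1,2) unfolding Complex_eq by simp
    show "AE x in lborel. f x = Complex (p x) (q x)"
      using pq(3,4) by eventually_elim (simp add: complex_eq_iff)
  qed
qed

lemma square_integrable_representative:
  fixes f :: "real ^ 'n \<Rightarrow> complex"
  assumes f: "square_integrable f" and f': "f' \<in> borel_measurable borel" "AE x in lborel. f x = f' x"
  shows "sq_int lborel f'" "norm2 lborel f' = L2_norm f"
proof -
  have m: "(\<lambda>x. (cmod (f' x))\<^sup>2) \<in> borel_measurable lborel" using f'(1) by simp
  have fm: "(\<lambda>x. (cmod (f x))\<^sup>2) \<in> borel_measurable lebesgue"
    using f by (auto simp: square_integrable_def)
  have AE: "AE x in lebesgue. (cmod (f x))\<^sup>2 = (cmod (f' x))\<^sup>2"
    using AE_completion[OF f'(2)] by eventually_elim simp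
  have "integrable lebesgue (\<lambda>x. (cmod (f' x))\<^sup>2)"
    using f integrable_cong_AE[OF fm measurable_completion[OF m] AE] by (simp add: square_integrable_def)
  then show "sq_int lborel f'"
    using f'(1) m by (simp add: sq_int_def integrable_completion)
  have "(LINT x|lebesgue. (cmod (f x))\<^sup>2) = (LINT x|lebesgue. (cmod (f' x))\<^sup>2)"
    by (rule integral_cong_AE[OF fm measurable_completion[OF m] AE])
  also have "\<dots> = (LINT x|lborel. (cmod (f' x))\<^sup>2)" by (rule integral_completion[OF m])
  finally show "norm2 lborel f' = L2_norm f" by (simp add: norm2_def L2_norm_def)
qed

lemma sq_int_imp_square_integrable:
  assumes "sq_int lborel f" shows "square_integrable f"
proof -
  have m: "f \<in> borel_measurable lborel" using assms by (rule sq_int_measurable)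
  have "(\<lambda>x. (cmod (f x))\<^sup>2) \<in> borel_measurable lborel" using m by measurable
  then show ?thesis
    using assms measurable_completion[OF m] by (simp add: square_integrable_def sq_int_def integrable_completion)
qed

lemma L2_tendsto_iff:
  fixes f f' :: "real ^ 'n \<Rightarrow> complex"
  assumes h: "\<And>n. sq_int lborel (h' n)" "\<And>n. AE x in lborel. h n x = h' n x"
    and f: "sq_int lborel f'" "AE x in lborel. f x = f' x"
  shows "L2_tendsto h f \<longleftrightarrow> (\<lambda>n. norm2 lborel (\<lambda>x. h' n x - f' x)) \<longlonglongrightarrow> 0"
proof -
  let ?d = "\<lambda>n. norm2 lborel (\<lambda>x. h' n x - f' x)"
  have "(\<integral>\<^sup>+x. ennreal ((cmod (h n x - f x))\<^sup>2) \<partial>lebesgue) = ennreal ((?d n)\<^sup>2)" for n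
  proof -
    have "(\<integral>\<^sup>+x. ennreal ((cmod (h n x - f x))\<^sup>2) \<partial>lebesgue) = (\<integral>\<^sup>+x. ennreal ((cmod (h' n x - f' x))\<^sup>2) \<partial>lborel)"
      unfolding nn_integral_completion
    proof (rule nn_integral_cong_AE)
      show "AE x in lborel. ennreal ((cmod (h n x - f x))\<^sup>2) = ennreal ((cmod (h' n x - f' x))\<^sup>2)"
        using h(2)[of n] f(2) by eventually_elim simp
    qed
    then show ?thesis by (simp only: sq_int_nn_integral[OF sq_int_diff[OF h(1) f(1)]])
  qed
  then have "L2_tendsto h f \<longleftrightarrow> (\<lambda>n. ennreal ((?d n)\<^sup>2)) \<longlonglongrightarrow> ennreal 0"
    by (simp add: L2_tendsto_def)
  also have "\<dots> \<longleftrightarrow> (\<lambda>n. (?d n)\<^sup>2) \<longlonglongrightarrow> 0"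
    by (rule tendsto_ennreal_iff) auto
  also have "\<dots> \<longleftrightarrow> (\<lambda>n. ?d n) \<longlonglongrightarrow> 0"
  proof
    assume "(\<lambda>n. (?d n)\<^sup>2) \<longlonglongrightarrow> 0"
    from tendsto_real_sqrt[OF this] show "(\<lambda>n. ?d n) \<longlonglongrightarrow> 0" by simp
  next
    assume "(\<lambda>n. ?d n) \<longlonglongrightarrow> 0"
    from tendsto_power[OF this, of 2] show "(\<lambda>n. (?d n)\<^sup>2) \<longlonglongrightarrow> 0" by simp
  qed
  finally show ?thesis .
qed

section \<open>Reduction of the fractional to the ordinary Fourier transform\<close>

lemma chirp_eq_cis: "chirp \<alpha> s x = cis (s * (\<Sum>k\<in>UNIV. a_coeff (\<alpha> $ k) * (x $ k)\<^sup>2))"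
  unfolding chirp_def cis_conv_exp ..

lemma chirp_measurable [measurable]: "chirp \<alpha> s \<in> borel_measurable borel"
  unfolding chirp_eq_cis[abs_def] by measurable

lemma norm_chirp [simp]: "cmod (chirp \<alpha> s x) = 1"
  by (simp add: chirp_eq_cis)

lemma cnj_chirp: "cnj (chirp \<alpha> s x) = chirp \<alpha> (- s) x"
  by (simp add: chirp_eq_cis cis_cnj)

lemma chirp_minus_mult [simp]: "chirp \<alpha> (- s) x * chirp \<alpha> s x = 1"
  by (simp add: chirp_eq_cis cis_mult)

lemma sq_int_chirp:
  assumes "sq_int lborel f"
  shows "sq_int lborel (\<lambda>x. f x * chirp \<alpha> s x)" "norm2 lborel (\<lambda>x. f x * chirp \<alpha> s x) = norm2 lborel f"
proof -
  show "sq_int lborel (\<lambda>x. f x * chirp \<alpha> s x)"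
    using sq_int_measurable[OF assms] by (intro sq_int_bound[OF assms, where C = 1]) (auto simp: norm_mult)
  show "norm2 lborel (\<lambda>x. f x * chirp \<alpha> s x) = norm2 lborel f"
    by (simp add: norm2_def norm_mult)
qed

text \<open>
  The frequency vector \<open>\<lambda>\<^sup>2 \<xi> csc \<alpha>\<close> of the kernel is \<open>freq_scale \<alpha> \<lambda> * \<xi>\<close>.
\<close>

definition freq_scale :: "real ^ 'n \<Rightarrow> real \<Rightarrow> real ^ 'n" where
  "freq_scale \<alpha> lam = (\<chi> k. lam\<^sup>2 / sin (\<alpha> $ k))"

definition mfrft_const :: "real ^ 'n \<Rightarrow> complex" where
  "mfrft_const \<alpha> = c_vec \<alpha> / of_real (sqrt (2 * pi) ^ CARD('n))"

lemma c_coeff_nonzero: "c_coeff \<theta> \<noteq> 0"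
proof
  assume "c_coeff \<theta> = 0"
  then have "1 - \<i> * of_real (cot \<theta>) = 0" by (simp add: c_coeff_def)
  then have "Re (1 - \<i> * of_real (cot \<theta>)) = 0" by simp
  then show False by simp
qed

lemma mfrft_const_nonzero: "mfrft_const \<alpha> \<noteq> 0"
  by (simp add: mfrft_const_def c_vec_def c_coeff_nonzero)

lemma norm_c_coeff:
  assumes "sin \<theta> \<noteq> 0" shows "(cmod (c_coeff \<theta>))\<^sup>2 = 1 / \<bar>sin \<theta>\<bar>"
proof -
  have "(cmod (c_coeff \<theta>))\<^sup>2 = cmod (1 - \<i> * of_real (cot \<theta>))"
    unfolding c_coeff_def norm_power[symmetric] by simp
  also have "\<dots> = sqrt (1 + (cot \<theta>)\<^sup>2)" by (simp add: cmod_def)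
  also have "1 + (cot \<theta>)\<^sup>2 = ((sin \<theta>)\<^sup>2 + (cos \<theta>)\<^sup>2) / (sin \<theta>)\<^sup>2"
    unfolding cot_def power_divide add_divide_distrib using assms by simp
  also have "\<dots> = (1 / \<bar>sin \<theta>\<bar>)\<^sup>2"
    unfolding sin_cos_squared_add by (simp add: power_divide)
  finally show ?thesis by simp
qed

text \<open>
  The identity that removes \<open>c(\<alpha>)\<close> and \<open>\<bar>sin \<alpha>\<bar>\<^sub>m\<close> from the constant \<open>P_const\<close>.
\<close>

lemma norm_c_vec:
  assumes "\<And>k. sin (\<alpha> $ k) \<noteq> 0"
  shows "(cmod (c_vec \<alpha>))\<^sup>2 * prod_abs (sin_vec \<alpha>) = 1"
proof -
  have "(cmod (c_vec \<alpha>))\<^sup>2 * prod_abs (sin_vec \<alpha>) = (\<Prod>k\<in>UNIV. (cmod (c_coeff (\<alpha> $ k)))\<^sup>2 * \<bar>sin (\<alpha> $ k)\<bar>)"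
    by (simp add: c_vec_def prod_abs_def sin_vec_def abs_prod prod.distrib prod_norm[symmetric] prod_power_distrib)
  also have "\<dots> = 1" using assms by (simp add: norm_c_coeff)
  finally show ?thesis .
qed

lemma norm_mfrft_const: "(cmod (mfrft_const \<alpha>))\<^sup>2 = (cmod (c_vec \<alpha>))\<^sup>2 / (2 * pi) ^ CARD('n)"
  for \<alpha> :: "real ^ 'n"
proof -
  have "(sqrt (2 * pi) ^ CARD('n))\<^sup>2 = (2 * pi) ^ CARD('n)"
    by (simp only: power_mult[symmetric] mult.commute[of _ 2]) (simp add: power_mult)
  then show ?thesis
    unfolding mfrft_const_def norm_divide norm_of_real power_divide power2_abs by simp
qed

lemma mfrft_L1_eq_fourier:
  fixes h :: "real ^ 'n \<Rightarrow> complex"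
  assumes h': "h' \<in> borel_measurable borel" "AE x in lborel. h x = h' x" and h: "h \<in> borel_measurable lebesgue"
  shows "mfrft_L1 \<alpha> lam h \<xi> = mfrft_const \<alpha> * chirp \<alpha> (lam\<^sup>2) \<xi> * fourier (\<lambda>x. h' x * chirp \<alpha> (lam\<^sup>2) x) (freq_scale \<alpha> lam * \<xi>)"
proof -
  note [measurable] = h'(1)
  have e: "exp (- \<i> * of_real (lam\<^sup>2 * (\<Sum>k\<in>UNIV. x $ k * \<xi> $ k * (1 / sin (\<alpha> $ k))))) = cis (- (x \<bullet> (freq_scale \<alpha> lam * \<xi>)))" for x
  proof -
    have "lam\<^sup>2 * (\<Sum>k\<in>UNIV. x $ k * \<xi> $ k * (1 / sin (\<alpha> $ k))) = x \<bullet> (freq_scale \<alpha> lam * \<xi>)"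
      by (simp add: inner_vec_def freq_scale_def sum_distrib_left mult_ac)
    then show ?thesis by (simp add: cis_conv_exp)
  qed
  have k: "mfrft_kernel \<alpha> lam x \<xi> = mfrft_const \<alpha> * chirp \<alpha> (lam\<^sup>2) \<xi> * (chirp \<alpha> (lam\<^sup>2) x * cis (- (x \<bullet> (freq_scale \<alpha> lam * \<xi>))))" for x
    unfolding mfrft_kernel_def e mfrft_const_def by (simp add: mult_ac)
  have km: "(\<lambda>x. mfrft_kernel \<alpha> lam x \<xi>) \<in> borel_measurable lborel"
    unfolding k by measurable
  have m: "(\<lambda>x. h' x * mfrft_kernel \<alpha> lam x \<xi>) \<in> borel_measurable lborel" using km by measurable
  have "mfrft_L1 \<alpha> lam h \<xi> = (LINT x|lebesgue. h' x * mfrft_kernel \<alpha> lam x \<xi>)"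
    unfolding mfrft_L1_def
  proof (rule integral_cong_AE)
    show "(\<lambda>x. h x * mfrft_kernel \<alpha> lam x \<xi>) \<in> borel_measurable lebesgue"
      using h measurable_completion[OF km] by measurable
    show "AE x in lebesgue. h x * mfrft_kernel \<alpha> lam x \<xi> = h' x * mfrft_kernel \<alpha> lam x \<xi>"
      using AE_completion[OF h'(2)] by eventually_elim simp
  qed (rule measurable_completion[OF m])
  also have "\<dots> = (LINT x|lborel. h' x * mfrft_kernel \<alpha> lam x \<xi>)" by (rule integral_completion[OF m])
  also have "\<dots> = (LINT x|lborel. mfrft_const \<alpha> * chirp \<alpha> (lam\<^sup>2) \<xi> * (h' x * chirp \<alpha> (lam\<^sup>2) x * cis (- (x \<bullet> (freq_scale \<alpha> lam * \<xi>)))))"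
    unfolding k by (simp only: mult_ac)
  finally show ?thesis unfolding fourier_def by (simp only: integral_mult_right_zero)
qed

lemma freq_scale_nonzero:
  assumes "lam \<noteq> 0" "\<And>k. sin (\<alpha> $ k) \<noteq> 0"
  shows "freq_scale \<alpha> lam \<in> nonzero_vecs"
  using assms by (simp add: nonzero_vecs_iff freq_scale_def)

text \<open>
  Transport a limit of ordinary transforms through \<open>mfrft_L1_eq_fourier\<close>. Existence makes the choice in the
  definition of \<open>mfrft\<close> a genuine one.
\<close>

lemma is_mfrft_exists:
  fixes f :: "real ^ 'n \<Rightarrow> complex"
  assumes D: "freq_scale \<alpha> lam \<in> nonzero_vecs" and f: "square_integrable f"
  shows "\<exists>g. is_mfrft \<alpha> lam f g"
proof -
  obtain f' where f': "f' \<in> borel_measurable borel" "AE x in lborel. f x = f' x"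
    using f Borel_representative[of f] by (auto simp: square_integrable_def)
  have f2: "sq_int lborel f'" by (rule square_integrable_representative[OF f f'])
  let ?c = "chirp \<alpha> (lam\<^sup>2)" and ?D = "freq_scale \<alpha> lam" and ?k = "mfrft_const \<alpha>"
  obtain \<gamma> where \<gamma>: "fourier_L2 (\<lambda>x. f' x * ?c x) \<gamma>" using fourier_L2_exists[OF sq_int_chirp(1)[OF f2]] by blast
  obtain u where u: "fourier_L2_approx u (\<lambda>x. f' x * ?c x) \<gamma>" using \<gamma> unfolding fourier_L2_def by blast
  note G = fourier_L2_sq_int(2)[OF \<gamma>]
  note lim = fourier_L2_approxD(3,4)[OF u] and u = fourier_L2_approxD(1,2)[OF u]
  define h where "h n x = u n x * chirp \<alpha> (- lam\<^sup>2) x" for n x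
  have hc: "h n x * ?c x = u n x" for n x by (simp add: h_def mult.assoc)
  have h2: "sq_int lborel (h n)" for n unfolding h_def[abs_def] by (rule sq_int_chirp(1)[OF u(2)])
  have h1: "integrable lborel (h n)" for n
    unfolding h_def[abs_def] by (rule integrable_mult_bounded[OF u(1), where C = 1]) auto
  have hm: "h n \<in> borel_measurable borel" for n using sq_int_measurable[OF h2[of n]] by simp
  define g where "g \<xi> = ?k * ?c \<xi> * \<gamma> (?D * \<xi>)" for \<xi>
  have m: "mfrft_L1 \<alpha> lam (h n) \<xi> = ?k * ?c \<xi> * fourier (u n) (?D * \<xi>)" for n \<xi>
  proof -
    have "h n \<in> borel_measurable lborel" using hm by simp
    from mfrft_L1_eq_fourier[OF hm AE_I2[OF refl] measurable_completion[OF this]] show ?thesis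
      by (simp only: hc)
  qed
  have scaled: "sq_int lborel (\<lambda>\<xi>. ?k * ?c \<xi> * v (?D * \<xi>))" if "sq_int lborel v" for v
    using sq_int_chirp(1)[OF sq_int_cmult[OF sq_int_diag(1)[OF D that], of ?k], of \<alpha> "lam\<^sup>2"]
    by (simp add: mult_ac)
  have g2: "sq_int lborel g" unfolding g_def[abs_def] by (rule scaled[OF G])
  have m2: "sq_int lborel (mfrft_L1 \<alpha> lam (h n))" for n
    unfolding m[abs_def] by (rule scaled) (rule Plancherel_L1_L2[OF u])
  have "L2_tendsto h f"
  proof (subst L2_tendsto_iff[OF h2 _ f2 f'(2)])
    have "norm2 lborel (\<lambda>x. h n x - f' x) = norm2 lborel (\<lambda>x. u n x - f' x * ?c x)" for n
      using sq_int_chirp(2)[OF sq_int_diff[OF h2[of n] f2], of \<alpha> "lam\<^sup>2"]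
      by (simp only: left_diff_distrib hc)
    then show "(\<lambda>n. norm2 lborel (\<lambda>x. h n x - f' x)) \<longlonglongrightarrow> 0" using lim(1) by simp
  qed simp
  moreover have "L2_tendsto (\<lambda>n. mfrft_L1 \<alpha> lam (h n)) g"
  proof (subst L2_tendsto_iff[OF m2 _ g2])
    have "norm2 lborel (\<lambda>\<xi>. mfrft_L1 \<alpha> lam (h n) \<xi> - g \<xi>) = cmod ?k * (norm2 lborel (\<lambda>x. fourier (u n) x - \<gamma> x) / sqrt (prod_abs ?D))" for n
    proof -
      have e: "mfrft_L1 \<alpha> lam (h n) \<xi> - g \<xi> = ?k * (fourier (u n) (?D * \<xi>) - \<gamma> (?D * \<xi>)) * ?c \<xi>" for \<xi>
        unfolding m g_def by (simp add: algebra_simps)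
      note d = sq_int_diag[OF D sq_int_diff[OF Plancherel_L1_L2(1)[OF u] G], of n]
      show ?thesis unfolding e sq_int_chirp(2)[OF sq_int_cmult[OF d(1)]] norm2_cmult d(2) ..
    qed
    then show "(\<lambda>n. norm2 lborel (\<lambda>x. mfrft_L1 \<alpha> lam (h n) x - g x)) \<longlonglongrightarrow> 0"
      by (simp only:) (intro tendsto_mult_right_zero tendsto_divide_zero lim)
  qed auto
  moreover have "integrable lebesgue (h n)" for n
    using h1[of n] hm[of n] by (subst integrable_completion) auto
  ultimately have "is_mfrft \<alpha> lam f g"
    unfolding is_mfrft_def using sq_int_imp_square_integrable[OF g2] sq_int_imp_square_integrable[OF h2] by blast
  then show ?thesis by blast
qed

text \<open>
  The converse transport, for an arbitrary limit: whichever representative was chosen, its modulus is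
  almost everywhere that of an ordinary Fourier transform at the scaled frequency.
\<close>

lemma is_mfrft_imp_fourier_L2:
  fixes f :: "real ^ 'n \<Rightarrow> complex"
  assumes D: "freq_scale \<alpha> lam \<in> nonzero_vecs" and fg: "is_mfrft \<alpha> lam f g"
    and f2: "sq_int lborel f'" and f': "AE x in lborel. f x = f' x"
  obtains \<gamma> where "fourier_L2 (\<lambda>x. f' x * chirp \<alpha> (lam\<^sup>2) x) \<gamma>"
    "AE \<xi> in lborel. cmod (g \<xi>) = cmod (mfrft_const \<alpha>) * cmod (\<gamma> (freq_scale \<alpha> lam * \<xi>))"
proof -
  let ?c = "chirp \<alpha> (lam\<^sup>2)" and ?D = "freq_scale \<alpha> lam" and ?k = "mfrft_const \<alpha>"
  let ?E = "vec_inverse ?D"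
  note E = vec_inverse_nonzero[OF D]
  have DE: "?D * (?E * \<eta>) = \<eta>" for \<eta> using vec_div_times'[OF D] by (simp add: vec_div_vec_inverse)
  have ED: "?E * (?D * \<eta>) = \<eta>" for \<eta> using vec_div_times[OF D] by (simp add: vec_div_vec_inverse)
  from fg obtain h where g: "square_integrable g"
    and h: "\<And>n. integrable lebesgue (h n)" "\<And>n. square_integrable (h n)"
    and lim: "L2_tendsto h f" "L2_tendsto (\<lambda>n. mfrft_L1 \<alpha> lam (h n)) g"
    unfolding is_mfrft_def by blast
  have hl: "h n \<in> borel_measurable lebesgue" for n using h(2)[of n] by (simp add: square_integrable_def)
  obtain g' where g': "g' \<in> borel_measurable borel" "AE x in lborel. g x = g' x"
    using g Borel_representative[of g] by (auto simp: square_integrable_def)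
  have g2: "sq_int lborel g'" by (rule square_integrable_representative[OF g g'])
  have "\<forall>n. \<exists>h'. h' \<in> borel_measurable borel \<and> (AE x in lborel. h n x = h' x)"
    using Borel_representative[OF hl] by blast
  then obtain h' where h': "\<And>n. h' n \<in> borel_measurable borel" "\<And>n. AE x in lborel. h n x = h' n x"
    by metis
  have h2: "sq_int lborel (h' n)" for n by (rule square_integrable_representative[OF h(2) h'])
  have h1: "integrable lborel (h' n)" for n
  proof -
    have m: "h' n \<in> borel_measurable lborel" using h'(1)[of n] by simp
    have "integrable lebesgue (h' n)"
      using h(1)[of n] integrable_cong_AE[OF hl measurable_completion[OF m] AE_completion[OF h'(2)]] by simp
    then show ?thesis using m by (simp add: integrable_completion)
  qed
  define u where "u n x = h' n x * ?c x" for n x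
  have u2: "sq_int lborel (u n)" for n unfolding u_def[abs_def] by (rule sq_int_chirp(1)[OF h2])
  have u1: "integrable lborel (u n)" for n
    unfolding u_def[abs_def] by (rule integrable_mult_bounded[OF h1, where C = 1]) auto
  have m: "mfrft_L1 \<alpha> lam (h n) \<xi> = ?k * ?c \<xi> * fourier (u n) (?D * \<xi>)" for n \<xi>
    unfolding u_def[abs_def] by (rule mfrft_L1_eq_fourier[OF h' hl])
  have m2: "sq_int lborel (mfrft_L1 \<alpha> lam (h n))" for n
  proof -
    have "sq_int lborel (\<lambda>\<xi>. ?k * fourier (u n) (?D * \<xi>) * ?c \<xi>)"
      by (intro sq_int_chirp(1) sq_int_cmult sq_int_diag(1)[OF D] Plancherel_L1_L2(1)[OF u1 u2])
    then show ?thesis unfolding m[abs_def] by (simp only: mult_ac)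
  qed
  define G where "G \<xi> = inverse ?k * (g' \<xi> * chirp \<alpha> (- lam\<^sup>2) \<xi>)" for \<xi>
  have G2: "sq_int lborel G" unfolding G_def[abs_def] by (intro sq_int_cmult sq_int_chirp g2)
  have G: "?k * ?c \<xi> * G \<xi> = g' \<xi>" for \<xi>
  proof -
    have "?k * ?c \<xi> * G \<xi> = (?k * inverse ?k) * (chirp \<alpha> (- lam\<^sup>2) \<xi> * ?c \<xi>) * g' \<xi>"
      unfolding G_def by (simp only: mult_ac)
    then show ?thesis by (simp only: right_inverse[OF mfrft_const_nonzero] chirp_minus_mult mult_1)
  qed
  define \<gamma> where "\<gamma> \<eta> = G (?E * \<eta>)" for \<eta>
  show thesis
  proof
    show "fourier_L2 (\<lambda>x. f' x * ?c x) \<gamma>"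
    proof (rule fourier_L2I[where h = u])
      show "(\<lambda>n. norm2 lborel (\<lambda>x. u n x - f' x * ?c x)) \<longlonglongrightarrow> 0"
        unfolding u_def left_diff_distrib[symmetric] sq_int_chirp(2)[OF sq_int_diff[OF h2 f2]]
        using lim(1) L2_tendsto_iff[OF h2 h'(2) f2 f'] by simp
      have "(\<lambda>n. norm2 lborel (\<lambda>x. mfrft_L1 \<alpha> lam (h n) x - g' x)) \<longlonglongrightarrow> 0"
        using lim(2) unfolding L2_tendsto_iff[OF m2 AE_I2[OF refl] g2 g'(2)] .
      moreover have "norm2 lborel (\<lambda>\<eta>. fourier (u n) \<eta> - \<gamma> \<eta>)
          = cmod (inverse ?k) * (norm2 lborel (\<lambda>x. mfrft_L1 \<alpha> lam (h n) x - g' x) / sqrt (prod_abs ?E))" for n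
      proof -
        define v where "v \<xi> = mfrft_L1 \<alpha> lam (h n) \<xi> - g' \<xi>" for \<xi>
        have v: "sq_int lborel v" unfolding v_def[abs_def] by (rule sq_int_diff[OF m2 g2])
        have "fourier (u n) \<eta> - \<gamma> \<eta> = inverse ?k * (v (?E * \<eta>) * chirp \<alpha> (- lam\<^sup>2) (?E * \<eta>))" for \<eta>
        proof -
          have "v (?E * \<eta>) = ?k * ?c (?E * \<eta>) * (fourier (u n) \<eta> - \<gamma> \<eta>)"
            unfolding v_def m \<gamma>_def G[symmetric] DE by (simp add: algebra_simps)
          then have "inverse ?k * (v (?E * \<eta>) * chirp \<alpha> (- lam\<^sup>2) (?E * \<eta>))
              = (?k * inverse ?k) * (chirp \<alpha> (- lam\<^sup>2) (?E * \<eta>) * ?c (?E * \<eta>)) * (fourier (u n) \<eta> - \<gamma> \<eta>)"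
            by (simp only: mult_ac)
          then show ?thesis by (simp only: right_inverse[OF mfrft_const_nonzero] chirp_minus_mult mult_1)
        qed
        then have "norm2 lborel (\<lambda>\<eta>. fourier (u n) \<eta> - \<gamma> \<eta>) = cmod (inverse ?k) * norm2 lborel (\<lambda>\<eta>. v (?E * \<eta>) * chirp \<alpha> (- lam\<^sup>2) (?E * \<eta>))"
          by (simp only: norm2_cmult)
        also have "norm2 lborel (\<lambda>\<eta>. v (?E * \<eta>) * chirp \<alpha> (- lam\<^sup>2) (?E * \<eta>)) = norm2 lborel v / sqrt (prod_abs ?E)"
          by (rule trans[OF sq_int_diag(2)[OF E sq_int_chirp(1)[OF v]]]) (simp only: sq_int_chirp(2)[OF v])
        finally show ?thesis unfolding v_def[abs_def] .
      qed
      ultimately show "(\<lambda>n. norm2 lborel (\<lambda>\<eta>. fourier (u n) \<eta> - \<gamma> \<eta>)) \<longlonglongrightarrow> 0"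
        by (simp only:) (intro tendsto_mult_right_zero tendsto_divide_zero)
    qed (use u1 u2 sq_int_chirp(1)[OF f2] sq_int_diag(1)[OF E G2] in \<open>auto simp: \<gamma>_def[abs_def]\<close>)
    show "AE \<xi> in lborel. cmod (g \<xi>) = cmod ?k * cmod (\<gamma> (?D * \<xi>))"
      using g'(2)
    proof eventually_elim
      case (elim \<xi>)
      show ?case unfolding elim \<gamma>_def ED G[symmetric] by (simp add: norm_mult)
    qed
  qed
qed

section \<open>The uncertainty inequality for the fractional wavelet transform\<close>

text \<open>
  All chirps can be absorbed: one belongs to \<open>f\<close>, one to \<open>\<psi>\<close>, and the one in \<open>b\<close> has modulus one.
\<close>

lemma mfrwt_eq_wavelet_coeff:
  fixes \<psi> f :: "real ^ 'n \<Rightarrow> complex"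
  assumes a: "a \<in> nonzero_vecs"
    and f: "f \<in> borel_measurable lebesgue" "f' \<in> borel_measurable borel" "AE x in lborel. f x = f' x"
    and \<psi>: "\<psi> \<in> borel_measurable lebesgue" "\<psi>' \<in> borel_measurable borel" "AE x in lborel. \<psi> x = \<psi>' x"
  shows "cmod (mfrwt \<alpha> lam \<psi> f a b) = cmod (c_vec \<alpha>) *
    cmod (wavelet_coeff (\<lambda>x. \<psi>' x * chirp \<alpha> (lam\<^sup>2) x) (\<lambda>x. f' x * chirp \<alpha> (lam\<^sup>2) x) a b)"
proof -
  let ?c = "chirp \<alpha> (lam\<^sup>2)"
  let ?T = "\<lambda>t. vec_div (t - b) a"
  let ?F = "\<lambda>t. f t * ?c t * cnj (\<psi> (?T t) * ?c (?T t))"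
  let ?F' = "\<lambda>t. f' t * ?c t * cnj (\<psi>' (?T t) * ?c (?T t))"
  note [measurable] = f(2) \<psi>(2)
  have cl: "?c \<in> borel_measurable lebesgue" by (rule measurable_completion) simp
  have T: "?T \<in> lebesgue \<rightarrow>\<^sub>M lebesgue"
    unfolding vec_div_diff_eq by (rule lebesgue_diag_measurable[OF vec_inverse_nonzero[OF a]])
  have m1: "(\<lambda>t. ?F t) \<in> borel_measurable lebesgue"
    using measurable_compose[OF T \<psi>(1)] measurable_compose[OF T cl] f(1) cl
    by (intro borel_measurable_times borel_measurable_cnj)
  have m2: "(\<lambda>t. ?F' t) \<in> borel_measurable lborel"
    by measurable
  have AE2: "AE t in lborel. \<psi> (?T t) = \<psi>' (?T t)"
    unfolding vec_div_diff_eq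
    by (rule AE_lborel_diag[OF vec_inverse_nonzero[OF a] AE_lborel_shift[OF \<psi>(3)]])
  have I: "(LINT t|lebesgue. ?F t)
      = (LINT t|lborel. ?F' t)"
  proof -
    have "(LINT t|lebesgue. ?F t)
      = (LINT t|lebesgue. ?F' t)"
    proof (rule integral_cong_AE[OF m1 measurable_completion[OF m2]])
      show "AE t in lebesgue. ?F t = ?F' t"
        using AE_completion[OF f(3)] AE_completion[OF AE2] by eventually_elim simp
    qed
    then show ?thesis using integral_completion[OF m2] by simp
  qed
  have "f t * cnj (wavelet_family \<alpha> lam \<psi> a b t)
      = c_vec \<alpha> * cnj (?c b) * of_real (1 / sqrt (prod_abs a)) * (?F t)" for t
    unfolding wavelet_family_def tilde_wavelet_def complex_cnj_mult complex_cnj_cnj cnj_chirp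
      complex_cnj_complex_of_real minus_minus by (simp only: mult_ac)
  then have "mfrwt \<alpha> lam \<psi> f a b = c_vec \<alpha> * cnj (?c b) * of_real (1 / sqrt (prod_abs a)) *
      (LINT t|lebesgue. ?F t)"
    unfolding mfrwt_def by (simp only: integral_mult_right_zero)
  also have "\<dots> = c_vec \<alpha> * cnj (?c b) * wavelet_coeff (\<lambda>x. \<psi>' x * ?c x) (\<lambda>x. f' x * ?c x) a b"
    unfolding I wavelet_coeff_def by (simp only: mult.assoc)
  finally show ?thesis by (simp only: norm_mult complex_mod_cnj norm_chirp mult_1_right)
qed

lemma mfrwt_second_moment:
  fixes \<psi> f \<psi>' f' :: "real ^ 'n \<Rightarrow> complex" and \<alpha> :: "real ^ 'n" and lam :: real
  defines "g \<equiv> (\<lambda>x. f' x * chirp \<alpha> (lam\<^sup>2) x)" and "\<phi> \<equiv> (\<lambda>x. \<psi>' x * chirp \<alpha> (lam\<^sup>2) x)"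
  assumes f: "f \<in> borel_measurable lebesgue" "f' \<in> borel_measurable borel" "AE x in lborel. f x = f' x"
    and \<psi>: "\<psi> \<in> borel_measurable lebesgue" "\<psi>' \<in> borel_measurable borel" "AE x in lborel. \<psi> x = \<psi>' x"
  shows "(\<integral>\<^sup>+a\<in>nonzero_vecs.
             (\<integral>\<^sup>+b. ennreal ((norm b)\<^sup>2 * (cmod (mfrwt \<alpha> lam \<psi> f a b))\<^sup>2) \<partial>lebesgue)
             * ennreal (1 / (prod_abs a)\<^sup>2) \<partial>lebesgue)
    = ennreal ((cmod (c_vec \<alpha>))\<^sup>2) * (\<integral>\<^sup>+x. ennreal ((norm (snd x))\<^sup>2 * (cmod (weighted_coeff \<phi> g x))\<^sup>2) \<partial>lborel)"
proof -
  let ?m = "\<lambda>a b. (norm b)\<^sup>2 * (cmod (mfrwt \<alpha> lam \<psi> f a b))\<^sup>2"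
  let ?h = "\<lambda>a b. (norm b)\<^sup>2 * (cmod (weighted_coeff \<phi> g (a, b)))\<^sup>2"
  note [measurable] = f(2) \<psi>(2)
  have gm[measurable]: "g \<in> borel_measurable borel" "\<phi> \<in> borel_measurable borel"
    unfolding g_def \<phi>_def by measurable
  have Hm: "weighted_coeff \<phi> g \<in> borel_measurable (borel \<Otimes>\<^sub>M borel)"
    using weighted_coeff_measurable[OF gm(2,1)] by (simp add: borel_prod)
  then have Fm: "(\<lambda>x. ennreal ((norm (snd x))\<^sup>2 * (cmod (weighted_coeff \<phi> g x))\<^sup>2)) \<in> borel_measurable (borel \<Otimes>\<^sub>M borel)"
    by measurable
  have Hb: "(\<lambda>b. weighted_coeff \<phi> g (a, b)) \<in> borel_measurable borel" for a
    using measurable_compose[OF measurable_Pair1' Hm] by simp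
  have "(\<integral>\<^sup>+b. ennreal (?m a b) \<partial>lebesgue)
           * ennreal (1 / (prod_abs a)\<^sup>2) * indicator nonzero_vecs a
      = ennreal ((cmod (c_vec \<alpha>))\<^sup>2) * (\<integral>\<^sup>+b. ennreal (?h a b) \<partial>lborel)" for a
  proof (cases "a \<in> nonzero_vecs")
    case False
    then have "weighted_coeff \<phi> g (a, b) = 0" for b by (simp add: weighted_coeff_def nonzero_vecs_def)
    then show ?thesis using False by simp
  next
    case True
    have p: "prod_abs a > 0" by (rule prod_abs_pos[OF True])
    have w: "?m a b = ((cmod (c_vec \<alpha>))\<^sup>2 * (prod_abs a)\<^sup>2) * (?h a b)" for b
    proof -
      have "cmod (mfrwt \<alpha> lam \<psi> f a b) = cmod (c_vec \<alpha>) * cmod (wavelet_coeff \<phi> g a b)"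
        unfolding \<phi>_def g_def by (rule mfrwt_eq_wavelet_coeff[OF True f \<psi>])
      also have "cmod (wavelet_coeff \<phi> g a b) = prod_abs a * cmod (weighted_coeff \<phi> g (a, b))"
        using p by (simp add: weighted_coeff_def norm_divide)
      finally have e: "cmod (mfrwt \<alpha> lam \<psi> f a b) = cmod (c_vec \<alpha>) * (prod_abs a * cmod (weighted_coeff \<phi> g (a, b)))" .
      show ?thesis unfolding e power_mult_distrib by (simp only: mult_ac)
    qed
    have "(\<integral>\<^sup>+b. ennreal (?m a b) \<partial>lebesgue)
       = (\<integral>\<^sup>+b. ennreal ((cmod (c_vec \<alpha>))\<^sup>2 * (prod_abs a)\<^sup>2) * ennreal (?h a b) \<partial>lborel)"
      unfolding nn_integral_completion w by (intro nn_integral_cong ennreal_mult) auto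
    also have "\<dots> = ennreal ((cmod (c_vec \<alpha>))\<^sup>2 * (prod_abs a)\<^sup>2) * (\<integral>\<^sup>+b. ennreal (?h a b) \<partial>lborel)"
      using Hb[of a] by (intro nn_integral_cmult) measurable
    finally have e: "(\<integral>\<^sup>+b. ennreal (?m a b) \<partial>lebesgue)
      = ennreal ((cmod (c_vec \<alpha>))\<^sup>2 * (prod_abs a)\<^sup>2) * (\<integral>\<^sup>+b. ennreal (?h a b) \<partial>lborel)" .
    have e2: "ennreal ((cmod (c_vec \<alpha>))\<^sup>2 * (prod_abs a)\<^sup>2) * ennreal (1 / (prod_abs a)\<^sup>2) = ennreal ((cmod (c_vec \<alpha>))\<^sup>2)"
      using p by (subst ennreal_mult[symmetric]) auto
    have swap: "x * y * z = x * z * y" for x y z :: ennreal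
      by (simp only: mult_ac)
    show ?thesis
      unfolding e using True by (simp only: indicator_simps mult_1_right swap[of _ _ "ennreal (1 / (prod_abs a)\<^sup>2)"] e2)
  qed
  then have "(\<integral>\<^sup>+a\<in>nonzero_vecs.
           (\<integral>\<^sup>+b. ennreal (?m a b) \<partial>lebesgue)
           * ennreal (1 / (prod_abs a)\<^sup>2) \<partial>lebesgue)
     = (\<integral>\<^sup>+a. ennreal ((cmod (c_vec \<alpha>))\<^sup>2) * (\<integral>\<^sup>+b. ennreal (?h a b) \<partial>lborel) \<partial>lborel)"
    unfolding nn_integral_completion[of lborel "\<lambda>a. _ a * indicator nonzero_vecs a"] by (simp only:)
  also have "\<dots> = ennreal ((cmod (c_vec \<alpha>))\<^sup>2) * (\<integral>\<^sup>+a. \<integral>\<^sup>+b. ennreal (?h a b) \<partial>lborel \<partial>lborel)"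
    using lborel.borel_measurable_nn_integral_fst[of "\<lambda>x. ennreal ((norm (snd x))\<^sup>2 * (cmod (weighted_coeff \<phi> g x))\<^sup>2)" lborel] Fm
    by (intro nn_integral_cmult) (simp add: lborel_prod borel_prod)
  also have "(\<integral>\<^sup>+a. \<integral>\<^sup>+b. ennreal (?h a b) \<partial>lborel \<partial>lborel)
      = (\<integral>\<^sup>+x. ennreal ((norm (snd x))\<^sup>2 * (cmod (weighted_coeff \<phi> g x))\<^sup>2) \<partial>lborel)"
    unfolding lborel_prod[symmetric]
    using lborel.nn_integral_fst[of "\<lambda>x. ennreal ((norm (snd x))\<^sup>2 * (cmod (weighted_coeff \<phi> g x))\<^sup>2)" lborel] Fm
    by (simp add: lborel_prod borel_prod)
  finally show ?thesis .
qed

lemma admissibility_integral: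
  fixes D :: "real ^ 'n"
  assumes D: "D \<in> nonzero_vecs" and \<omega>[measurable]: "\<omega> \<in> borel_measurable borel"
    and mAE: "AE \<xi> in lborel. cmod (m \<xi>) = \<kappa> * cmod (\<omega> (D * \<xi>))"
  shows "(\<integral>\<^sup>+u\<in>nonzero_vecs. ennreal ((cmod (m u))\<^sup>2 / prod_abs u) \<partial>lebesgue)
    = ennreal (\<kappa>\<^sup>2) * (\<integral>\<^sup>+u. ennreal ((cmod (\<omega> u))\<^sup>2 / prod_abs u) \<partial>lborel)"
    (is "?R = _")
proof -
  have "?R = (\<integral>\<^sup>+u. ennreal (\<kappa>\<^sup>2) * ennreal ((cmod (\<omega> (u * D)))\<^sup>2 / prod_abs u) \<partial>lborel)"
    unfolding nn_integral_completion
  proof (rule nn_integral_cong_AE)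
    show "AE u in lborel. ennreal ((cmod (m u))\<^sup>2 / prod_abs u) * indicator nonzero_vecs u
        = ennreal (\<kappa>\<^sup>2) * ennreal ((cmod (\<omega> (u * D)))\<^sup>2 / prod_abs u)"
      using mAE AE_nonzero_vecs
    proof eventually_elim
      case (elim u)
      have "(cmod (m u))\<^sup>2 / prod_abs u = \<kappa>\<^sup>2 * ((cmod (\<omega> (u * D)))\<^sup>2 / prod_abs u)"
        unfolding elim(1) by (simp add: power_mult_distrib mult.commute[of u])
      also have "ennreal \<dots> = ennreal (\<kappa>\<^sup>2) * ennreal ((cmod (\<omega> (u * D)))\<^sup>2 / prod_abs u)"
        using prod_abs_nonneg[of u] by (intro ennreal_mult) auto
      finally show ?case using elim(2) by (simp only: indicator_simps mult_1_right)
    qed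
  qed
  also have "\<dots> = ennreal (\<kappa>\<^sup>2) * (\<integral>\<^sup>+u. ennreal ((cmod (\<omega> (u * D)))\<^sup>2 / prod_abs u) \<partial>lborel)"
    by (rule nn_integral_cmult) measurable
  finally show ?thesis
    unfolding scale_integral_invariant[OF \<omega> D] .
qed

lemma M_sq_ge:
  fixes \<alpha> :: "real ^ 'n"
  assumes "\<And>k. sin (\<alpha> $ k) \<noteq> 0"
  shows "M_sq \<alpha> > 0" "1 / M_sq \<alpha> \<le> (sin (\<alpha> $ k))\<^sup>2"
proof -
  have le: "1 / (sin (\<alpha> $ k))\<^sup>2 \<le> M_sq \<alpha>" for k
    unfolding M_sq_def by (rule Max_ge) auto
  have p: "(sin (\<alpha> $ k))\<^sup>2 > 0" for k using assms[of k] by simp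
  show M: "M_sq \<alpha> > 0"
    using le[of undefined] p[of undefined] by (meson divide_pos_pos less_le_trans zero_less_one)
  have "1 \<le> M_sq \<alpha> * (sin (\<alpha> $ k))\<^sup>2"
    using le[of k] p[of k] by (simp only: pos_divide_le_eq)
  then show "1 / M_sq \<alpha> \<le> (sin (\<alpha> $ k))\<^sup>2"
    using M by (simp only: pos_divide_le_eq mult.commute)
qed

text \<open>
  The source of \<open>M_sq\<close>: undoing the frequency scaling multiplies the component \<open>\<eta>\<^sub>k\<close> by
  \<open>sin \<alpha>\<^sub>k / \<lambda>\<^sup>2\<close>, and \<open>1 / M_sq \<alpha>\<close> is the least of the \<open>sin\<^sup>2 \<alpha>\<^sub>k\<close>.
\<close>

lemma norm_vec_inverse_freq_scale_ge:
  fixes \<alpha> \<eta> :: "real ^ 'n"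
  assumes lam: "lam \<noteq> 0" and s: "\<And>k. sin (\<alpha> $ k) \<noteq> 0"
  shows "(norm \<eta>)\<^sup>2 / (M_sq \<alpha> * (lam\<^sup>2)\<^sup>2) \<le> (norm (vec_inverse (freq_scale \<alpha> lam) * \<eta>))\<^sup>2"
proof -
  have n: "(norm v)\<^sup>2 = (\<Sum>k\<in>UNIV. (v $ k)\<^sup>2)" for v :: "real ^ 'n"
    unfolding power2_norm_eq_inner inner_vec_def by (simp add: power2_eq_square)
  have "(\<eta> $ k)\<^sup>2 / (M_sq \<alpha> * (lam\<^sup>2)\<^sup>2) \<le> ((vec_inverse (freq_scale \<alpha> lam) * \<eta>) $ k)\<^sup>2" for k
  proof -
    have "(\<eta> $ k)\<^sup>2 / (M_sq \<alpha> * (lam\<^sup>2)\<^sup>2) = (\<eta> $ k)\<^sup>2 / (lam\<^sup>2)\<^sup>2 * (1 / M_sq \<alpha>)" by simp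
    also have "\<dots> \<le> (\<eta> $ k)\<^sup>2 / (lam\<^sup>2)\<^sup>2 * (sin (\<alpha> $ k))\<^sup>2"
      by (intro mult_left_mono M_sq_ge[OF s]) simp
    also have "\<dots> = ((vec_inverse (freq_scale \<alpha> lam) * \<eta>) $ k)\<^sup>2"
      by (simp add: vec_inverse_def freq_scale_def power_mult_distrib power_divide)
    finally show ?thesis .
  qed
  then show ?thesis
    unfolding n sum_divide_distrib by (rule sum_mono)
qed

lemma prod_abs_freq_scale:
  fixes \<alpha> :: "real ^ 'n"
  shows "prod_abs (freq_scale \<alpha> lam) = (lam\<^sup>2) ^ CARD('n) / prod_abs (sin_vec \<alpha>)"
  by (simp add: prod_abs_def freq_scale_def sin_vec_def abs_prod prod_dividef)

text \<open>
  Substituting the scaled frequency costs the Jacobian, which combines with \<open>\<bar>c(\<alpha>)\<bar>\<^sup>2\<close> to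
  \<open>(\<lambda>\<^sup>2)\<^sup>-\<^sup>N\<close>; \<open>norm_vec_inverse_freq_scale_ge\<close> contributes the remaining \<open>(\<lambda>\<^sup>2)\<^sup>-\<^sup>2 / M_sq \<alpha>\<close>.
\<close>

lemma mfrft_second_moment_ge:
  fixes \<alpha> :: "real ^ 'n"
  assumes lam: "lam \<noteq> 0" and s: "\<And>k. sin (\<alpha> $ k) \<noteq> 0"
    and [measurable]: "\<gamma> \<in> borel_measurable borel"
    and mAE: "AE \<xi> in lborel. cmod (m \<xi>) = cmod (mfrft_const \<alpha>) * cmod (\<gamma> (freq_scale \<alpha> lam * \<xi>))"
  shows "ennreal (1 / (M_sq \<alpha> * (lam\<^sup>2) ^ (CARD('n) + 2))) * (ennreal (1 / (2 * pi) ^ CARD('n)) *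
        (\<integral>\<^sup>+\<eta>. ennreal ((norm \<eta>)\<^sup>2 * (cmod (\<gamma> \<eta>))\<^sup>2) \<partial>lborel))
      \<le> (\<integral>\<^sup>+\<xi>. ennreal ((norm \<xi>)\<^sup>2 * (cmod (m \<xi>))\<^sup>2) \<partial>lebesgue)"
    (is "_ * (_ * ?B) \<le> _")
proof -
  let ?D = "freq_scale \<alpha> lam" and ?k = "mfrft_const \<alpha>" and ?m = "1 / (M_sq \<alpha> * (lam\<^sup>2)\<^sup>2)" and ?N = "CARD('n)"
  have D: "?D \<in> nonzero_vecs" by (rule freq_scale_nonzero[OF lam s])
  have Dp: "prod_abs ?D > 0" by (rule prod_abs_pos[OF D])
  have L: "lam\<^sup>2 > 0" using lam by simp
  have cs: "(cmod (c_vec \<alpha>))\<^sup>2 * prod_abs (sin_vec \<alpha>) = 1" by (rule norm_c_vec[OF s])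
  have Mp: "M_sq \<alpha> > 0" by (rule M_sq_ge(1)[OF s])
  define F where "F \<eta> = ennreal ((norm (vec_inverse ?D * \<eta>))\<^sup>2 * (cmod (\<gamma> \<eta>))\<^sup>2)" for \<eta>
  have Fm[measurable]: "F \<in> borel_measurable borel" unfolding F_def[abs_def] by measurable
  have ED: "vec_inverse ?D * (?D * \<eta>) = \<eta>" for \<eta> using vec_div_times[OF D] by (simp add: vec_div_vec_inverse)
  have "(\<integral>\<^sup>+\<xi>. ennreal ((norm \<xi>)\<^sup>2 * (cmod (m \<xi>))\<^sup>2) \<partial>lebesgue)
     = (\<integral>\<^sup>+\<xi>. ennreal ((cmod ?k)\<^sup>2) * F (?D * \<xi>) \<partial>lborel)"
    unfolding nn_integral_completion
  proof (rule nn_integral_cong_AE)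
    show "AE \<xi> in lborel. ennreal ((norm \<xi>)\<^sup>2 * (cmod (m \<xi>))\<^sup>2) = ennreal ((cmod ?k)\<^sup>2) * F (?D * \<xi>)"
      using mAE
    proof eventually_elim
      case (elim \<xi>)
      show ?case unfolding F_def ED elim by (subst ennreal_mult[symmetric]) (simp_all add: power_mult_distrib)
    qed
  qed
  also have "\<dots> = ennreal ((cmod ?k)\<^sup>2) * (\<integral>\<^sup>+\<xi>. F (?D * \<xi>) \<partial>lborel)"
    by (rule nn_integral_cmult) measurable
  also have "(\<integral>\<^sup>+\<xi>. F (?D * \<xi>) \<partial>lborel) = ennreal (1 / prod_abs ?D) * (\<integral>\<^sup>+\<eta>. F \<eta> \<partial>lborel)"
  proof -
    have "ennreal (1 / prod_abs ?D) * (\<integral>\<^sup>+\<eta>. F \<eta> \<partial>lborel)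
        = (ennreal (1 / prod_abs ?D) * ennreal (prod_abs ?D)) * (\<integral>\<^sup>+\<xi>. F (?D * \<xi>) \<partial>lborel)"
      unfolding mult.assoc by (rule arg_cong[OF nn_integral_diag[OF D]]) measurable
    also have "ennreal (1 / prod_abs ?D) * ennreal (prod_abs ?D) = 1"
      using Dp by (subst ennreal_mult[symmetric]) auto
    finally show ?thesis by simp
  qed
  finally have eq: "(\<integral>\<^sup>+\<xi>. ennreal ((norm \<xi>)\<^sup>2 * (cmod (m \<xi>))\<^sup>2) \<partial>lebesgue)
    = ennreal ((cmod ?k)\<^sup>2) * (ennreal (1 / prod_abs ?D) * (\<integral>\<^sup>+\<eta>. F \<eta> \<partial>lborel))" .
  have "ennreal ?m * ?B = (\<integral>\<^sup>+\<eta>. ennreal ?m * ennreal ((norm \<eta>)\<^sup>2 * (cmod (\<gamma> \<eta>))\<^sup>2) \<partial>lborel)"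
    by (rule nn_integral_cmult[symmetric]) measurable
  also have "\<dots> \<le> (\<integral>\<^sup>+\<eta>. F \<eta> \<partial>lborel)"
  proof (rule nn_integral_mono)
    fix \<eta>
    have "?m * ((norm \<eta>)\<^sup>2 * (cmod (\<gamma> \<eta>))\<^sup>2) = (norm \<eta>)\<^sup>2 / (M_sq \<alpha> * (lam\<^sup>2)\<^sup>2) * (cmod (\<gamma> \<eta>))\<^sup>2" by simp
    also have "\<dots> \<le> (norm (vec_inverse ?D * \<eta>))\<^sup>2 * (cmod (\<gamma> \<eta>))\<^sup>2"
      by (intro mult_right_mono norm_vec_inverse_freq_scale_ge[OF lam s]) simp
    finally show "ennreal ?m * ennreal ((norm \<eta>)\<^sup>2 * (cmod (\<gamma> \<eta>))\<^sup>2) \<le> F \<eta>"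
      unfolding F_def using Mp L by (subst ennreal_mult[symmetric]) (auto intro: ennreal_leI)
  qed
  finally have mB: "ennreal ?m * ?B \<le> (\<integral>\<^sup>+\<eta>. F \<eta> \<partial>lborel)" .
  have const: "1 / (M_sq \<alpha> * (lam\<^sup>2) ^ (?N + 2)) * (1 / (2 * pi) ^ ?N) = (cmod ?k)\<^sup>2 * (1 / prod_abs ?D * ?m)"
  proof -
    have "(cmod ?k)\<^sup>2 * (1 / prod_abs ?D * ?m)
      = ((cmod (c_vec \<alpha>))\<^sup>2 * prod_abs (sin_vec \<alpha>)) * (1 / (2 * pi) ^ ?N * (1 / (lam\<^sup>2) ^ ?N * ?m))"
      unfolding norm_mfrft_const prod_abs_freq_scale by simp
    also have "\<dots> = 1 / (M_sq \<alpha> * (lam\<^sup>2) ^ (?N + 2)) * (1 / (2 * pi) ^ ?N)"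
      unfolding cs power_add by simp
    finally show ?thesis by simp
  qed
  have "ennreal (1 / (M_sq \<alpha> * (lam\<^sup>2) ^ (?N + 2))) * (ennreal (1 / (2 * pi) ^ ?N) * ?B)
      = ennreal (1 / (M_sq \<alpha> * (lam\<^sup>2) ^ (?N + 2)) * (1 / (2 * pi) ^ ?N)) * ?B"
    using Mp L by (subst ennreal_mult) (auto simp: mult.assoc)
  also have "\<dots> = ennreal ((cmod ?k)\<^sup>2) * (ennreal (1 / prod_abs ?D) * (ennreal ?m * ?B))"
  proof -
    have n: "0 \<le> (cmod ?k)\<^sup>2" "0 \<le> 1 / prod_abs ?D" "0 \<le> ?m" using Mp Dp by auto
    show ?thesis
      unfolding const ennreal_mult[OF n(1) mult_nonneg_nonneg[OF n(2,3)]] ennreal_mult[OF n(2,3)] mult.assoc ..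
  qed
  also have "\<dots> \<le> ennreal ((cmod ?k)\<^sup>2) * (ennreal (1 / prod_abs ?D) * (\<integral>\<^sup>+\<eta>. F \<eta> \<partial>lborel))"
    by (intro mult_left_mono mB) auto
  finally show ?thesis unfolding eq .
qed

theorem theorem4p1:
  fixes \<alpha> :: "real ^ 'n" and lam :: real
    and \<psi> f :: "real ^ 'n \<Rightarrow> complex"
  assumes "lam \<noteq> 0"
    and "\<And>k. \<alpha> $ k \<in> {-pi<..<pi} - {0}"
    and "admissible_wavelet \<alpha> lam \<psi>"
    and "square_integrable f"
  shows "(\<integral>\<^sup>+a\<in>nonzero_vecs.
             (\<integral>\<^sup>+b. ennreal ((norm b)\<^sup>2 * (cmod (mfrwt \<alpha> lam \<psi> f a b))\<^sup>2) \<partial>lebesgue)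
             * ennreal (1 / (prod_abs a)\<^sup>2) \<partial>lebesgue)
         * (\<integral>\<^sup>+\<xi>. ennreal ((norm \<xi>)\<^sup>2 * (cmod (mfrft \<alpha> lam f \<xi>))\<^sup>2) \<partial>lebesgue)
       \<ge> ennreal (P_const \<alpha> lam * C_const \<alpha> lam \<psi> * (real CARD('n))\<^sup>2 / 4 * L2_norm f ^ 4)"
proof -
  have s: "sin (\<alpha> $ k) \<noteq> 0" for k
    using assms(2)[of k] sin_gt_zero[of "\<alpha> $ k"] sin_gt_zero[of "- (\<alpha> $ k)"]
    by (cases "\<alpha> $ k > 0") auto
  let ?c = "chirp \<alpha> (lam\<^sup>2)" and ?D = "freq_scale \<alpha> lam" and ?k = "mfrft_const \<alpha>"
  have D: "?D \<in> nonzero_vecs" by (rule freq_scale_nonzero[OF assms(1) s])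
  have L: "lam\<^sup>2 > 0" using assms(1) by simp
  have \<psi>: "square_integrable \<psi>" and f: "square_integrable f"
    and adm: "(\<integral>\<^sup>+u\<in>nonzero_vecs. ennreal ((cmod (mfrft \<alpha> lam \<psi> u))\<^sup>2 / prod_abs u) \<partial>lebesgue) < \<infinity>"
    using assms(3,4) by (auto simp: admissible_wavelet_def)
  have fl: "f \<in> borel_measurable lebesgue" and \<psi>l: "\<psi> \<in> borel_measurable lebesgue"
    using f \<psi> by (auto simp: square_integrable_def)
  obtain f' where f': "f' \<in> borel_measurable borel" "AE x in lborel. f x = f' x"
    using Borel_representative[OF fl] by blast
  obtain \<psi>' where \<psi>': "\<psi>' \<in> borel_measurable borel" "AE x in lborel. \<psi> x = \<psi>' x"
    using Borel_representative[OF \<psi>l] by blast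
  note f2 = square_integrable_representative[OF f f'] and \<psi>2 = square_integrable_representative[OF \<psi> \<psi>']
  have Mf: "is_mfrft \<alpha> lam f (mfrft \<alpha> lam f)" and M\<psi>: "is_mfrft \<alpha> lam \<psi> (mfrft \<alpha> lam \<psi>)"
    unfolding mfrft_def by (rule someI_ex[OF is_mfrft_exists[OF D f]], rule someI_ex[OF is_mfrft_exists[OF D \<psi>]])
  define g where "g x = f' x * ?c x" for x
  define \<phi> where "\<phi> x = \<psi>' x * ?c x" for x
  obtain \<gamma> where \<gamma>: "fourier_L2 g \<gamma>" and \<gamma>AE: "AE \<xi> in lborel. cmod (mfrft \<alpha> lam f \<xi>) = cmod ?k * cmod (\<gamma> (?D * \<xi>))"
    using is_mfrft_imp_fourier_L2[OF D Mf f2(1) f'(2)] unfolding g_def[abs_def] by blast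
  obtain \<omega> where \<omega>: "fourier_L2 \<phi> \<omega>" and \<omega>AE: "AE \<xi> in lborel. cmod (mfrft \<alpha> lam \<psi> \<xi>) = cmod ?k * cmod (\<omega> (?D * \<xi>))"
    using is_mfrft_imp_fourier_L2[OF D M\<psi> \<psi>2(1) \<psi>'(2)] unfolding \<phi>_def[abs_def] by blast
  note [measurable] = fourier_L2_measurable[OF \<gamma>] fourier_L2_measurable[OF \<omega>]
  have gL: "norm2 lborel g = L2_norm f"
    unfolding g_def[abs_def] sq_int_chirp(2)[OF f2(1)] by (rule f2(2))
  have kp: "cmod ?k > 0" using mfrft_const_nonzero[of \<alpha>] by simp

  \<comment> \<open>\<open>R\<close> is the admissibility integral of \<open>\<psi>\<close>; being finite, it makes \<open>Q\<close>, hence \<open>K\<close>, finite.\<close>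
  define Q where "Q = (\<integral>\<^sup>+u. ennreal ((cmod (\<omega> u))\<^sup>2 / prod_abs u) \<partial>lborel)"
  define R where "R = (\<integral>\<^sup>+u\<in>nonzero_vecs. ennreal ((cmod (mfrft \<alpha> lam \<psi> u))\<^sup>2 / prod_abs u) \<partial>lebesgue)"
  have RQ: "R = ennreal ((cmod ?k)\<^sup>2) * Q"
    unfolding R_def Q_def by (rule admissibility_integral[OF D fourier_L2_measurable(2)[OF \<omega>] \<omega>AE])
  define K where "K = enn2real Q"
  have Qfin: "Q < \<infinity>"
    using adm kp unfolding R_def[symmetric] RQ by (auto simp: ennreal_mult_less_top less_top[symmetric] ennreal_mult_eq_top_iff)
  have K: "0 \<le> K" "(\<integral>\<^sup>+u. ennreal ((cmod (\<omega> u))\<^sup>2 / prod_abs u) \<partial>lborel) = ennreal K"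
    unfolding K_def using Qfin by (auto simp: Q_def[symmetric])
  have C: "C_const \<alpha> lam \<psi> = (cmod (c_vec \<alpha>))\<^sup>2 * K"
  proof -
    have ml: "mfrft \<alpha> lam \<psi> \<in> borel_measurable lebesgue"
      using M\<psi> by (simp add: is_mfrft_def square_integrable_def)
    have pl: "prod_abs \<in> borel_measurable lebesgue" by (rule measurable_completion) simp
    have il: "(\<lambda>u. indicator nonzero_vecs u :: real) \<in> borel_measurable lebesgue" by (rule measurable_completion) simp
    have "(LINT u:nonzero_vecs|lebesgue. (cmod (mfrft \<alpha> lam \<psi> u))\<^sup>2 / prod_abs u)
      = enn2real (\<integral>\<^sup>+u. ennreal (indicator nonzero_vecs u *\<^sub>R ((cmod (mfrft \<alpha> lam \<psi> u))\<^sup>2 / prod_abs u)) \<partial>lebesgue)"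
      unfolding set_lebesgue_integral_def
    proof (rule integral_eq_nn_integral)
      show "(\<lambda>u. indicator nonzero_vecs u *\<^sub>R ((cmod (mfrft \<alpha> lam \<psi> u))\<^sup>2 / prod_abs u)) \<in> borel_measurable lebesgue"
        using ml pl il by measurable
    qed (simp add: prod_abs_nonneg)
    also have "(\<integral>\<^sup>+u. ennreal (indicator nonzero_vecs u *\<^sub>R ((cmod (mfrft \<alpha> lam \<psi> u))\<^sup>2 / prod_abs u)) \<partial>lebesgue) = R"
      unfolding R_def by (intro nn_integral_cong) (simp add: indicator_def)
    also have "enn2real R = (cmod ?k)\<^sup>2 * K"
      unfolding RQ K_def by (simp add: enn2real_mult)
    finally show ?thesis
      unfolding C_const_def norm_mfrft_const by simp
  qed
  have cs: "(cmod (c_vec \<alpha>))\<^sup>2 * prod_abs (sin_vec \<alpha>) = 1" by (rule norm_c_vec[OF s])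
  have Mp: "M_sq \<alpha> > 0" by (rule M_sq_ge(1)[OF s])
  let ?N = "CARD('n)"

  \<comment> \<open>The two second moments for the ordinary transforms.\<close>
  define A where "A = (\<integral>\<^sup>+x. ennreal ((norm (snd x))\<^sup>2 * (cmod (weighted_coeff \<phi> g x))\<^sup>2) \<partial>lborel)"
  define B where "B = (\<integral>\<^sup>+\<eta>. ennreal ((norm \<eta>)\<^sup>2 * (cmod (\<gamma> \<eta>))\<^sup>2) \<partial>lborel)"
  have first: "(\<integral>\<^sup>+a\<in>nonzero_vecs.
             (\<integral>\<^sup>+b. ennreal ((norm b)\<^sup>2 * (cmod (mfrwt \<alpha> lam \<psi> f a b))\<^sup>2) \<partial>lebesgue)
             * ennreal (1 / (prod_abs a)\<^sup>2) \<partial>lebesgue) = ennreal ((cmod (c_vec \<alpha>))\<^sup>2) * A"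
    unfolding A_def g_def[abs_def] \<phi>_def[abs_def]
    by (rule mfrwt_second_moment[OF fl f' \<psi>l \<psi>'])
  have second: "ennreal (1 / (M_sq \<alpha> * (lam\<^sup>2) ^ (?N + 2))) * (ennreal (1 / (2 * pi) ^ ?N) * B)
      \<le> (\<integral>\<^sup>+\<xi>. ennreal ((norm \<xi>)\<^sup>2 * (cmod (mfrft \<alpha> lam f \<xi>))\<^sup>2) \<partial>lebesgue)"
    unfolding B_def by (rule mfrft_second_moment_ge[OF assms(1) s fourier_L2_measurable(2)[OF \<gamma>] \<gamma>AE])
  have P: "P_const \<alpha> lam = 1 / (M_sq \<alpha> * (lam\<^sup>2) ^ (?N + 2))"
    unfolding P_const_def cs ..
  have "ennreal (P_const \<alpha> lam * C_const \<alpha> lam \<psi> * (real ?N)\<^sup>2 / 4 * L2_norm f ^ 4)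
      = ennreal ((cmod (c_vec \<alpha>))\<^sup>2 * (P_const \<alpha> lam * (K * (real ?N)\<^sup>2 / 4 * norm2 lborel g ^ 4)))"
    unfolding C gL by (simp add: mult_ac)
  also have "\<dots> = ennreal ((cmod (c_vec \<alpha>))\<^sup>2) * (ennreal (P_const \<alpha> lam) * ennreal (K * (real ?N)\<^sup>2 / 4 * norm2 lborel g ^ 4))"
  proof -
    have n: "0 \<le> (cmod (c_vec \<alpha>))\<^sup>2" "0 \<le> P_const \<alpha> lam" "0 \<le> K * (real ?N)\<^sup>2 / 4 * norm2 lborel g ^ 4"
      using K(1) Mp L unfolding P by auto
    show ?thesis
      unfolding ennreal_mult[OF n(1) mult_nonneg_nonneg[OF n(2,3)]] ennreal_mult[OF n(2,3)] ..
  qed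
  also have "\<dots> \<le> ennreal ((cmod (c_vec \<alpha>))\<^sup>2) * (ennreal (P_const \<alpha> lam) * (A * (ennreal (1 / (2 * pi) ^ ?N) * B)))"
    using wavelet_uncertainty[OF \<gamma> \<omega> K] unfolding A_def B_def by (intro mult_left_mono) auto
  also have "\<dots> = ennreal ((cmod (c_vec \<alpha>))\<^sup>2) * A * (ennreal (P_const \<alpha> lam) * (ennreal (1 / (2 * pi) ^ ?N) * B))"
    by (simp only: mult_ac)
  also have "\<dots> \<le> ennreal ((cmod (c_vec \<alpha>))\<^sup>2) * A *
      (\<integral>\<^sup>+\<xi>. ennreal ((norm \<xi>)\<^sup>2 * (cmod (mfrft \<alpha> lam f \<xi>))\<^sup>2) \<partial>lebesgue)"
    using second unfolding P by (intro mult_left_mono) auto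
  finally show ?thesis unfolding first .
qed

end
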